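(* Let $(\Gamma,\mathrm d)$ be an $S$-compatible $N$-dimensional bicovariant first order differential calculus on a Hopf algebra $A$, and let $\mathcal C_\Gamma$ be its quantum Cartan algebra with its $\mathbb Z_2$-graded bialgebra structure. Let $S$ be the antipode of the dual Hopf algebra $H$ of $A$. The linear map $S_\Gamma:\mathcal C_\Gamma\to\mathcal C_\Gamma$ defined on generators by $$S_\Gamma(f_{ij})=S(f_{ij}),\qquad S_\Gamma(X_i)=-X_jS(f_{ji}),\qquad S_\Gamma(\xi_i)=-\xi_jS(f_{ji}),\qquad S_\Gamma(\delta)=-\delta,$$ and extended as a $\mathbb Z_2$-graded algebra and coalgebra anti-homomorphism, defines an invertible antipode on the bialgebra $\mathcal C_\Gamma$, so that $\mathcal C_\Gamma$ becomes a $\mathbb Z_2$-graded Hopf algebra.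
   Context: Summation over repeated indices is understood; indices run in $\{1,\dots,N\}$; $\delta_{ij}$ is the Kronecker symbol, while $\delta$ without indices is an algebra generator. Calculus. $A$ is a unital complex Hopf algebra with invertible antipode, $H$ its dual Hopf algebra. $(\Gamma,\mathrm d)$ is a bicovariant first order differential calculus in the sense of Woronowicz: $\Gamma$ is an $A$-bimodule, $\mathrm d:A\to\Gamma$ is linear and satisfies the Leibniz rule, every element of $\Gamma$ is a sum $x_k\,\mathrm dy_k$, and there are a left coaction $\Delta_\Gamma:\Gamma\to A\otimes\Gamma$ and a right coaction ${}_\Gamma\Delta:\Gamma\to\Gamma\otimes A$ with $\Delta_\Gamma(x\,\mathrm dy)=\Delta(x)(\mathrm{id}\otimes\mathrm d)\Delta(y)$ and ${}_\Gamma\Delta(x\,\mathrm dy)=\Delta(x)(\mathrm d\otimes\mathrm{id})\Delta(y)$. Its dimension $N$ (the dimension of the space ${}_{inv}\Gamma$ of left-invariant elements, $\Delta_\Gamma(\omega)=1\otimes\omega$) is finite. Fix a basis $\omega_1,\dots,\omega_N$ of ${}_{inv}\Gamma$; it is a free $A$-module basis of $\Gamma$. For $f\in H$, $x\in A$ put $f\triangleright x=x_{(1)}f(x_{(2)})$. There are $f_{ij}\in H$ and $J_{ij}\in A$ with $\omega_ix=(f_{ij}\triangleright x)\omega_j$ for $x\in A$ and ${}_\Gamma\Delta(\omega_i)=\omega_j\otimes J_{ji}$. The quantum tangent space is $\mathcal T=\{X\in A':X(1)=0,\ X|_{R_\Gamma}=0\}\subset H$, where $R_\Gamma\subset\ker\varepsilon$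 is the right ideal characterizing the calculus; $\{X_i\}$ is the basis of $\mathcal T$ dual to $\{\omega_i\}$ under the pairing $\{X,x\,\mathrm dy\}=\varepsilon(x)X(y)$, so $\mathrm dx=(X_i\triangleright x)\omega_i$. Set $\sigma^{kl}_{ij}=f_{il}(J_{kj})$ (components of the Woronowicz braiding $\sigma(\omega_i\otimes\omega_j)=\sigma_{ij}^{kl}\omega_k\otimes\omega_l$) and $C_{ij}^k=X_j(J_{ik})$. Let $\sigma^t$ be the transposed map on $\mathcal T\otimes\mathcal T$, $\sigma^t(X_i\otimes X_j)=\sigma^{ij}_{kl}X_k\otimes X_l$, and let $t^{ij}_{kl}\in\mathbb C$, with $t^{ij}_{ij}=0$ (no sum), be such that $\ker(\mathrm{id}-\sigma^t)$ is spanned by the elements $X_i\otimes X_j+t^{ij}_{kl}X_k\otimes X_l$. $\mathcal E_\Gamma\subset H$ denotes the unital subalgebra generated by the elements $X_i,f_{jk}$. It is a sub-bialgebra of $H$ in which the relations $$X_iX_j-\sigma^{ij}_{kl}X_kX_l=C^k_{ij}X_k,\qquad \sigma^{ij}_{nm}f_{ip}f_{jq}=f_{ni}f_{mj}\sigma^{pq}_{ij},$$ $$C^i_{mn}f_{mj}f_{nk}+f_{ij}X_k=\sigma^{jk}_{pq}X_pf_{iq}+C^l_{jk}f_{il},\qquad X_kf_{nl}=\sigma^{kl}_{ij}f_{ni}X_j$$ hold. The calculus is called $S$-compatible if the antipode $S$ of $H$ satisfies $S(f_{ij})\in\mathcal E_\Gamma$ for all $i,j$ (so that $S$ restricts to $\mathcal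 E_\Gamma$). Quantum Cartan algebra. $\mathcal C_\Gamma$ is the unital $\mathbb Z_2$-graded algebra over $\mathbb C$ extending $\mathcal E_\Gamma$: it is generated by the algebra $\mathcal E_\Gamma$ (in even degree, with the relations holding in $\mathcal E_\Gamma$) and odd elements $\xi_i,\delta$, subject to $$\xi_i\xi_j+t^{ij}_{kl}\xi_k\xi_l=0,\quad \xi_i\delta+\delta\xi_i=X_i,\quad \delta\delta=0,\quad \xi_if_{kj}-\sigma^{ij}_{nm}f_{kn}\xi_m=0,$$ $$\xi_iX_j-\sigma^{ij}_{kl}X_k\xi_l=C^k_{ij}\xi_k,\quad f_{ij}\delta-\delta f_{ij}=0,\quad X_i\delta-\delta X_i=0.$$ Elements of $\mathcal E_\Gamma$, such as $S(f_{ij})$, are regarded as elements of $\mathcal C_\Gamma$. The graded bialgebra structure is given by $\triangle(X_i)=1\otimes X_i+X_j\otimes f_{ji}$, $\triangle(f_{ij})=f_{ik}\otimes f_{kj}$, $\triangle(\xi_i)=1\otimes\xi_i+\xi_j\otimes f_{ji}$, $\triangle(\delta)=1\otimes\delta+\delta\otimes1$, $\varepsilon(X_i)=\varepsilon(\xi_i)=\varepsilon(\delta)=0$, $\varepsilon(f_{ij})=\delta_{ij}$, with the graded product $(a_1\otimes a_2)(b_1\otimes b_2)=(-1)^{|a_2||b_1|}a_1b_1\otimes a_2b_2$ on $\mathcal C_\Gamma\otimes\mathcal C_\Gamma$. A $\mathbb Z_2$-graded algebra anti-homomorphism satisfies $S_\Gamma(ab)=(-1)^{|a||b|}S_\Gamma(b)S_\Gamma(a)$.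 *)

theory Defs
  imports
    Complex_Main
    "HOL-Library.Poly_Mapping"
    "HOL-Library.Function_Algebras"
    "HOL-Library.Z2"
begin

section \<open>Complex vector spaces and unital complex algebras\<close>

class complex_vector = ab_group_add +
  fixes scaleC :: "complex \<Rightarrow> 'a \<Rightarrow> 'a"  (infixr \<open>*\<^sub>C\<close> 75)
  assumes scaleC_add_right: "c *\<^sub>C (x + y) = c *\<^sub>C x + c *\<^sub>C y"
    and scaleC_add_left: "(b + c) *\<^sub>C x = b *\<^sub>C x + c *\<^sub>C x"
    and scaleC_scaleC: "b *\<^sub>C (c *\<^sub>C x) = (b * c) *\<^sub>C x"
    and scaleC_one: "1 *\<^sub>C x = x"

class complex_algebra_1 = complex_vector + ring_1 +
  assumes scaleC_mult_left: "(c *\<^sub>C x) * y = c *\<^sub>C (x * y)"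
    and scaleC_mult_right: "x * (c *\<^sub>C y) = c *\<^sub>C (x * y)"

global_interpretation cvs: vector_space "scaleC :: complex \<Rightarrow> 'a \<Rightarrow> 'a::complex_vector"
  by unfold_locales (simp_all add: scaleC_add_right scaleC_add_left scaleC_scaleC scaleC_one)

abbreviation clinear :: "('a::complex_vector \<Rightarrow> 'b::complex_vector) \<Rightarrow> bool" where
  "clinear \<equiv> Vector_Spaces.linear scaleC scaleC"

lemma clinearI:
  assumes "\<And>x y. h (x + y) = h x + h y" "\<And>c x. h (c *\<^sub>C x) = c *\<^sub>C h x"
  shows "clinear h"
  by (simp add: Vector_Spaces.linear_def module_hom_def module_hom_axioms_def assms
      cvs.vector_space_axioms cvs.module_axioms)

lemma clinear_add: "clinear h \<Longrightarrow> h (x + y) = h x + h y"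
  unfolding Vector_Spaces.linear_def by (blast intro: module_hom.add)

lemma clinear_scale: "clinear h \<Longrightarrow> h (c *\<^sub>C x) = c *\<^sub>C h x"
  unfolding Vector_Spaces.linear_def by (blast intro: module_hom.scale)

lemma clinear_diff: "clinear h \<Longrightarrow> h (x - y) = h x - h y"
  unfolding Vector_Spaces.linear_def by (blast intro: module_hom.diff)

lemma clinear_0: "clinear h \<Longrightarrow> h 0 = 0"
  unfolding Vector_Spaces.linear_def by (blast intro: module_hom.zero)

definition cbilinear ::
  "('a::complex_vector \<Rightarrow> 'b::complex_vector \<Rightarrow> 'c::complex_vector) \<Rightarrow> bool" where
  "cbilinear B \<longleftrightarrow> (\<forall>a. clinear (B a)) \<and> (\<forall>b. clinear (\<lambda>a. B a b))"

instantiation complex :: complex_algebra_1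
begin
definition scaleC_complex :: "complex \<Rightarrow> complex \<Rightarrow> complex" where
  "scaleC_complex = (*)"
instance by standard (simp_all add: scaleC_complex_def algebra_simps)
end

instantiation "fun" :: (type, complex_vector) complex_vector
begin
definition scaleC_fun :: "complex \<Rightarrow> ('a \<Rightarrow> 'b) \<Rightarrow> 'a \<Rightarrow> 'b" where
  "scaleC_fun c f = (\<lambda>x. c *\<^sub>C f x)"
instance
  by standard
    (simp_all add: scaleC_fun_def fun_eq_iff scaleC_add_right scaleC_add_left scaleC_scaleC scaleC_one)
end

instantiation poly_mapping :: (type, complex_vector) complex_vector
begin
lift_definition scaleC_poly_mapping ::
  "complex \<Rightarrow> ('a \<Rightarrow>\<^sub>0 'b) \<Rightarrow> 'a \<Rightarrow>\<^sub>0 'b" is "\<lambda>c p k. c *\<^sub>C p k"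
proof -
  fix c :: complex and p :: "'a \<Rightarrow> 'b"
  assume "finite {k. p k \<noteq> 0}"
  then show "finite {k. c *\<^sub>C p k \<noteq> 0}"
    by (rule rev_finite_subset) auto
qed
instance
  by standard
    (transfer, simp add: fun_eq_iff scaleC_add_right scaleC_add_left scaleC_scaleC scaleC_one)+
end

definition basis_of :: "nat \<Rightarrow> (nat \<Rightarrow> 'v::complex_vector) \<Rightarrow> 'v set \<Rightarrow> bool" where
  "basis_of N e V \<longleftrightarrow>
     inj_on e {1..N} \<and> \<not> cvs.dependent (e ` {1..N}) \<and> cvs.span (e ` {1..N}) = V"


section \<open>Algebraic tensor products\<close>

definition tensor_relations :: "('a::complex_vector \<times> 'b::complex_vector \<Rightarrow>\<^sub>0 complex) set" where
  "tensor_relations =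
     (\<Union>a a' b. {Poly_Mapping.single (a + a', b) 1
        - Poly_Mapping.single (a, b) 1 - Poly_Mapping.single (a', b) 1}) \<union>
     (\<Union>a b b'. {Poly_Mapping.single (a, b + b') 1
        - Poly_Mapping.single (a, b) 1 - Poly_Mapping.single (a, b') 1}) \<union>
     (\<Union>c a b. {Poly_Mapping.single (c *\<^sub>C a, b) 1 - c *\<^sub>C Poly_Mapping.single (a, b) 1}) \<union>
     (\<Union>c a b. {Poly_Mapping.single (a, c *\<^sub>C b) 1 - c *\<^sub>C Poly_Mapping.single (a, b) 1})"

definition tensor_rel ::
  "('a::complex_vector \<times> 'b::complex_vector \<Rightarrow>\<^sub>0 complex) \<Rightarrow> ('a \<times> 'b \<Rightarrow>\<^sub>0 complex) \<Rightarrow> bool" where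
  "tensor_rel p q \<longleftrightarrow> p - q \<in> cvs.span tensor_relations"

quotient_type (overloaded) ('a, 'b) tensor =
  "('a::complex_vector \<times> 'b::complex_vector) \<Rightarrow>\<^sub>0 complex" / tensor_rel
proof (rule equivpI)
  show "reflp (tensor_rel :: ('a \<times> 'b \<Rightarrow>\<^sub>0 complex) \<Rightarrow> _)"
    by (simp add: reflp_def tensor_rel_def cvs.span_zero)
  show "symp (tensor_rel :: ('a \<times> 'b \<Rightarrow>\<^sub>0 complex) \<Rightarrow> _)"
    unfolding symp_def tensor_rel_def by (metis cvs.span_neg minus_diff_eq)
  show "transp (tensor_rel :: ('a \<times> 'b \<Rightarrow>\<^sub>0 complex) \<Rightarrow> _)"
    unfolding transp_def tensor_rel_def
    by (metis (no_types, lifting) cvs.span_add diff_add_cancel add_diff_eq)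
qed

instantiation tensor :: (complex_vector, complex_vector) complex_vector
begin

lift_definition zero_tensor :: "('a, 'b) tensor" is 0 .

lift_definition plus_tensor :: "('a, 'b) tensor \<Rightarrow> ('a, 'b) tensor \<Rightarrow> ('a, 'b) tensor" is "(+)"
  unfolding tensor_rel_def by (metis (no_types, lifting) add_diff_add cvs.span_add)

lift_definition uminus_tensor :: "('a, 'b) tensor \<Rightarrow> ('a, 'b) tensor" is uminus
  unfolding tensor_rel_def by (metis cvs.span_neg minus_diff_minus)

lift_definition minus_tensor :: "('a, 'b) tensor \<Rightarrow> ('a, 'b) tensor \<Rightarrow> ('a, 'b) tensor" is "(-)"
  unfolding tensor_rel_def
proof -
  fix p p' q q' :: "'a \<times> 'b \<Rightarrow>\<^sub>0 complex"
  assume "p - p' \<in> cvs.span tensor_relations" "q - q' \<in> cvs.span tensor_relations"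
  then have "(p - p') - (q - q') \<in> cvs.span tensor_relations" by (rule cvs.span_diff)
  then show "p - q - (p' - q') \<in> cvs.span tensor_relations" by (simp add: algebra_simps)
qed

lift_definition scaleC_tensor :: "complex \<Rightarrow> ('a, 'b) tensor \<Rightarrow> ('a, 'b) tensor" is scaleC
  unfolding tensor_rel_def by (metis cvs.scale_right_diff_distrib cvs.span_scale)

instance
  by standard
    (transfer, simp add: tensor_rel_def cvs.span_zero algebra_simps
      scaleC_add_right scaleC_add_left scaleC_scaleC scaleC_one)+

end

lift_definition tensor_pure :: "'a::complex_vector \<Rightarrow> 'b::complex_vector \<Rightarrow> ('a, 'b) tensor"
  (infixr \<open>\<otimes>\<close> 72) is "\<lambda>a b. Poly_Mapping.single (a, b) 1" .

definition tensor_eval ::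
  "('a::complex_vector \<Rightarrow> 'b::complex_vector \<Rightarrow> 'c::complex_vector) \<Rightarrow>
    ('a \<times> 'b \<Rightarrow>\<^sub>0 complex) \<Rightarrow> 'c" where
  "tensor_eval B p = (\<Sum>k\<in>Poly_Mapping.keys p. Poly_Mapping.lookup p k *\<^sub>C B (fst k) (snd k))"

text \<open>
  The linear map on the tensor product induced by a bilinear map \<open>B\<close>
  (lemmas \<open>tensor_lift_pure\<close>, \<open>tensor_lift_linear\<close>, \<open>tensor_linear_unique\<close>);
  it is meaningless when \<open>B\<close> is not bilinear.
\<close>

definition tensor_lift ::
  "('a::complex_vector \<Rightarrow> 'b::complex_vector \<Rightarrow> 'c::complex_vector) \<Rightarrow> ('a, 'b) tensor \<Rightarrow> 'c" where
  "tensor_lift B s = tensor_eval B (rep_tensor s)"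

lemma tensor_eval_superset:
  assumes "finite K" "Poly_Mapping.keys p \<subseteq> K"
  shows "tensor_eval B p = (\<Sum>k\<in>K. Poly_Mapping.lookup p k *\<^sub>C B (fst k) (snd k))"
  unfolding tensor_eval_def
  by (rule sum.mono_neutral_left) (use assms in \<open>auto simp: in_keys_iff\<close>)

lemma tensor_eval_linear: "clinear (tensor_eval B)"
proof (rule clinearI)
  fix p q :: "'a \<times> 'b \<Rightarrow>\<^sub>0 complex" and c :: complex
  let ?K = "Poly_Mapping.keys p \<union> Poly_Mapping.keys q"
  have K: "finite ?K" by simp
  have "Poly_Mapping.keys (p + q) \<subseteq> ?K" by (rule Poly_Mapping.keys_add)
  then show "tensor_eval B (p + q) = tensor_eval B p + tensor_eval B q"
    by (simp add: tensor_eval_superset[OF K] lookup_add scaleC_add_left sum.distrib)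
  have "Poly_Mapping.keys (c *\<^sub>C p) \<subseteq> Poly_Mapping.keys p"
    by (auto simp: in_keys_iff scaleC_poly_mapping.rep_eq)
  then have "tensor_eval B (c *\<^sub>C p)
      = (\<Sum>k\<in>Poly_Mapping.keys p. Poly_Mapping.lookup (c *\<^sub>C p) k *\<^sub>C B (fst k) (snd k))"
    by (rule tensor_eval_superset[OF finite_keys])
  then show "tensor_eval B (c *\<^sub>C p) = c *\<^sub>C tensor_eval B p"
    by (simp add: tensor_eval_def scaleC_poly_mapping.rep_eq scaleC_scaleC
        cvs.scale_sum_right scaleC_complex_def)
qed

lemma tensor_eval_single: "tensor_eval B (Poly_Mapping.single (a, b) 1) = B a b"
  by (simp add: tensor_eval_def scaleC_one)

lemma tensor_eval_cong:
  assumes "cbilinear B" "tensor_rel p q"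
  shows "tensor_eval B p = tensor_eval B q"
proof -
  have B: "clinear (B a)" "clinear (\<lambda>a. B a b)" for a b
    using assms(1) by (auto simp: cbilinear_def)
  have rel: "tensor_eval B r = 0" if "r \<in> tensor_relations" for r
    using that unfolding tensor_relations_def
    by (auto simp: clinear_diff[OF tensor_eval_linear] clinear_scale[OF tensor_eval_linear]
        tensor_eval_single clinear_add[OF B(1)] clinear_add[OF B(2)]
        clinear_scale[OF B(1)] clinear_scale[OF B(2)])
  have "tensor_eval B (p - q) = 0"
    using assms(2) unfolding tensor_rel_def
    by (induction rule: cvs.span_induct_alt)
      (simp_all add: clinear_0[OF tensor_eval_linear] clinear_add[OF tensor_eval_linear]
        clinear_scale[OF tensor_eval_linear] rel)
  then show ?thesis by (simp add: clinear_diff[OF tensor_eval_linear])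
qed

lemma tensor_rel_rep: "tensor_rel (rep_tensor (abs_tensor p)) p"
  by (metis Quotient_rel_rep Quotient_tensor Quotient_abs_rep tensor.abs_eq_iff)

lemma tensor_lift_abs: "cbilinear B \<Longrightarrow> tensor_lift B (abs_tensor p) = tensor_eval B p"
  unfolding tensor_lift_def by (rule tensor_eval_cong[OF _ tensor_rel_rep])

lemma tensor_lift_pure: "cbilinear B \<Longrightarrow> tensor_lift B (a \<otimes> b) = B a b"
  by (simp add: tensor_pure.abs_eq tensor_lift_abs tensor_eval_single)

lemma tensor_lift_linear:
  assumes "cbilinear B"
  shows "clinear (tensor_lift B)"
proof (rule clinearI)
  fix s t :: "('a, 'b) tensor" and c :: complex
  obtain p q where "s = abs_tensor p" "t = abs_tensor q"
    by (metis Quotient_abs_rep Quotient_tensor)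
  then show "tensor_lift B (s + t) = tensor_lift B s + tensor_lift B t"
    and "tensor_lift B (c *\<^sub>C s) = c *\<^sub>C tensor_lift B s"
    by (simp_all add: plus_tensor.abs_eq scaleC_tensor.abs_eq tensor_lift_abs[OF assms]
        clinear_add[OF tensor_eval_linear] clinear_scale[OF tensor_eval_linear])
qed

lemma abs_tensor_linear: "clinear abs_tensor"
  by (rule clinearI) (simp_all add: plus_tensor.abs_eq scaleC_tensor.abs_eq)

lemma tensor_linear_unique:
  assumes g: "clinear g" and h: "clinear h" and "\<And>a b. g (a \<otimes> b) = h (a \<otimes> b)"
  shows "g = h"
proof
  fix s :: "('a, 'b) tensor"
  obtain p where p: "s = abs_tensor p" by (metis Quotient_abs_rep Quotient_tensor)
  have "p = (\<Sum>k\<in>Poly_Mapping.keys p. Poly_Mapping.lookup p k *\<^sub>C Poly_Mapping.single k 1)"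
  proof (rule poly_mapping_eqI)
    fix k
    have "Poly_Mapping.lookup
        (\<Sum>l\<in>Poly_Mapping.keys p. Poly_Mapping.lookup p l *\<^sub>C Poly_Mapping.single l 1) k
      = (\<Sum>l\<in>Poly_Mapping.keys p. if l = k then Poly_Mapping.lookup p k else 0)"
      by (simp add: lookup_sum scaleC_poly_mapping.rep_eq lookup_single when_def
          scaleC_complex_def if_distrib cong: if_cong)
    then show "Poly_Mapping.lookup p k = Poly_Mapping.lookup
        (\<Sum>l\<in>Poly_Mapping.keys p. Poly_Mapping.lookup p l *\<^sub>C Poly_Mapping.single l 1) k"
      by (simp add: in_keys_iff)
  qed
  then have p': "abs_tensor p = abs_tensor
      (\<Sum>k\<in>Poly_Mapping.keys p. Poly_Mapping.lookup p k *\<^sub>C Poly_Mapping.single k 1)"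
    by (rule arg_cong)
  have expand: "u (abs_tensor (\<Sum>k\<in>K. c k *\<^sub>C Poly_Mapping.single k 1))
      = (\<Sum>k\<in>K. c k *\<^sub>C u (fst k \<otimes> snd k))"
    if "clinear u" "finite K" for u :: "('a, 'b) tensor \<Rightarrow> 'c" and K c
    using that(2)
    by (induction K)
      (simp_all add: clinear_0[OF that(1)] clinear_0[OF abs_tensor_linear]
        clinear_add[OF that(1)] clinear_add[OF abs_tensor_linear]
        clinear_scale[OF that(1)] clinear_scale[OF abs_tensor_linear] tensor_pure.abs_eq)
  have "g (abs_tensor p) = h (abs_tensor p)"
    by (subst (1 2) p') (simp only: expand[OF g finite_keys] expand[OF h finite_keys] assms(3))
  then show "g s = h s" by (simp add: p)
qed

definition tensor_map ::
  "('a::complex_vector \<Rightarrow> 'c::complex_vector) \<Rightarrow> ('b::complex_vector \<Rightarrow> 'd::complex_vector) \<Rightarrow>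
    ('a, 'b) tensor \<Rightarrow> ('c, 'd) tensor" where
  "tensor_map g h = tensor_lift (\<lambda>a b. g a \<otimes> h b)"

definition tensor_assoc ::
  "(('a::complex_vector, 'b::complex_vector) tensor, 'c::complex_vector) tensor \<Rightarrow>
    ('a, ('b, 'c) tensor) tensor" where
  "tensor_assoc = tensor_lift (\<lambda>s c. tensor_lift (\<lambda>a b. a \<otimes> (b \<otimes> c)) s)"

text \<open>\<open>(a \<otimes> b) (c \<otimes> d) = m a c \<otimes> n b d\<close> for bilinear \<open>m\<close> and \<open>n\<close>.\<close>

definition tensor_mult ::
  "('a::complex_vector \<Rightarrow> 'c::complex_vector \<Rightarrow> 'e::complex_vector) \<Rightarrow>
   ('b::complex_vector \<Rightarrow> 'd::complex_vector \<Rightarrow> 'f::complex_vector) \<Rightarrow>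
   ('a, 'b) tensor \<Rightarrow> ('c, 'd) tensor \<Rightarrow> ('e, 'f) tensor" where
  "tensor_mult m n s t = tensor_lift (\<lambda>a b. tensor_lift (\<lambda>c d. m a c \<otimes> n b d) t) s"


section \<open>Hopf algebras and their duals\<close>

definition coalgebra ::
  "('a::complex_vector \<Rightarrow> ('a, 'a) tensor) \<Rightarrow> ('a \<Rightarrow> complex) \<Rightarrow> bool" where
  "coalgebra cop cou \<longleftrightarrow>
     clinear cop \<and> clinear cou \<and>
     (\<forall>x. tensor_assoc (tensor_map cop id (cop x)) = tensor_map id cop (cop x)) \<and>
     (\<forall>x. tensor_lift (\<lambda>a b. cou a *\<^sub>C b) (cop x) = x) \<and>
     (\<forall>x. tensor_lift (\<lambda>a b. cou b *\<^sub>C a) (cop x) = x)"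

definition is_antipode ::
  "('a::complex_algebra_1 \<Rightarrow> ('a, 'a) tensor) \<Rightarrow> ('a \<Rightarrow> complex) \<Rightarrow> ('a \<Rightarrow> 'a) \<Rightarrow> bool" where
  "is_antipode cop cou S \<longleftrightarrow>
     clinear S \<and>
     (\<forall>x. tensor_lift (\<lambda>a b. S a * b) (cop x) = cou x *\<^sub>C 1) \<and>
     (\<forall>x. tensor_lift (\<lambda>a b. a * S b) (cop x) = cou x *\<^sub>C 1)"

definition hopf_algebra ::
  "('a::complex_algebra_1 \<Rightarrow> ('a, 'a) tensor) \<Rightarrow> ('a \<Rightarrow> complex) \<Rightarrow> ('a \<Rightarrow> 'a) \<Rightarrow> bool" where
  "hopf_algebra cop cou S \<longleftrightarrow>
     coalgebra cop cou \<and>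
     cop 1 = 1 \<otimes> 1 \<and> (\<forall>x y. cop (x * y) = tensor_mult (*) (*) (cop x) (cop y)) \<and>
     cou 1 = 1 \<and> (\<forall>x y. cou (x * y) = cou x * cou y) \<and>
     is_antipode cop cou S"

text \<open>
  The dual Hopf algebra is the finite (Sweedler) dual: the functionals \<open>f\<close> for which
  \<open>(x, y) \<mapsto> f (x * y)\<close> lies in the tensor square of the algebraic dual.  Its product is
  convolution, its unit is the counit of \<open>A\<close>, its antipode is the transpose of that of \<open>A\<close>.
\<close>

definition hopf_dual :: "('a::complex_algebra_1 \<Rightarrow> complex) set" where
  "hopf_dual = {f. clinear f \<and>
     (\<exists>(n::nat) g h. (\<forall>k<n. clinear (g k) \<and> clinear (h k)) \<and>
        (\<forall>x y. f (x * y) = (\<Sum>k<n. g k x * h k y)))}"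

definition conv ::
  "('a::complex_algebra_1 \<Rightarrow> ('a, 'a) tensor) \<Rightarrow>
    ('a \<Rightarrow> complex) \<Rightarrow> ('a \<Rightarrow> complex) \<Rightarrow> 'a \<Rightarrow> complex" where
  "conv cop f g x = tensor_lift (\<lambda>a b. f a * g b) (cop x)"

definition dual_antipode :: "('a \<Rightarrow> 'a) \<Rightarrow> ('a \<Rightarrow> complex) \<Rightarrow> 'a \<Rightarrow> complex" where
  "dual_antipode S f = f \<circ> S"

text \<open>The left action of a functional on the algebra: \<open>x\<close> is sent to \<open>x\<^sub>(\<^sub>1\<^sub>) f (x\<^sub>(\<^sub>2\<^sub>))\<close>.\<close>

definition dual_act ::
  "('a::complex_algebra_1 \<Rightarrow> ('a, 'a) tensor) \<Rightarrow> ('a \<Rightarrow> complex) \<Rightarrow> 'a \<Rightarrow> 'a" where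
  "dual_act cop f x = tensor_lift (\<lambda>a b. f b *\<^sub>C a) (cop x)"


section \<open>Bicovariant first order differential calculi\<close>

definition bimodule ::
  "('a::complex_algebra_1 \<Rightarrow> 'g::complex_vector \<Rightarrow> 'g) \<Rightarrow> ('g \<Rightarrow> 'a \<Rightarrow> 'g) \<Rightarrow> bool" where
  "bimodule lm rm \<longleftrightarrow>
     cbilinear lm \<and> cbilinear rm \<and>
     (\<forall>v. lm 1 v = v) \<and> (\<forall>x y v. lm (x * y) v = lm x (lm y v)) \<and>
     (\<forall>v. rm v 1 = v) \<and> (\<forall>v x y. rm v (x * y) = rm (rm v x) y) \<and>
     (\<forall>x v y. rm (lm x v) y = lm x (rm v y))"

definition fodc ::
  "('a::complex_algebra_1 \<Rightarrow> 'g::complex_vector \<Rightarrow> 'g) \<Rightarrow> ('g \<Rightarrow> 'a \<Rightarrow> 'g) \<Rightarrow> ('a \<Rightarrow> 'g) \<Rightarrow> bool" where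
  "fodc lm rm d \<longleftrightarrow>
     bimodule lm rm \<and> clinear d \<and>
     (\<forall>x y. d (x * y) = rm (d x) y + lm x (d y)) \<and>
     (\<forall>v. \<exists>(n::nat) x y. v = (\<Sum>k<n. lm (x k) (d (y k))))"

definition left_coaction ::
  "('a::complex_vector \<Rightarrow> ('a, 'a) tensor) \<Rightarrow> ('a \<Rightarrow> complex) \<Rightarrow>
    ('g::complex_vector \<Rightarrow> ('a, 'g) tensor) \<Rightarrow> bool" where
  "left_coaction cop cou lco \<longleftrightarrow>
     clinear lco \<and>
     (\<forall>v. tensor_assoc (tensor_map cop id (lco v)) = tensor_map id lco (lco v)) \<and>
     (\<forall>v. tensor_lift (\<lambda>a w. cou a *\<^sub>C w) (lco v) = v)"

definition right_coaction ::
  "('a::complex_vector \<Rightarrow> ('a, 'a) tensor) \<Rightarrow> ('a \<Rightarrow> complex) \<Rightarrow>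
    ('g::complex_vector \<Rightarrow> ('g, 'a) tensor) \<Rightarrow> bool" where
  "right_coaction cop cou rco \<longleftrightarrow>
     clinear rco \<and>
     (\<forall>v. tensor_assoc (tensor_map rco id (rco v)) = tensor_map id cop (rco v)) \<and>
     (\<forall>v. tensor_lift (\<lambda>w a. cou a *\<^sub>C w) (rco v) = v)"

definition bicovariant_fodc ::
  "('a::complex_algebra_1 \<Rightarrow> ('a, 'a) tensor) \<Rightarrow> ('a \<Rightarrow> complex) \<Rightarrow>
    ('a \<Rightarrow> 'g::complex_vector \<Rightarrow> 'g) \<Rightarrow> ('g \<Rightarrow> 'a \<Rightarrow> 'g) \<Rightarrow> ('a \<Rightarrow> 'g) \<Rightarrow>
    ('g \<Rightarrow> ('a, 'g) tensor) \<Rightarrow> ('g \<Rightarrow> ('g, 'a) tensor) \<Rightarrow> bool" where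
  "bicovariant_fodc cop cou lm rm d lco rco \<longleftrightarrow>
     fodc lm rm d \<and>
     left_coaction cop cou lco \<and>
     (\<forall>x y. lco (lm x (d y)) = tensor_mult (*) lm (cop x) (tensor_map id d (cop y))) \<and>
     right_coaction cop cou rco \<and>
     (\<forall>x y. rco (lm x (d y)) = tensor_mult lm (*) (cop x) (tensor_map d id (cop y)))"

definition left_invariants ::
  "('g::complex_vector \<Rightarrow> ('a::complex_algebra_1, 'g) tensor) \<Rightarrow> 'g set" where
  "left_invariants lco = {v. lco v = 1 \<otimes> v}"

text \<open>
  Woronowicz's right ideal: the kernel of \<open>x \<mapsto> S(x\<^sub>(\<^sub>1\<^sub>)) d x\<^sub>(\<^sub>2\<^sub>)\<close> on the kernel of the counit.
\<close>

definition calculus_ideal ::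
  "('a::complex_algebra_1 \<Rightarrow> ('a, 'a) tensor) \<Rightarrow> ('a \<Rightarrow> complex) \<Rightarrow> ('a \<Rightarrow> 'a) \<Rightarrow>
    ('a \<Rightarrow> 'g::complex_vector \<Rightarrow> 'g) \<Rightarrow> ('a \<Rightarrow> 'g) \<Rightarrow> 'a set" where
  "calculus_ideal cop cou S lm d =
     {x. cou x = 0 \<and> tensor_lift (\<lambda>a b. lm (S a) (d b)) (cop x) = 0}"

definition tangent_space ::
  "('a::complex_algebra_1 \<Rightarrow> ('a, 'a) tensor) \<Rightarrow> ('a \<Rightarrow> complex) \<Rightarrow> ('a \<Rightarrow> 'a) \<Rightarrow>
    ('a \<Rightarrow> 'g::complex_vector \<Rightarrow> 'g) \<Rightarrow> ('a \<Rightarrow> 'g) \<Rightarrow> ('a \<Rightarrow> complex) set" where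
  "tangent_space cop cou S lm d =
     {X. clinear X \<and> X 1 = 0 \<and> (\<forall>x\<in>calculus_ideal cop cou S lm d. X x = 0)}"

text \<open>For \<open>X\<close> in the tangent space, the functional on \<open>\<Gamma>\<close> with \<open>x dy \<mapsto> \<epsilon>(x) X(y)\<close>.\<close>

definition tangent_pairing ::
  "('a \<Rightarrow> complex) \<Rightarrow> ('a::complex_algebra_1 \<Rightarrow> 'g::complex_vector \<Rightarrow> 'g) \<Rightarrow> ('a \<Rightarrow> 'g) \<Rightarrow>
    ('a \<Rightarrow> complex) \<Rightarrow> 'g \<Rightarrow> complex" where
  "tangent_pairing cou lm d X =
     (THE \<phi>. clinear \<phi> \<and> (\<forall>x y. \<phi> (lm x (d y)) = cou x * X y))"

text \<open>Index conventions: \<open>braid f J k l i j\<close> is \<open>\<sigma>\<close> with upper indices \<open>k l\<close> and lower indices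
  \<open>i j\<close>; \<open>struct X J i j k\<close> is \<open>C\<close> with lower indices \<open>i j\<close> and upper index \<open>k\<close>.\<close>

definition braid ::
  "(nat \<Rightarrow> nat \<Rightarrow> 'a \<Rightarrow> complex) \<Rightarrow> (nat \<Rightarrow> nat \<Rightarrow> 'a) \<Rightarrow>
    nat \<Rightarrow> nat \<Rightarrow> nat \<Rightarrow> nat \<Rightarrow> complex" where
  "braid f J k l i j = f i l (J k j)"

definition struct ::
  "(nat \<Rightarrow> 'a \<Rightarrow> complex) \<Rightarrow> (nat \<Rightarrow> nat \<Rightarrow> 'a) \<Rightarrow> nat \<Rightarrow> nat \<Rightarrow> nat \<Rightarrow> complex" where
  "struct X J i j k = X j (J i k)"

text \<open>
  The kernel of \<open>id - \<sigma>\<^sup>t\<close> on \<open>\<T> \<otimes> \<T>\<close>, where \<open>\<sigma>\<^sup>t\<close> sends the basis vector \<open>X i \<otimes> X j\<close> to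
  \<open>\<Sum>k l. \<sigma> i j k l (X k \<otimes> X l)\<close>: an element with coordinates \<open>v\<close> must equal its image.
\<close>

definition transposed_braid_kernel ::
  "nat \<Rightarrow> (nat \<Rightarrow> 'v::complex_vector) \<Rightarrow> (nat \<Rightarrow> nat \<Rightarrow> nat \<Rightarrow> nat \<Rightarrow> complex) \<Rightarrow>
    ('v, 'v) tensor set" where
  "transposed_braid_kernel N X \<sigma> =
     {u. \<exists>v. u = (\<Sum>i=1..N. \<Sum>j=1..N. v i j *\<^sub>C (X i \<otimes> X j)) \<and>
             u = (\<Sum>i=1..N. \<Sum>j=1..N. v i j *\<^sub>C
                    (\<Sum>k=1..N. \<Sum>l=1..N. \<sigma> i j k l *\<^sub>C (X k \<otimes> X l)))}"

inductive_set calc_subalgebra ::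
  "('a::complex_algebra_1 \<Rightarrow> ('a, 'a) tensor) \<Rightarrow> ('a \<Rightarrow> complex) \<Rightarrow> nat \<Rightarrow>
    (nat \<Rightarrow> 'a \<Rightarrow> complex) \<Rightarrow> (nat \<Rightarrow> nat \<Rightarrow> 'a \<Rightarrow> complex) \<Rightarrow> ('a \<Rightarrow> complex) set"
  for cop :: "'a \<Rightarrow> ('a, 'a) tensor" and cou :: "'a \<Rightarrow> complex" and N :: nat
    and X :: "nat \<Rightarrow> 'a \<Rightarrow> complex" and f :: "nat \<Rightarrow> nat \<Rightarrow> 'a \<Rightarrow> complex"
  where
    unit: "cou \<in> calc_subalgebra cop cou N X f"
  | gen_X: "i \<in> {1..N} \<Longrightarrow> X i \<in> calc_subalgebra cop cou N X f"
  | gen_f: "i \<in> {1..N} \<Longrightarrow> j \<in> {1..N} \<Longrightarrow> f i j \<in> calc_subalgebra cop cou N X f"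
  | add: "g \<in> calc_subalgebra cop cou N X f \<Longrightarrow> h \<in> calc_subalgebra cop cou N X f \<Longrightarrow>
            g + h \<in> calc_subalgebra cop cou N X f"
  | scale: "g \<in> calc_subalgebra cop cou N X f \<Longrightarrow> c *\<^sub>C g \<in> calc_subalgebra cop cou N X f"
  | mult: "g \<in> calc_subalgebra cop cou N X f \<Longrightarrow> h \<in> calc_subalgebra cop cou N X f \<Longrightarrow>
            conv cop g h \<in> calc_subalgebra cop cou N X f"


section \<open>\<open>\<int>\<^sub>2\<close>-graded algebras, bialgebras and Hopf algebras\<close>

definition koszul :: "bit \<Rightarrow> bit \<Rightarrow> complex" where
  "koszul i j = (if i = 1 \<and> j = 1 then - 1 else 1)"

definition graded_algebra :: "(bit \<Rightarrow> 'c::complex_algebra_1 set) \<Rightarrow> bool" where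
  "graded_algebra G \<longleftrightarrow>
     (\<forall>i. cvs.subspace (G i)) \<and> G 0 \<inter> G 1 = {0} \<and> (\<forall>x. \<exists>y\<in>G 0. \<exists>z\<in>G 1. x = y + z) \<and>
     1 \<in> G 0 \<and> (\<forall>i j. \<forall>x\<in>G i. \<forall>y\<in>G j. x * y \<in> G (i + j))"

definition hom_part :: "(bit \<Rightarrow> 'c::complex_vector set) \<Rightarrow> bit \<Rightarrow> 'c \<Rightarrow> 'c" where
  "hom_part G i x = (THE y. y \<in> G i \<and> x - y \<in> G (i + 1))"

definition tensor_grade ::
  "(bit \<Rightarrow> 'c::complex_vector set) \<Rightarrow> bit \<Rightarrow> ('c, 'c) tensor set" where
  "tensor_grade G k = cvs.span {a \<otimes> b | a b i j. a \<in> G i \<and> b \<in> G j \<and> i + j = k}"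

text \<open>
  The graded product and the graded flip on the tensor square; on homogeneous elements they are given
  by \<open>graded_tensor_mult_homogeneous\<close> and \<open>graded_flip_homogeneous\<close> below.
\<close>

definition graded_tensor_mult ::
  "(bit \<Rightarrow> 'c::complex_algebra_1 set) \<Rightarrow> ('c, 'c) tensor \<Rightarrow> ('c, 'c) tensor \<Rightarrow> ('c, 'c) tensor" where
  "graded_tensor_mult G s t =
     (\<Sum>i\<in>{0, 1}. \<Sum>j\<in>{0, 1}. koszul i j *\<^sub>C
        tensor_mult (\<lambda>a b. a * hom_part G j b) (\<lambda>a b. hom_part G i a * b) s t)"

definition graded_flip ::
  "(bit \<Rightarrow> 'c::complex_vector set) \<Rightarrow> ('c, 'c) tensor \<Rightarrow> ('c, 'c) tensor" where
  "graded_flip G =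
     tensor_lift (\<lambda>a b. \<Sum>i\<in>{0, 1}. \<Sum>j\<in>{0, 1}. koszul i j *\<^sub>C (hom_part G j b \<otimes> hom_part G i a))"

definition graded_bialgebra ::
  "(bit \<Rightarrow> 'c::complex_algebra_1 set) \<Rightarrow> ('c \<Rightarrow> ('c, 'c) tensor) \<Rightarrow> ('c \<Rightarrow> complex) \<Rightarrow> bool" where
  "graded_bialgebra G cop cou \<longleftrightarrow>
     graded_algebra G \<and> coalgebra cop cou \<and>
     (\<forall>k. cop ` G k \<subseteq> tensor_grade G k) \<and> (\<forall>x\<in>G 1. cou x = 0) \<and>
     cop 1 = 1 \<otimes> 1 \<and> (\<forall>x y. cop (x * y) = graded_tensor_mult G (cop x) (cop y)) \<and>
     cou 1 = 1 \<and> (\<forall>x y. cou (x * y) = cou x * cou y)"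

definition graded_hopf_algebra ::
  "(bit \<Rightarrow> 'c::complex_algebra_1 set) \<Rightarrow> ('c \<Rightarrow> ('c, 'c) tensor) \<Rightarrow> ('c \<Rightarrow> complex) \<Rightarrow>
    ('c \<Rightarrow> 'c) \<Rightarrow> bool" where
  "graded_hopf_algebra G cop cou S \<longleftrightarrow>
     graded_bialgebra G cop cou \<and> (\<forall>i. S ` G i \<subseteq> G i) \<and> is_antipode cop cou S"

definition graded_algebra_antihom ::
  "(bit \<Rightarrow> 'c::complex_algebra_1 set) \<Rightarrow> ('c \<Rightarrow> 'c) \<Rightarrow> bool" where
  "graded_algebra_antihom G S \<longleftrightarrow>
     clinear S \<and> (\<forall>i. S ` G i \<subseteq> G i) \<and> S 1 = 1 \<and>
     (\<forall>i j. \<forall>a\<in>G i. \<forall>b\<in>G j. S (a * b) = koszul i j *\<^sub>C (S b * S a))"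

definition graded_coalgebra_antihom ::
  "(bit \<Rightarrow> 'c::complex_algebra_1 set) \<Rightarrow> ('c \<Rightarrow> ('c, 'c) tensor) \<Rightarrow> ('c \<Rightarrow> complex) \<Rightarrow>
    ('c \<Rightarrow> 'c) \<Rightarrow> bool" where
  "graded_coalgebra_antihom G cop cou S \<longleftrightarrow>
     clinear S \<and> (\<forall>i. S ` G i \<subseteq> G i) \<and>
     (\<forall>x. cop (S x) = graded_flip G (tensor_map S S (cop x))) \<and> (\<forall>x. cou (S x) = cou x)"


section \<open>Algebras given by generators and relations\<close>

text \<open>
  Words are lists, so \<open>'x list \<Rightarrow>\<^sub>0 complex\<close> with the convolution product of
  \<open>Poly_Mapping\<close> is the free unital complex algebra on \<open>'x\<close>.
\<close>

instantiation list :: (type) monoid_add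
begin
definition zero_list :: "'a list" where "zero_list = []"
definition plus_list :: "'a list \<Rightarrow> 'a list \<Rightarrow> 'a list" where "plus_list = (@)"
instance by standard (simp_all add: zero_list_def plus_list_def)
end

type_synonym 'x free_algebra = "'x list \<Rightarrow>\<^sub>0 complex"

definition letter :: "'x \<Rightarrow> 'x free_algebra" where
  "letter x = Poly_Mapping.single [x] 1"

definition free_algebra_on :: "'x set \<Rightarrow> 'x free_algebra set" where
  "free_algebra_on G = {p. \<forall>w\<in>Poly_Mapping.keys p. set w \<subseteq> G}"

definition free_eval :: "('x \<Rightarrow> 'c::complex_algebra_1) \<Rightarrow> 'x free_algebra \<Rightarrow> 'c" where
  "free_eval \<gamma> p =
     (\<Sum>w\<in>Poly_Mapping.keys p. Poly_Mapping.lookup p w *\<^sub>C prod_list (map \<gamma> w))"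

definition two_sided_ideal :: "'x set \<Rightarrow> 'x free_algebra set \<Rightarrow> 'x free_algebra set" where
  "two_sided_ideal G R =
     cvs.span {p * r * q | p r q. p \<in> free_algebra_on G \<and> r \<in> R \<and> q \<in> free_algebra_on G}"

text \<open>
  The algebra \<open>'c\<close>, with \<open>\<gamma>\<close> interpreting the generators, is the algebra presented by generators
  \<open>G\<close> and relators \<open>R\<close>: evaluation induces an isomorphism from the free algebra on \<open>G\<close> modulo the
  two-sided ideal generated by \<open>R\<close> onto \<open>'c\<close>.
\<close>

definition presented_algebra ::
  "'x set \<Rightarrow> 'x free_algebra set \<Rightarrow> ('x \<Rightarrow> 'c::complex_algebra_1) \<Rightarrow> bool" where
  "presented_algebra G R \<gamma> \<longleftrightarrow>
     free_eval \<gamma> ` free_algebra_on G = UNIV \<and>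
     (\<forall>p\<in>free_algebra_on G. free_eval \<gamma> p = 0 \<longleftrightarrow> p \<in> two_sided_ideal G R)"


section \<open>The quantum Cartan algebra\<close>

text \<open>\<open>Even h\<close> is the generator given by the element \<open>h\<close> of the subalgebra \<open>\<E>\<^sub>\<Gamma>\<close> of the dual.\<close>

datatype 'h cartan_gen = Even 'h | Xi nat | Delta

definition cartan_gens :: "nat \<Rightarrow> 'h set \<Rightarrow> 'h cartan_gen set" where
  "cartan_gens N E = Even ` E \<union> Xi ` {1..N} \<union> {Delta}"

text \<open>The relators making \<open>Even\<close> a unital algebra homomorphism on \<open>\<E>\<^sub>\<Gamma>\<close>, i.e. imposing all the
  relations that hold in \<open>\<E>\<^sub>\<Gamma>\<close>.\<close>

definition even_relators ::
  "('h::complex_vector \<Rightarrow> 'h \<Rightarrow> 'h) \<Rightarrow> 'h \<Rightarrow> 'h set \<Rightarrow> 'h cartan_gen free_algebra set" where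
  "even_relators m u E =
     {letter (Even u) - 1} \<union>
     {letter (Even (g + h)) - letter (Even g) - letter (Even h) | g h. g \<in> E \<and> h \<in> E} \<union>
     {letter (Even (c *\<^sub>C g)) - c *\<^sub>C letter (Even g) | c g. g \<in> E} \<union>
     {letter (Even (m g h)) - letter (Even g) * letter (Even h) | g h. g \<in> E \<and> h \<in> E}"

definition odd_relators ::
  "nat \<Rightarrow> (nat \<Rightarrow> 'h) \<Rightarrow> (nat \<Rightarrow> nat \<Rightarrow> 'h) \<Rightarrow>
    (nat \<Rightarrow> nat \<Rightarrow> nat \<Rightarrow> nat \<Rightarrow> complex) \<Rightarrow> (nat \<Rightarrow> nat \<Rightarrow> nat \<Rightarrow> complex) \<Rightarrow>
    (nat \<Rightarrow> nat \<Rightarrow> nat \<Rightarrow> nat \<Rightarrow> complex) \<Rightarrow> 'h cartan_gen free_algebra set" where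
  "odd_relators N X f \<sigma> C t =
    (let \<xi> = (\<lambda>i. letter (Xi i)); \<delta> = letter Delta;
         x = (\<lambda>i. letter (Even (X i))); \<phi> = (\<lambda>i j. letter (Even (f i j)))
     in
     {\<xi> i * \<xi> j + (\<Sum>k=1..N. \<Sum>l=1..N. t i j k l *\<^sub>C (\<xi> k * \<xi> l))
        | i j. i \<in> {1..N} \<and> j \<in> {1..N}} \<union>
     {\<xi> i * \<delta> + \<delta> * \<xi> i - x i | i. i \<in> {1..N}} \<union>
     {\<delta> * \<delta>} \<union>
     {\<xi> i * \<phi> k j - (\<Sum>n=1..N. \<Sum>m=1..N. \<sigma> i j n m *\<^sub>C (\<phi> k n * \<xi> m))
        | i j k. i \<in> {1..N} \<and> j \<in> {1..N} \<and> k \<in> {1..N}} \<union>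
     {\<xi> i * x j - (\<Sum>k=1..N. \<Sum>l=1..N. \<sigma> i j k l *\<^sub>C (x k * \<xi> l)) - (\<Sum>k=1..N. C i j k *\<^sub>C \<xi> k)
        | i j. i \<in> {1..N} \<and> j \<in> {1..N}} \<union>
     {\<phi> i j * \<delta> - \<delta> * \<phi> i j | i j. i \<in> {1..N} \<and> j \<in> {1..N}} \<union>
     {x i * \<delta> - \<delta> * x i | i. i \<in> {1..N}})"

definition quantum_cartan_algebra ::
  "('a::complex_algebra_1 \<Rightarrow> ('a, 'a) tensor) \<Rightarrow> ('a \<Rightarrow> complex) \<Rightarrow> nat \<Rightarrow>
    (nat \<Rightarrow> 'a \<Rightarrow> complex) \<Rightarrow> (nat \<Rightarrow> nat \<Rightarrow> 'a \<Rightarrow> complex) \<Rightarrow> (nat \<Rightarrow> nat \<Rightarrow> 'a) \<Rightarrow>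
    (nat \<Rightarrow> nat \<Rightarrow> nat \<Rightarrow> nat \<Rightarrow> complex) \<Rightarrow>
    (('a \<Rightarrow> complex) cartan_gen \<Rightarrow> 'c::complex_algebra_1) \<Rightarrow> bool" where
  "quantum_cartan_algebra cop cou N X f J t \<gamma> \<longleftrightarrow>
    (let E = calc_subalgebra cop cou N X f in
     presented_algebra (cartan_gens N E)
       (even_relators (conv cop) cou E \<union> odd_relators N X f (braid f J) (struct X J) t) \<gamma>)"

fun gen_parity :: "'h cartan_gen \<Rightarrow> bit" where
  "gen_parity (Even h) = 0"
| "gen_parity (Xi i) = 1"
| "gen_parity Delta = 1"

definition cartan_grading ::
  "('a::complex_algebra_1 \<Rightarrow> ('a, 'a) tensor) \<Rightarrow> ('a \<Rightarrow> complex) \<Rightarrow> nat \<Rightarrow>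
    (nat \<Rightarrow> 'a \<Rightarrow> complex) \<Rightarrow> (nat \<Rightarrow> nat \<Rightarrow> 'a \<Rightarrow> complex) \<Rightarrow>
    (('a \<Rightarrow> complex) cartan_gen \<Rightarrow> 'c::complex_algebra_1) \<Rightarrow> bit \<Rightarrow> 'c set" where
  "cartan_grading cop cou N X f \<gamma> i =
     free_eval \<gamma> ` {p \<in> free_algebra_on (cartan_gens N (calc_subalgebra cop cou N X f)).
        \<forall>w\<in>Poly_Mapping.keys p. sum_list (map gen_parity w) = i}"


section \<open>Values of the graded operations on homogeneous pure tensors\<close>

lemma hom_part_unique:
  assumes G: "graded_algebra G" and "y \<in> G i" "x - y \<in> G (i + 1)"
  shows "hom_part G i x = y"
  unfolding hom_part_def
proof (rule the_equality)
  fix z assume z: "z \<in> G i \<and> x - z \<in> G (i + 1)"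
  have sub: "cvs.subspace (G k)" for k using G by (simp add: graded_algebra_def)
  have "z - y \<in> G i" using z assms(2) sub cvs.subspace_diff by blast
  moreover have "z - y \<in> G (i + 1)"
    using cvs.subspace_diff[OF sub[of "i + 1"], of "x - y" "x - z"] z assms(3) by simp
  moreover have "G i \<inter> G (i + 1) = {0}"
    using G by (cases i) (simp_all add: graded_algebra_def Int_commute)
  ultimately have "z - y \<in> {0}" by blast
  then show "z = y" by simp
qed (use assms in auto)

lemma hom_part_homogeneous:
  assumes G: "graded_algebra G" and "x \<in> G i"
  shows "hom_part G j x = (if j = i then x else 0)"
proof -
  have sub: "cvs.subspace (G k)" for k using G by (simp add: graded_algebra_def)
  have "j \<noteq> i \<Longrightarrow> j + 1 = i" by (cases i; cases j) auto
  then show ?thesis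
    using assms by (auto intro!: hom_part_unique[OF G] simp: cvs.subspace_0[OF sub])
qed

lemma hom_part_props:
  assumes G: "graded_algebra G"
  shows "hom_part G i x \<in> G i" "x - hom_part G i x \<in> G (i + 1)"
proof -
  obtain y z where yz: "y \<in> G 0" "z \<in> G 1" "x = y + z"
    using G unfolding graded_algebra_def by blast
  have "hom_part G i x = (if i = 0 then y else z)"
    by (rule hom_part_unique[OF G]) (use yz in \<open>cases i; simp\<close>)+
  then show "hom_part G i x \<in> G i" "x - hom_part G i x \<in> G (i + 1)"
    using yz by (cases i; simp)+
qed

lemma hom_part_linear:
  assumes G: "graded_algebra G"
  shows "clinear (hom_part G i)"
proof (rule clinearI)
  have sub: "cvs.subspace (G k)" for k using G by (simp add: graded_algebra_def)
  note p = hom_part_props[OF G]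
  fix x y c
  have "(x + y) - (hom_part G i x + hom_part G i y) =
      (x - hom_part G i x) + (y - hom_part G i y)" by simp
  then show "hom_part G i (x + y) = hom_part G i x + hom_part G i y"
    by (intro hom_part_unique[OF G]) (simp_all only: cvs.subspace_add[OF sub] p)
  have "c *\<^sub>C x - c *\<^sub>C hom_part G i x = c *\<^sub>C (x - hom_part G i x)"
    by (simp add: cvs.scale_right_diff_distrib)
  then show "hom_part G i (c *\<^sub>C x) = c *\<^sub>C hom_part G i x"
    by (intro hom_part_unique[OF G]) (simp_all only: cvs.subspace_scale[OF sub] p)
qed

lemma tensor_pure_bilinear: "cbilinear (\<otimes>)"
proof -
  have *: "abs_tensor p = abs_tensor q" if "p - q \<in> tensor_relations"
    for p q :: "'a \<times> 'b \<Rightarrow>\<^sub>0 complex"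
    using that by (simp add: tensor.abs_eq_iff tensor_rel_def cvs.span_base)
  have "(a + a') \<otimes> b = a \<otimes> b + a' \<otimes> b" for a a' :: 'a and b :: 'b
    unfolding tensor_pure.abs_eq plus_tensor.abs_eq
    by (rule *, unfold tensor_relations_def diff_diff_eq[symmetric]) (rule UnI1, rule UnI1, rule UnI1, blast)
  moreover have "a \<otimes> (b + b') = a \<otimes> b + a \<otimes> b'" for a :: 'a and b b' :: 'b
    unfolding tensor_pure.abs_eq plus_tensor.abs_eq
    by (rule *, unfold tensor_relations_def diff_diff_eq[symmetric]) (rule UnI1, rule UnI1, rule UnI2, blast)
  moreover have "(c *\<^sub>C a) \<otimes> b = c *\<^sub>C (a \<otimes> b)" for c and a :: 'a and b :: 'b
    unfolding tensor_pure.abs_eq scaleC_tensor.abs_eq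
    by (rule *, unfold tensor_relations_def) (rule UnI1, rule UnI2, blast)
  moreover have "a \<otimes> (c *\<^sub>C b) = c *\<^sub>C (a \<otimes> b)" for c and a :: 'a and b :: 'b
    unfolding tensor_pure.abs_eq scaleC_tensor.abs_eq
    by (rule *, unfold tensor_relations_def) (rule UnI2, blast)
  ultimately show ?thesis
    unfolding cbilinear_def by (intro conjI allI clinearI)
qed

lemma tensor_mult_pure:
  fixes m :: "'a::complex_vector \<Rightarrow> 'c::complex_vector \<Rightarrow> 'e::complex_vector"
    and n :: "'b::complex_vector \<Rightarrow> 'd::complex_vector \<Rightarrow> 'f::complex_vector"
  assumes "cbilinear m" "cbilinear n"
  shows "tensor_mult m n (a \<otimes> b) (c \<otimes> d) = m a c \<otimes> n b d"
proof -
  have T': "clinear (\<lambda>x. x \<otimes> y)" "clinear (\<lambda>y. x \<otimes> y)" for x :: 'e and y :: 'f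
    using tensor_pure_bilinear by (auto simp: cbilinear_def)
  have M: "clinear (m x)" "clinear (\<lambda>x. m x y)" for x y
    using assms(1) by (auto simp: cbilinear_def)
  have N: "clinear (n x)" "clinear (\<lambda>x. n x y)" for x y
    using assms(2) by (auto simp: cbilinear_def)
  note lin = clinear_add[OF M(1)] clinear_add[OF M(2)] clinear_add[OF N(1)] clinear_add[OF N(2)]
    clinear_scale[OF M(1)] clinear_scale[OF M(2)] clinear_scale[OF N(1)] clinear_scale[OF N(2)]
    clinear_add[OF T'(1)] clinear_add[OF T'(2)] clinear_scale[OF T'(1)] clinear_scale[OF T'(2)]
  have inner: "cbilinear (\<lambda>c d. m a' c \<otimes> n b' d)" for a' b'
    unfolding cbilinear_def by (intro conjI allI clinearI) (simp_all add: lin)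
  have "cbilinear (\<lambda>a b. tensor_lift (\<lambda>c d. m a c \<otimes> n b d) (c \<otimes> d))"
    unfolding tensor_lift_pure[OF inner] cbilinear_def
    by (intro conjI allI clinearI) (simp_all add: lin)
  then show ?thesis
    unfolding tensor_mult_def by (simp add: tensor_lift_pure tensor_lift_pure[OF inner])
qed

lemma graded_tensor_mult_homogeneous:
  assumes G: "graded_algebra G" and "a2 \<in> G i" "b1 \<in> G j"
  shows "graded_tensor_mult G (a1 \<otimes> a2) (b1 \<otimes> b2) = koszul i j *\<^sub>C ((a1 * b1) \<otimes> (a2 * b2))"
proof -
  note H = hom_part_linear[OF G]
  note lin = clinear_add[OF H] clinear_scale[OF H] algebra_simps scaleC_mult_left scaleC_mult_right
  have "cbilinear (\<lambda>a b. a * hom_part G l b)" "cbilinear (\<lambda>a b. hom_part G k a * b)" for k l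
    unfolding cbilinear_def by (intro conjI allI clinearI; simp add: lin)+
  then have m: "tensor_mult (\<lambda>a b. a * hom_part G l b) (\<lambda>a b. hom_part G k a * b)
      (a1 \<otimes> a2) (b1 \<otimes> b2) = (a1 * hom_part G l b1) \<otimes> (hom_part G k a2 * b2)" for k l
    by (rule tensor_mult_pure)
  have z: "(0 :: 'a) \<otimes> x = 0" "x \<otimes> (0 :: 'a) = 0" for x :: 'a
    using tensor_pure_bilinear clinear_0[of "(\<otimes>) x"] clinear_0[of "\<lambda>a. a \<otimes> x"]
    by (auto simp: cbilinear_def)
  show ?thesis
    unfolding graded_tensor_mult_def m
    by (cases i; cases j)
      (simp_all add: hom_part_homogeneous[OF G assms(2)] hom_part_homogeneous[OF G assms(3)] z)
qed

lemma graded_flip_homogeneous: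
  assumes G: "graded_algebra G" and "a \<in> G i" "b \<in> G j"
  shows "graded_flip G (a \<otimes> b) = koszul i j *\<^sub>C (b \<otimes> a)"
proof -
  note H = hom_part_linear[OF G]
  have T: "clinear (\<lambda>x. x \<otimes> y)" "clinear ((\<otimes>) x)" for x :: 'a and y :: 'a
    using tensor_pure_bilinear by (auto simp: cbilinear_def)
  note lin = clinear_add[OF H] clinear_scale[OF H] clinear_add[OF T(1)] clinear_add[OF T(2)]
    clinear_scale[OF T(1)] clinear_scale[OF T(2)]
  have "cbilinear (\<lambda>a b. \<Sum>i\<in>{0, 1}. \<Sum>j\<in>{0, 1}.
      koszul i j *\<^sub>C (hom_part G j b \<otimes> hom_part G i a))"
    unfolding cbilinear_def
    by (intro conjI allI clinearI)
      (simp_all add: lin scaleC_add_right scaleC_scaleC mult.commute)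
  note e = tensor_lift_pure[OF this]
  have z: "(0 :: 'a) \<otimes> x = 0" "x \<otimes> (0 :: 'a) = 0" for x :: 'a
    using clinear_0[OF T(1)] clinear_0[OF T(2)] by auto
  show ?thesis
    unfolding graded_flip_def e
    by (cases i; cases j)
      (simp_all add: hom_part_homogeneous[OF G assms(2)] hom_part_homogeneous[OF G assms(3)] z)
qed

end

theory Submission
  imports Defs
begin

text \<open>
  The antipode is the convolution inverse of the identity of \<open>\<C>\<^sub>\<Gamma>\<close>, so no relation of the algebra has
  to be checked on it.  It exists by Takeuchi's argument: the number of odd generators gives a coalgebra
  filtration, and a linear map is convolution invertible as soon as it is so on the zeroth piece.  That
  piece is the image of \<open>\<E>\<^sub>\<Gamma>\<close>; a representation by \<open>2 \<times> 2\<close> matrices over \<open>\<E>\<^sub>\<Gamma>\<close> shows that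
  \<open>\<E>\<^sub>\<Gamma> \<rightarrow> \<C>\<^sub>\<Gamma>\<close> is injective, so the antipode of \<open>\<E>\<^sub>\<Gamma>\<close> is the required inverse there.

  For the inverse of the antipode the same argument is run with the graded opposite product.  It needs that
  \<open>S\<close> maps \<open>\<E>\<^sub>\<Gamma>\<close> onto itself, although only \<open>S(f\<^sub>i\<^sub>j) \<in> \<E>\<^sub>\<Gamma>\<close> is assumed: the invertible Drinfeld
  matrix of the left-invariant forms conjugates \<open>f\<close> into \<open>S\<^sup>2(f)\<close>, so each \<open>f\<^sub>i\<^sub>j\<close> is a linear combination of
  the \<open>S(S(f\<^sub>k\<^sub>l))\<close>.
\<close>

section \<open>Linear and bilinear maps on tensor products\<close>

text \<open>Prescribing the antipode on generators would mean verifying every relation, including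
  the quadratic ones with the coefficients \<open>t\<close>. Starting from a convolution inverse
  reverses the order of the argument. The antipode identity for a product of a generator with an
  arbitrary element \<open>z\<close> is a linear system whose matrix is formed by the
  \<open>f i j\<close>; that matrix is inverted by the elements \<open>f i j \<circ> S\<close>, and
  the unique solution yields at once the prescribed value on the generator and the reversal of
  products.

  Injectivity of \<E> into the algebra matters because \<open>h \<circ> S\<close> is built from the
  functional \<open>h\<close>, whereas an inverse on the zeroth piece may depend only on the image
  of \<open>h\<close>.

  The matrix units fit because e12 e21 + e21 e12 = 1 and both squares vanish, which is the pattern
  of the relations between \<xi> and \<delta>.

  For bijectivity, an injective map of an infinite-dimensional space into itself need not be onto,
  so stability of \<E> under S says nothing about its inverse. This is why the square of the
  antipode has to be expressed through the calculus itself.\<close>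

lemma clinear_sum: "clinear h \<Longrightarrow> h (\<Sum>i\<in>I. g i) = (\<Sum>i\<in>I. h (g i))"
  by (induction I rule: infinite_finite_induct) (simp_all add: clinear_0 clinear_add)

lemma clinear_neg: "clinear h \<Longrightarrow> h (- x) = - h x"
  using clinear_diff[of h 0 x] by (simp add: clinear_0)

lemma clinear_comp: "clinear g \<Longrightarrow> clinear h \<Longrightarrow> clinear (\<lambda>x. g (h x))"
  by (rule clinearI) (simp_all add: clinear_add clinear_scale)

lemma clinear_ident: "clinear (\<lambda>x. x)" "clinear id"
  by (rule clinearI; simp)+

lemma clinear_sum_fun:
  assumes "\<And>i. i \<in> I \<Longrightarrow> clinear (g i)"
  shows "clinear (\<lambda>x. \<Sum>i\<in>I. g i x)"
  using assms
  by (intro clinearI)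
    (simp_all add: clinear_add clinear_scale sum.distrib cvs.scale_sum_right)

lemma clinear_add_fun: "clinear g \<Longrightarrow> clinear h \<Longrightarrow> clinear (\<lambda>x. g x + h x)"
  by (rule clinearI) (simp_all add: clinear_add clinear_scale scaleC_add_right algebra_simps)

lemma clinear_diff_fun: "clinear g \<Longrightarrow> clinear h \<Longrightarrow> clinear (\<lambda>x. g x - h x)"
  by (rule clinearI)
    (simp_all add: clinear_add clinear_scale cvs.scale_right_diff_distrib algebra_simps)

lemma clinear_scale_fun: "clinear g \<Longrightarrow> clinear (\<lambda>x. c *\<^sub>C g x)"
  by (rule clinearI) (simp_all add: clinear_add clinear_scale scaleC_add_right scaleC_scaleC mult.commute)

lemma cbilinearI:
  assumes "\<And>a. clinear (B a)" "\<And>b. clinear (\<lambda>a. B a b)"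
  shows "cbilinear B"
  using assms by (simp add: cbilinear_def)

lemma cbilinearD:
  assumes "cbilinear B"
  shows "clinear (B a)" "clinear (\<lambda>a. B a b)"
  using assms by (simp_all add: cbilinear_def)

lemma clinear_bilinear_left: "cbilinear B \<Longrightarrow> clinear g \<Longrightarrow> clinear (\<lambda>x. B (g x) b)"
  by (rule clinear_comp[OF cbilinearD(2)])

lemma clinear_bilinear_right: "cbilinear B \<Longrightarrow> clinear g \<Longrightarrow> clinear (\<lambda>x. B a (g x))"
  by (rule clinear_comp[OF cbilinearD(1)])

lemma cbilinear_comp:
  "cbilinear B \<Longrightarrow> clinear g \<Longrightarrow> clinear h \<Longrightarrow> cbilinear (\<lambda>a b. B (g a) (h b))"
  by (rule cbilinearI) (rule clinear_bilinear_right clinear_bilinear_left, assumption+)+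

lemma cbilinear_post: "clinear h \<Longrightarrow> cbilinear B \<Longrightarrow> cbilinear (\<lambda>a b. h (B a b))"
  by (rule cbilinearI) (rule clinear_comp, assumption, erule cbilinearD)+

lemma cbilinear_swap: "cbilinear B \<Longrightarrow> cbilinear (\<lambda>a b. B b a)"
  by (simp add: cbilinear_def)

lemma cbilinear_mult: "cbilinear ((*) :: 'a::complex_algebra_1 \<Rightarrow> 'a \<Rightarrow> 'a)"
  by (intro cbilinearI clinearI) (simp_all add: algebra_simps scaleC_mult_left scaleC_mult_right)

lemma cbilinear_scale: "cbilinear (\<lambda>(c::complex) v. c *\<^sub>C v)"
  by (intro cbilinearI clinearI)
    (simp_all add: scaleC_add_left scaleC_add_right scaleC_scaleC scaleC_complex_def mult.commute)

lemma tensor_add_left: "(a + a') \<otimes> b = a \<otimes> b + a' \<otimes> b"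
  and tensor_add_right: "a \<otimes> (b + b') = a \<otimes> b + a \<otimes> b'"
  and tensor_scale_left: "(c *\<^sub>C a) \<otimes> b = c *\<^sub>C (a \<otimes> b)"
  and tensor_scale_right: "a \<otimes> (c *\<^sub>C b) = c *\<^sub>C (a \<otimes> b)"
  and tensor_neg_left: "(- a) \<otimes> b = - (a \<otimes> b)"
  and tensor_neg_right: "a \<otimes> (- b) = - (a \<otimes> b)"
  and tensor_zero_left: "0 \<otimes> b = 0"
  and tensor_zero_right: "a \<otimes> 0 = 0"
  and tensor_sum_left: "(\<Sum>i\<in>I. g i) \<otimes> b = (\<Sum>i\<in>I. g i \<otimes> b)"
  and tensor_sum_right: "a \<otimes> (\<Sum>i\<in>I. h i) = (\<Sum>i\<in>I. a \<otimes> h i)"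
  for a a' :: "'a::complex_vector" and b b' :: "'b::complex_vector"
  and g :: "'i \<Rightarrow> 'a" and h :: "'i \<Rightarrow> 'b"
proof -
  note L = cbilinearD(2)[OF tensor_pure_bilinear, where b = b]
  note R = cbilinearD(1)[OF tensor_pure_bilinear, where a = a]
  show "(a + a') \<otimes> b = a \<otimes> b + a' \<otimes> b" "(c *\<^sub>C a) \<otimes> b = c *\<^sub>C (a \<otimes> b)"
    "(- a) \<otimes> b = - (a \<otimes> b)" "0 \<otimes> b = 0" "(\<Sum>i\<in>I. g i) \<otimes> b = (\<Sum>i\<in>I. g i \<otimes> b)"
    by (rule clinear_add[OF L] clinear_scale[OF L] clinear_neg[OF L] clinear_0[OF L]
        clinear_sum[OF L])+
  show "a \<otimes> (b + b') = a \<otimes> b + a \<otimes> b'" "a \<otimes> (c *\<^sub>C b) = c *\<^sub>C (a \<otimes> b)"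
    "a \<otimes> (- b) = - (a \<otimes> b)" "a \<otimes> 0 = 0" "a \<otimes> (\<Sum>i\<in>I. h i) = (\<Sum>i\<in>I. a \<otimes> h i)"
    by (rule clinear_add[OF R] clinear_scale[OF R] clinear_neg[OF R] clinear_0[OF R]
        clinear_sum[OF R])+
qed

lemma poly_mapping_expand:
  "p = (\<Sum>k\<in>Poly_Mapping.keys p. Poly_Mapping.lookup p k *\<^sub>C Poly_Mapping.single k (1::complex))"
proof (rule poly_mapping_eqI)
  fix k
  have "Poly_Mapping.lookup
      (\<Sum>l\<in>Poly_Mapping.keys p. Poly_Mapping.lookup p l *\<^sub>C Poly_Mapping.single l (1::complex)) k
    = (\<Sum>l\<in>Poly_Mapping.keys p. if l = k then Poly_Mapping.lookup p k else 0)"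
    by (simp add: lookup_sum scaleC_poly_mapping.rep_eq lookup_single when_def
        scaleC_complex_def if_distrib cong: if_cong)
  then show "Poly_Mapping.lookup p k = Poly_Mapping.lookup
      (\<Sum>l\<in>Poly_Mapping.keys p. Poly_Mapping.lookup p l *\<^sub>C Poly_Mapping.single l 1) k"
    by (simp add: in_keys_iff)
qed

text \<open>A scalar in front of a pure tensor can be absorbed into its left factor, so sums of pure
  tensors already exhaust the space and no case for scaling is needed.\<close>

lemma tensor_induct [case_names pure add]:
  assumes pure: "\<And>a b. P (a \<otimes> b)" and add: "\<And>s u. P s \<Longrightarrow> P u \<Longrightarrow> P (s + u)"
  shows "P (s :: ('a::complex_vector, 'b::complex_vector) tensor)"
proof -
  obtain p where p: "s = abs_tensor p" by (metis Quotient_abs_rep Quotient_tensor)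
  have "P (abs_tensor (\<Sum>k\<in>K. c k *\<^sub>C Poly_Mapping.single k 1))" if "finite K" for K c
    using that
  proof (induction K)
    case empty
    show ?case
      using pure[of 0 0] by (simp only: sum.empty clinear_0[OF abs_tensor_linear] tensor_zero_left)
  next
    case (insert k K)
    have "abs_tensor (c k *\<^sub>C Poly_Mapping.single k 1) = (c k *\<^sub>C fst k) \<otimes> snd k"
      by (simp only: clinear_scale[OF abs_tensor_linear] tensor_scale_left)
        (simp add: tensor_pure.abs_eq)
    then show ?case
      using insert by (simp add: clinear_add[OF abs_tensor_linear] add pure)
  qed
  then show ?thesis
    by (subst p, subst poly_mapping_expand) simp
qed

lemma clinear_lift: "cbilinear B \<Longrightarrow> clinear g \<Longrightarrow> clinear (\<lambda>x. tensor_lift B (g x))"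
  by (rule clinear_comp[OF tensor_lift_linear])

text \<open>Supplies linearity in a parameter of the bilinear map, such as the outer variable of an
  iterated lift.\<close>

lemma clinear_lift_param:
  assumes B: "\<And>p. cbilinear (B p)" and p: "\<And>a b. clinear (\<lambda>p. B p a b)"
  shows "clinear (\<lambda>p. tensor_lift (B p) s)"
proof (rule clinearI)
  note T = tensor_lift_linear[OF B]
  fix x y c
  show "tensor_lift (B (x + y)) s = tensor_lift (B x) s + tensor_lift (B y) s"
  proof (induction s rule: tensor_induct)
    case (pure a b)
    show ?case by (simp only: tensor_lift_pure[OF B]) (rule clinear_add[OF p])
  next
    case (add s u)
    show ?case by (simp only: clinear_add[OF T] add ac_simps)
  qed
  show "tensor_lift (B (c *\<^sub>C x)) s = c *\<^sub>C tensor_lift (B x) s"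
  proof (induction s rule: tensor_induct)
    case (pure a b)
    show ?case by (simp only: tensor_lift_pure[OF B]) (rule clinear_scale[OF p])
  next
    case (add s u)
    show ?case by (simp only: clinear_add[OF T] add scaleC_add_right)
  qed
qed

lemma tensor_lift_comp:
  assumes "clinear h" "cbilinear B"
  shows "h (tensor_lift B s) = tensor_lift (\<lambda>a b. h (B a b)) s"
  by (induction s rule: tensor_induct)
    (simp_all add: tensor_lift_pure cbilinear_post assms clinear_add[OF tensor_lift_linear]
      clinear_add[OF assms(1)])

lemma cbilinear_add_fun: "cbilinear B \<Longrightarrow> cbilinear B' \<Longrightarrow> cbilinear (\<lambda>a b. B a b + B' a b)"
  by (simp add: cbilinear_def clinear_add_fun)

lemma tensor_lift_add:
  assumes "cbilinear B" "cbilinear B'"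
  shows "tensor_lift (\<lambda>a b. B a b + B' a b) s = tensor_lift B s + tensor_lift B' s"
proof -
  note B = cbilinear_add_fun[OF assms]
  show ?thesis
  proof (induction s rule: tensor_induct)
    case (pure a b)
    show ?case by (simp only: tensor_lift_pure[OF B] tensor_lift_pure assms)
  next
    case (add s u)
    show ?case
      by (simp only: clinear_add[OF tensor_lift_linear[OF B]]
          clinear_add[OF tensor_lift_linear] assms add ac_simps)
  qed
qed

lemma tensor_map_bilinear:
  "clinear g \<Longrightarrow> clinear h \<Longrightarrow> cbilinear (\<lambda>a b. g a \<otimes> h b)"
  by (rule cbilinear_comp[OF tensor_pure_bilinear])

lemma tensor_map_pure: "clinear g \<Longrightarrow> clinear h \<Longrightarrow> tensor_map g h (a \<otimes> b) = g a \<otimes> h b"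
  by (simp add: tensor_map_def tensor_lift_pure tensor_map_bilinear)

lemma tensor_map_linear: "clinear g \<Longrightarrow> clinear h \<Longrightarrow> clinear (tensor_map g h)"
  unfolding tensor_map_def by (intro tensor_lift_linear tensor_map_bilinear)

lemma tensor_lift_map:
  assumes "clinear g" "clinear h" "cbilinear B"
  shows "tensor_lift B (tensor_map g h s) = tensor_lift (\<lambda>a b. B (g a) (h b)) s"
  unfolding tensor_map_def
  by (subst tensor_lift_comp)
    (simp_all add: tensor_lift_linear tensor_map_bilinear assms tensor_lift_pure)

lemma tensor_mult_bilinear:
  assumes m: "cbilinear m" and n: "cbilinear n"
  shows "cbilinear (tensor_mult m n)"
proof -
  have inner: "cbilinear (\<lambda>c d. m a c \<otimes> n b d)" for a b
    by (rule tensor_map_bilinear[OF cbilinearD(1)[OF m] cbilinearD(1)[OF n]])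
  have a: "clinear (\<lambda>a. m a c \<otimes> n b d)" for c b d
    by (rule clinear_bilinear_left[OF tensor_pure_bilinear cbilinearD(2)[OF m]])
  have b: "clinear (\<lambda>b. m a c \<otimes> n b d)" for a c d
    by (rule clinear_bilinear_right[OF tensor_pure_bilinear cbilinearD(2)[OF n]])
  have outer: "cbilinear (\<lambda>a b. tensor_lift (\<lambda>c d. m a c \<otimes> n b d) t)" for t
    by (intro cbilinearI clinear_lift_param inner a b)
  have "clinear (\<lambda>t. tensor_lift (\<lambda>a b. tensor_lift (\<lambda>c d. m a c \<otimes> n b d) t) s)" for s
    by (intro clinear_lift_param outer tensor_lift_linear inner)
  then show ?thesis
    unfolding tensor_mult_def by (intro cbilinearI tensor_lift_linear outer)
qed

lemmas tensor_mult_alg_bilinear = tensor_mult_bilinear[OF cbilinear_mult cbilinear_mult]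
lemmas tensor_mult_alg_pure = tensor_mult_pure[OF cbilinear_mult cbilinear_mult]

lemma complex_algebra_1_scaleC_1_mult:
  "(c *\<^sub>C 1) * x = c *\<^sub>C x" "x * (c *\<^sub>C 1) = c *\<^sub>C x" for x :: "'a::complex_algebra_1"
  by (simp_all add: scaleC_mult_left scaleC_mult_right)

text \<open>Makes Sweedler notation literal: a coproduct is replaced by an explicit finite sum of
  pure tensors.\<close>

lemma tensor_finite_sum:
  obtains n :: nat and a b where "s = (\<Sum>k<n. a k \<otimes> b k)"
proof -
  have "\<exists>(n::nat) a b. s = (\<Sum>k<n. a k \<otimes> b k)"
  proof (induction s rule: tensor_induct)
    case (pure a b)
    have "a \<otimes> b = (\<Sum>k<Suc 0. a \<otimes> b)" by simp
    then show ?case by (intro exI)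
  next
    case (add s u)
    then obtain n m :: nat and a b c d
      where *: "s = (\<Sum>k<n. a k \<otimes> b k)" "u = (\<Sum>k<m. c k \<otimes> d k)" by blast
    have "s + u = (\<Sum>k<n + m. (if k < n then a k else c (k - n)) \<otimes> (if k < n then b k else d (k - n)))"
      unfolding * by (induction m) (simp_all add: add.assoc)
    then show ?case by (intro exI)
  qed
  then show ?thesis using that by blast
qed

lemma tensor_lift_sum_pure:
  "cbilinear B \<Longrightarrow> tensor_lift B (\<Sum>k\<in>K. a k \<otimes> b k) = (\<Sum>k\<in>K. B (a k) (b k))"
  by (simp add: clinear_sum[OF tensor_lift_linear] tensor_lift_pure)

lemma tensor_lift_mult:
  assumes "cbilinear m" "cbilinear n" "cbilinear B"
  shows "tensor_lift B (tensor_mult m n s t) =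
    tensor_lift (\<lambda>a b. tensor_lift (\<lambda>c d. B (m a c) (n b d)) t) s"
proof -
  have inner: "cbilinear (\<lambda>c d. m a c \<otimes> n b d)" for a b
    by (rule tensor_map_bilinear[OF cbilinearD(1)[OF assms(1)] cbilinearD(1)[OF assms(2)]])
  have "cbilinear (\<lambda>a b. tensor_lift (\<lambda>c d. m a c \<otimes> n b d) t)"
    by (rule cbilinearI; rule clinear_lift_param[OF inner];
        rule clinear_bilinear_left[OF tensor_pure_bilinear cbilinearD(2)[OF assms(1)]]
          clinear_bilinear_right[OF tensor_pure_bilinear cbilinearD(2)[OF assms(2)]])
  then have "tensor_lift B (tensor_mult m n s t) =
      tensor_lift (\<lambda>a b. tensor_lift B (tensor_lift (\<lambda>c d. m a c \<otimes> n b d) t)) s"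
    unfolding tensor_mult_def by (rule tensor_lift_comp[OF tensor_lift_linear[OF assms(3)]])
  then show ?thesis
    by (simp add: tensor_lift_comp[OF tensor_lift_linear[OF assms(3)] inner] tensor_lift_pure[OF assms(3)])
qed

text \<open>The two maps are compared only on pairs satisfying \<open>R\<close>. This is how facts
  valid on certain filtration levels enter a computation with a coproduct.\<close>

lemma tensor_lift_cong_span:
  assumes "s \<in> cvs.span {a \<otimes> b | a b. R a b}" "cbilinear B" "cbilinear B'"
    and "\<And>a b. R a b \<Longrightarrow> B a b = B' a b"
  shows "tensor_lift B s = tensor_lift B' s"
  using assms(1)
proof (induction rule: cvs.span_induct_alt)
  case base
  show ?case by (simp add: clinear_0[OF tensor_lift_linear] assms)
next
  case (step c x y)
  then obtain a b where "x = a \<otimes> b" "R a b" by blast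
  then show ?case
    using step assms(2-) by (simp add: clinear_add[OF tensor_lift_linear]
        clinear_scale[OF tensor_lift_linear] tensor_lift_pure)
qed

lemma tensor_lift_sum:
  assumes "\<And>i. i \<in> I \<Longrightarrow> cbilinear (B i)"
  shows "tensor_lift (\<lambda>a b. \<Sum>i\<in>I. B i a b) s = (\<Sum>i\<in>I. tensor_lift (B i) s)"
proof (induction s rule: tensor_induct)
  have sum: "cbilinear (\<lambda>a b. \<Sum>i\<in>I. B i a b)"
    by (intro cbilinearI clinear_sum_fun) (simp_all add: cbilinearD[OF assms])
  case (pure a b)
  show ?case by (simp add: tensor_lift_pure sum assms)
next
  have sum: "cbilinear (\<lambda>a b. \<Sum>i\<in>I. B i a b)"
    by (intro cbilinearI clinear_sum_fun) (simp_all add: cbilinearD[OF assms])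
  case (add s u)
  then show ?case
    by (simp add: clinear_add[OF tensor_lift_linear[OF sum]] clinear_add[OF tensor_lift_linear]
        assms sum.distrib)
qed

lemma tensor_mult_assoc:
  fixes r s t :: "('a::complex_algebra_1, 'b::complex_algebra_1) tensor"
  shows "tensor_mult (*) (*) (tensor_mult (*) (*) r s) t =
    tensor_mult (*) (*) r (tensor_mult (*) (*) s t)"
proof -
  note B = tensor_mult_bilinear[OF cbilinear_mult[where 'a = 'a] cbilinear_mult[where 'a = 'b]]
  note [simp] = clinear_add[OF cbilinearD(1)[OF B]] clinear_add[OF cbilinearD(2)[OF B]]
    tensor_mult_alg_pure
  have 1: "tensor_mult (*) (*) (tensor_mult (*) (*) (a \<otimes> b) (c \<otimes> d)) t =
    tensor_mult (*) (*) (a \<otimes> b) (tensor_mult (*) (*) (c \<otimes> d) t)" for a c :: 'a and b d :: 'b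
    by (induction t rule: tensor_induct) (simp_all add: mult.assoc)
  have 2: "tensor_mult (*) (*) (tensor_mult (*) (*) (a \<otimes> b) s) t =
    tensor_mult (*) (*) (a \<otimes> b) (tensor_mult (*) (*) s t)" for a :: 'a and b :: 'b
    by (induction s rule: tensor_induct) (simp_all add: 1[unfolded tensor_mult_alg_pure])
  show ?thesis
    by (induction r rule: tensor_induct) (simp_all add: 2)
qed

lemma tensor_mult_one:
  fixes t :: "('a::complex_algebra_1, 'b::complex_algebra_1) tensor"
  shows "tensor_mult (*) (*) (1 \<otimes> 1) t = t" "tensor_mult (*) (*) t (1 \<otimes> 1) = t"
proof -
  note B = tensor_mult_bilinear[OF cbilinear_mult[where 'a = 'a] cbilinear_mult[where 'a = 'b]]
  show "tensor_mult (*) (*) (1 \<otimes> 1) t = t" "tensor_mult (*) (*) t (1 \<otimes> 1) = t"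
    by (induction t rule: tensor_induct;
      simp add: tensor_mult_alg_pure clinear_add[OF cbilinearD(1)[OF B]] clinear_add[OF cbilinearD(2)[OF B]])+
qed

section \<open>Convolution\<close>

definition convolve ::
  "('a::complex_vector \<Rightarrow> ('a, 'a) tensor) \<Rightarrow>
    ('b::complex_vector \<Rightarrow> 'c::complex_vector \<Rightarrow> 'd::complex_vector) \<Rightarrow>
    ('a \<Rightarrow> 'b) \<Rightarrow> ('a \<Rightarrow> 'c) \<Rightarrow> 'a \<Rightarrow> 'd" where
  "convolve cop m P Q x = tensor_lift (\<lambda>a b. m (P a) (Q b)) (cop x)"

lemma coalgebraD:
  assumes "coalgebra cop cou"
  shows "clinear cop" "clinear cou"
    and "tensor_assoc (tensor_map cop id (cop x)) = tensor_map id cop (cop x)"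
    and "tensor_lift (\<lambda>a b. cou a *\<^sub>C b) (cop x) = x"
    and "tensor_lift (\<lambda>a b. cou b *\<^sub>C a) (cop x) = x"
  using assms by (auto simp: coalgebra_def)

lemma convolve_linear:
  assumes "clinear cop" "cbilinear m" "clinear P" "clinear Q"
  shows "clinear (convolve cop m P Q)"
  unfolding convolve_def by (rule clinear_lift[OF cbilinear_comp[OF assms(2-4)] assms(1)])

lemma convolve_comp:
  assumes "clinear h" "cbilinear m" "clinear P" "clinear Q"
  shows "h (convolve cop m P Q x) = convolve cop (\<lambda>p q. h (m p q)) P Q x"
  unfolding convolve_def by (rule tensor_lift_comp[OF assms(1) cbilinear_comp[OF assms(2-4)]])

lemma convolve_cong:
  assumes "\<And>a b. m (P a) (Q b) = m' (P' a) (Q' b)"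
  shows "convolve cop m P Q x = convolve cop m' P' Q' x"
  unfolding convolve_def by (simp add: assms)

lemma convolve_scale_left:
  assumes "cbilinear m" "clinear P" "clinear Q"
  shows "convolve cop m (\<lambda>a. c *\<^sub>C P a) Q x = c *\<^sub>C convolve cop m P Q x"
proof -
  have "(\<lambda>a b. m (c *\<^sub>C P a) (Q b)) = (\<lambda>a b. c *\<^sub>C m (P a) (Q b))"
    by (simp add: clinear_scale[OF cbilinearD(2)[OF assms(1)]])
  then show ?thesis
    unfolding convolve_def
    by (simp add: tensor_lift_comp[OF clinear_scale_fun[OF clinear_ident(1)] cbilinear_comp[OF assms], symmetric])
qed

lemma convolve_add_left:
  assumes "cbilinear m" "clinear P" "clinear P'" "clinear Q"
  shows "convolve cop m (\<lambda>a. P a + P' a) Q x = convolve cop m P Q x + convolve cop m P' Q x"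
  unfolding convolve_def
  by (simp add: clinear_add[OF cbilinearD(2)[OF assms(1)]] tensor_lift_add cbilinear_comp assms)

lemma convolve_add_right:
  assumes "cbilinear m" "clinear P" "clinear Q" "clinear Q'"
  shows "convolve cop m P (\<lambda>a. Q a + Q' a) x = convolve cop m P Q x + convolve cop m P Q' x"
  unfolding convolve_def
  by (simp add: clinear_add[OF cbilinearD(1)[OF assms(1)]] tensor_lift_add cbilinear_comp assms)

lemma convolve_scale_right:
  assumes "cbilinear m" "clinear P" "clinear Q"
  shows "convolve cop m P (\<lambda>a. c *\<^sub>C Q a) x = c *\<^sub>C convolve cop m P Q x"
proof -
  have "(\<lambda>a b. m (P a) (c *\<^sub>C Q b)) = (\<lambda>a b. c *\<^sub>C m (P a) (Q b))"
    by (simp add: clinear_scale[OF cbilinearD(1)[OF assms(1)]])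
  then show ?thesis
    unfolding convolve_def
    by (simp add: tensor_lift_comp[OF clinear_scale_fun[OF clinear_ident(1)] cbilinear_comp[OF assms], symmetric])
qed

lemma clinear_zero_fun: "clinear (\<lambda>x. 0)"
  by (rule clinearI) simp_all

lemma convolve_zero_left: "cbilinear m \<Longrightarrow> clinear Q \<Longrightarrow> convolve cop m (\<lambda>a. 0) Q x = 0"
  using convolve_scale_left[of m "\<lambda>a. 0" Q cop 0 x] by (simp add: clinear_zero_fun)

lemma convolve_zero_right: "cbilinear m \<Longrightarrow> clinear P \<Longrightarrow> convolve cop m P (\<lambda>a. 0) x = 0"
  using convolve_scale_right[of m P "\<lambda>a. 0" cop 0 x] by (simp add: clinear_zero_fun)

lemma convolve_sum_left:
  assumes "cbilinear m" "\<And>i. i \<in> I \<Longrightarrow> clinear (P i)" "clinear Q"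
  shows "convolve cop m (\<lambda>a. \<Sum>i\<in>I. P i a) Q x = (\<Sum>i\<in>I. convolve cop m (P i) Q x)"
  using assms(2)
  by (induction I rule: infinite_finite_induct)
    (simp_all add: convolve_zero_left convolve_add_left clinear_sum_fun assms)

lemma convolve_sum_right:
  assumes "cbilinear m" "clinear P" "\<And>i. i \<in> I \<Longrightarrow> clinear (Q i)"
  shows "convolve cop m P (\<lambda>a. \<Sum>i\<in>I. Q i a) x = (\<Sum>i\<in>I. convolve cop m P (Q i) x)"
  using assms(3)
  by (induction I rule: infinite_finite_induct)
    (simp_all add: convolve_zero_right convolve_add_right clinear_sum_fun assms)

lemma convolve_counit_left:
  assumes "coalgebra cop cou" "cbilinear m" "clinear Q"
  shows "convolve cop m (\<lambda>a. cou a *\<^sub>C u) Q x = m u (Q x)"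
proof -
  have "clinear (\<lambda>x. m u (Q x))" by (rule clinear_bilinear_right[OF assms(2,3)])
  note L = this
  have "m u (Q x) = m u (Q (tensor_lift (\<lambda>a b. cou a *\<^sub>C b) (cop x)))"
    by (simp add: coalgebraD(4)[OF assms(1)])
  also have "\<dots> = tensor_lift (\<lambda>a b. m u (Q (cou a *\<^sub>C b))) (cop x)"
    by (rule tensor_lift_comp[OF L cbilinear_comp[OF cbilinear_scale coalgebraD(2)[OF assms(1)] clinear_ident(1)]])
  finally show ?thesis
    unfolding convolve_def
    by (simp add: clinear_scale[OF assms(3)] clinear_scale[OF cbilinearD(1)[OF assms(2)]]
        clinear_scale[OF cbilinearD(2)[OF assms(2)]])
qed

lemma convolve_counit_right:
  assumes "coalgebra cop cou" "cbilinear m" "clinear P"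
  shows "convolve cop m P (\<lambda>a. cou a *\<^sub>C u) x = m (P x) u"
proof -
  have L: "clinear (\<lambda>x. m (P x) u)" by (rule clinear_bilinear_left[OF assms(2,3)])
  have "m (P x) u = m (P (tensor_lift (\<lambda>a b. cou b *\<^sub>C a) (cop x))) u"
    by (simp add: coalgebraD(5)[OF assms(1)])
  also have "\<dots> = tensor_lift (\<lambda>a b. m (P (cou b *\<^sub>C a)) u) (cop x)"
    by (rule tensor_lift_comp[OF L cbilinear_swap[OF cbilinear_comp[OF cbilinear_scale coalgebraD(2)[OF assms(1)] clinear_ident(1)]]])
  finally show ?thesis
    unfolding convolve_def
    by (simp add: clinear_scale[OF assms(3)] clinear_scale[OF cbilinearD(1)[OF assms(2)]]
        clinear_scale[OF cbilinearD(2)[OF assms(2)]])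
qed

text \<open>Coassociativity with four independent products, required to be compatible only on values
  of \<open>P\<close>, \<open>Q\<close> and \<open>R\<close>. This freedom lets one lemma replace
  most rearrangements of Sweedler indices.\<close>

lemma convolve_assoc:
  assumes C: "coalgebra cop cou"
    and m: "cbilinear m1" "cbilinear m2" "cbilinear m3" "cbilinear m4"
    and L: "clinear P" "clinear Q" "clinear R"
    and eq: "\<And>a b c. m1 (m2 (P a) (Q b)) (R c) = m3 (P a) (m4 (Q b) (R c))"
  shows "convolve cop m1 (convolve cop m2 P Q) R x = convolve cop m3 P (convolve cop m4 Q R) x"
proof -
  \<comment> \<open>The threefold expression with its last two legs already lifted; both sides
    become values of the single linear map \<open>tensor_lift B\<close>.\<close>
  define B where "B a u = tensor_lift (\<lambda>b c. m3 (P a) (m4 (Q b) (R c))) u" for a u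
  note cop = coalgebraD(1)[OF C]
  have bc: "cbilinear (\<lambda>b c. m3 (P a) (m4 (Q b) (R c)))" for a
    by (rule cbilinear_post[OF cbilinearD(1)[OF m(3)] cbilinear_comp[OF m(4) L(2,3)]])
  have ab: "cbilinear (\<lambda>a b. m1 (m2 (P a) (Q b)) (R c))" for c
    by (rule cbilinear_post[OF cbilinearD(2)[OF m(1)] cbilinear_comp[OF m(2) L(1,2)]])
  have B: "cbilinear B"
    unfolding B_def
    by (intro cbilinearI tensor_lift_linear bc clinear_lift_param
        clinear_bilinear_left[OF m(3) L(1)])
  have sc: "cbilinear (\<lambda>s c. tensor_lift (\<lambda>a b. m1 (m2 (P a) (Q b)) (R c)) s)"
    by (intro cbilinearI tensor_lift_linear ab clinear_lift_param
        clinear_bilinear_right[OF m(1) L(3)])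
  have pp: "cbilinear (\<lambda>a b. a \<otimes> (b \<otimes> c))" for c
    by (rule cbilinear_comp[OF tensor_pure_bilinear clinear_ident(1) cbilinearD(2)[OF tensor_pure_bilinear]])
  have assoc: "cbilinear (\<lambda>s c. tensor_lift (\<lambda>a b. a \<otimes> (b \<otimes> c)) s)"
    by (intro cbilinearI tensor_lift_linear pp clinear_lift_param
        clinear_bilinear_right[OF tensor_pure_bilinear cbilinearD(1)[OF tensor_pure_bilinear]])
  note m4 = cbilinear_comp[OF m(4) L(2,3)] and m2 = cbilinear_comp[OF m(2) L(1,2)]
  have "convolve cop m3 P (convolve cop m4 Q R) x =
      tensor_lift (\<lambda>a b. m3 (P a) (tensor_lift (\<lambda>b c. m4 (Q b) (R c)) (cop b))) (cop x)"
    by (simp add: convolve_def)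
  also have "\<dots> = tensor_lift (\<lambda>a b. B (id a) (cop b)) (cop x)"
    by (simp add: B_def tensor_lift_comp[OF cbilinearD(1)[OF m(3)] m4])
  also have "\<dots> = tensor_lift B (tensor_map id cop (cop x))"
    by (rule tensor_lift_map[symmetric]) (simp_all add: clinear_ident cop B)
  also have "\<dots> = tensor_lift B (tensor_assoc (tensor_map cop id (cop x)))"
    by (simp add: coalgebraD(3)[OF C])
  also have "\<dots> = tensor_lift (\<lambda>s c. tensor_lift B (tensor_lift (\<lambda>a b. a \<otimes> (b \<otimes> c)) s))
      (tensor_map cop id (cop x))"
    unfolding tensor_assoc_def by (rule tensor_lift_comp[OF tensor_lift_linear[OF B] assoc])
  also have "(\<lambda>s c. tensor_lift B (tensor_lift (\<lambda>a b. a \<otimes> (b \<otimes> c)) s)) =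
      (\<lambda>s c. tensor_lift (\<lambda>a b. m1 (m2 (P a) (Q b)) (R c)) s)"
    by (simp add: tensor_lift_comp[OF tensor_lift_linear[OF B] pp] tensor_lift_pure[OF B]
        B_def tensor_lift_pure[OF bc] eq)
  also have "tensor_lift \<dots> (tensor_map cop id (cop x)) =
      tensor_lift (\<lambda>s c. tensor_lift (\<lambda>a b. m1 (m2 (P a) (Q b)) (R c)) (cop s)) (cop x)"
    by (subst tensor_lift_map[OF cop clinear_ident(2) sc]) simp
  also have "\<dots> = convolve cop m1 (convolve cop m2 P Q) R x"
    by (simp add: convolve_def tensor_lift_comp[OF cbilinearD(2)[OF m(1)] m2])
  finally show ?thesis ..
qed

section \<open>Convolution inverses and geometric series on a filtered coalgebra\<close>

locale convolution_algebra =
  fixes cop :: "'c::complex_vector \<Rightarrow> ('c, 'c) tensor" and cou :: "'c \<Rightarrow> complex"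
    and m :: "'d::complex_vector \<Rightarrow> 'd \<Rightarrow> 'd" and u :: 'd
  assumes coalg: "coalgebra cop cou" and m_bilinear: "cbilinear m"
    and m_assoc: "m (m p q) r = m p (m q r)"
    and m_unit: "m u p = p" "m p u = p"
begin

abbreviation star :: "('c \<Rightarrow> 'd) \<Rightarrow> ('c \<Rightarrow> 'd) \<Rightarrow> 'c \<Rightarrow> 'd" (infixl "\<star>" 70)
  where "P \<star> Q \<equiv> convolve cop m P Q"

abbreviation unit_map :: "'c \<Rightarrow> 'd" ("\<eta>") where "\<eta> x \<equiv> cou x *\<^sub>C u"

lemma unit_map_linear: "clinear \<eta>"
  by (rule clinear_bilinear_left[OF cbilinear_scale coalgebraD(2)[OF coalg]])

lemma star_linear: "clinear P \<Longrightarrow> clinear Q \<Longrightarrow> clinear (P \<star> Q)"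
  by (rule convolve_linear[OF coalgebraD(1)[OF coalg] m_bilinear])

lemma star_assoc:
  "clinear P \<Longrightarrow> clinear Q \<Longrightarrow> clinear R \<Longrightarrow> (P \<star> Q) \<star> R = P \<star> (Q \<star> R)"
  by (rule ext, rule convolve_assoc[OF coalg]) (simp_all add: m_bilinear m_assoc)

lemma star_unit: "clinear P \<Longrightarrow> \<eta> \<star> P = P" "clinear P \<Longrightarrow> P \<star> \<eta> = P"
  by (rule ext, simp add: convolve_counit_left[OF coalg m_bilinear] convolve_counit_right[OF coalg m_bilinear] m_unit)+

lemma star_inverse_unique:
  assumes "clinear L" "clinear J" "clinear R" "L \<star> J = \<eta>" "J \<star> R = \<eta>"
  shows "L = R"
  using star_assoc[OF assms(1-3)] star_unit assms by metis

primrec star_power :: "('c \<Rightarrow> 'd) \<Rightarrow> nat \<Rightarrow> 'c \<Rightarrow> 'd" where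
  "star_power P 0 = \<eta>"
| "star_power P (Suc k) = P \<star> star_power P k"

lemma star_power_linear: "clinear P \<Longrightarrow> clinear (star_power P k)"
  by (induction k) (simp_all add: unit_map_linear star_linear)

lemma star_power_commute: "clinear P \<Longrightarrow> star_power P k \<star> P = P \<star> star_power P k"
  by (induction k) (simp_all add: star_unit star_assoc star_power_linear)

end

locale filtered_convolution = convolution_algebra +
  fixes F :: "nat \<Rightarrow> 'a set"
  assumes F_mono: "i \<le> j \<Longrightarrow> F i \<subseteq> F j"
    and F_exhaust: "\<exists>n. x \<in> F n"
    and F_cop: "x \<in> F n \<Longrightarrow> cop x \<in> cvs.span {a \<otimes> b | a b. \<exists>i j. a \<in> F i \<and> b \<in> F j \<and> i + j \<le> n}"
begin

text \<open>Since \<open>P\<close> kills level 0, each of the \<open>k\<close> factors must use up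
  at least one level, and \<open>l < k\<close> levels are too few.\<close>

lemma star_power_vanishes:
  assumes P: "clinear P" "\<And>x. x \<in> F 0 \<Longrightarrow> P x = 0"
  shows "x \<in> F l \<Longrightarrow> l < k \<Longrightarrow> star_power P k x = 0"
proof (induction k arbitrary: x l)
  case (Suc k)
  have "m (P a) (star_power P k b) = 0" if "a \<in> F i" "b \<in> F j" "i + j \<le> l" for a b i j
  proof (cases i)
    case 0
    then show ?thesis using that P(2) by (simp add: clinear_0[OF cbilinearD(2)[OF m_bilinear]])
  next
    case (Suc i')
    then have "star_power P k b = 0" using that Suc.prems by (intro Suc.IH[of b j]) auto
    then show ?thesis by (simp add: clinear_0[OF cbilinearD(1)[OF m_bilinear]])
  qed
  moreover have "cbilinear (\<lambda>(a::'a) (b::'a). 0::'b)" by (simp add: cbilinear_def clinear_zero_fun)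
  ultimately have "(P \<star> star_power P k) x = tensor_lift (\<lambda>a b. 0) (cop x)"
    unfolding convolve_def
    by (intro tensor_lift_cong_span[OF F_cop[OF Suc.prems(1)]]
        cbilinear_comp[OF m_bilinear P(1) star_power_linear[OF P(1)]]) auto
  also have "\<dots> = 0"
    using convolve_zero_left[OF m_bilinear P(1), of cop x]
    by (simp add: convolve_def clinear_0[OF cbilinearD(2)[OF m_bilinear]])
  finally show ?case by simp
qed simp

text \<open>The inverse of \<open>\<eta> - P\<close> is the geometric series in \<open>P\<close>. By
  \<open>star_power_vanishes\<close> it is a finite sum at every point, although its length depends
  on the point.\<close>

lemma neumann_series:
  assumes P: "clinear P" "\<And>x. x \<in> F 0 \<Longrightarrow> P x = 0"
  obtains N where "clinear N" "(\<lambda>x. \<eta> x - P x) \<star> N = \<eta>" "N \<star> (\<lambda>x. \<eta> x - P x) = \<eta>"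
proof -
  define lev where "lev x = (LEAST n. x \<in> F n)" for x
  define N where "N x = (\<Sum>k\<le>lev x. star_power P k x)" for x
  have lev: "x \<in> F (lev x)" for x
    unfolding lev_def by (rule LeastI_ex[OF F_exhaust])
  have N: "N x = (\<Sum>k\<le>n. star_power P k x)" if "x \<in> F n" for x n
  proof -
    have "lev x \<le> n" unfolding lev_def by (rule Least_le) (rule that)
    moreover have "star_power P k x = 0" if "k > lev x" for k
      using star_power_vanishes[OF P lev that] .
    ultimately show ?thesis
      unfolding N_def by (intro sum.mono_neutral_left) auto
  qed
  note pl = star_power_linear[OF P(1)]
  have Nlin: "clinear N"
  proof (rule clinearI)
    fix x y c
    \<comment> \<open>The levels of the sum and of the multiple are included because a level is not
      assumed to be closed under these operations.\<close>
    define n where "n = Max (lev ` {x, y, x + y, c *\<^sub>C x})"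
    have "z \<in> F n" if "z \<in> {x, y, x + y, c *\<^sub>C x}" for z
      using F_mono[of "lev z" n] lev[of z] that unfolding n_def by (meson Max_ge finite.intros finite_imageI imageI subsetD)
    then have "x \<in> F n" "y \<in> F n" "x + y \<in> F n" "c *\<^sub>C x \<in> F n" by simp_all
    then show "N (x + y) = N x + N y" "N (c *\<^sub>C x) = c *\<^sub>C N x"
      by (simp_all add: N clinear_add[OF pl] clinear_scale[OF pl] sum.distrib cvs.scale_sum_right)
  qed
  define M where "M n x = (\<Sum>k\<le>n. star_power P k x)" for n x
  have Mlin: "clinear (M n)" for n
    unfolding M_def by (intro clinear_sum_fun pl)
  have M: "N x = M n x" if "x \<in> F n" for n x using N[OF that] by (simp add: M_def)
  have M_star: "M (Suc n) x = \<eta> x + (P \<star> M n) x" for n x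
    unfolding M_def sum.atMost_Suc_shift
    by (simp add: convolve_sum_right[OF m_bilinear P(1)] pl)
  have M_star': "(P \<star> M n) x = (M n \<star> P) x" for n x
    unfolding M_def
    by (simp add: convolve_sum_right[OF m_bilinear P(1)] convolve_sum_left[OF m_bilinear _ P(1)]
        pl star_power_commute[OF P(1)])
  have eq: "N x = \<eta> x + (P \<star> N) x \<and> N x = \<eta> x + (N \<star> P) x" for x
  proof -
    obtain n where n: "x \<in> F n" using F_exhaust by blast
    have *: "a \<in> F n \<and> b \<in> F n" if "\<exists>i j. a \<in> F i \<and> b \<in> F j \<and> i + j \<le> n" for a b
      using that F_mono by (metis add_leE subsetD)
    have "N a = M n a" "N b = M n b" if "\<exists>i j. a \<in> F i \<and> b \<in> F j \<and> i + j \<le> n" for a b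
      using *[OF that] M by blast+
    note Mn = this
    have "(P \<star> N) x = (P \<star> M n) x"
      unfolding convolve_def
      by (rule tensor_lift_cong_span[OF F_cop[OF n] cbilinear_comp[OF m_bilinear P(1) Nlin]
            cbilinear_comp[OF m_bilinear P(1) Mlin]]) (simp only: Mn(2))
    moreover have "(N \<star> P) x = (M n \<star> P) x"
      unfolding convolve_def
      by (rule tensor_lift_cong_span[OF F_cop[OF n] cbilinear_comp[OF m_bilinear Nlin P(1)]
            cbilinear_comp[OF m_bilinear Mlin P(1)]]) (simp only: Mn(1))
    \<comment> \<open>The recursion \<open>M_star\<close> lengthens the truncation by one, so
      \<open>x\<close> is read at level \<open>Suc n\<close> on the left and at level
      \<open>n\<close> on the right.\<close>
    moreover have "N x = M (Suc n) x" using M[of x "Suc n"] F_mono[OF le_SucI[OF order_refl], of n] n by blast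
    ultimately show ?thesis by (simp add: M_star M_star')
  qed
  have diff: "(\<lambda>x. \<eta> x - P x) = (\<lambda>x. \<eta> x + (- 1) *\<^sub>C P x)" by simp
  have "((\<lambda>x. \<eta> x - P x) \<star> N) x = \<eta> x" "(N \<star> (\<lambda>x. \<eta> x - P x)) x = \<eta> x" for x
    unfolding diff
    using eq[of x, THEN conjunct1] eq[of x, THEN conjunct2]
    by (simp_all only: convolve_add_left[OF m_bilinear unit_map_linear clinear_scale_fun[OF P(1)] Nlin]
        convolve_add_right[OF m_bilinear Nlin unit_map_linear clinear_scale_fun[OF P(1)]]
        convolve_scale_left[OF m_bilinear P(1) Nlin] convolve_scale_right[OF m_bilinear Nlin P(1)]
        star_unit Nlin) (simp_all add: algebra_simps)
  then show ?thesis using that[OF Nlin] by blast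
qed

text \<open>Both \<open>J \<star> g\<close> and \<open>g \<star> J\<close> differ from
  \<open>\<eta>\<close> by a map vanishing on level 0. The geometric series therefore gives a right
  inverse \<open>g \<star> N\<close> and a left inverse \<open>N' \<star> g\<close> of
  \<open>J\<close>, and associativity identifies them.\<close>

theorem convolution_inverse_extends:
  assumes J: "clinear J" and g: "clinear g"
    and inv: "\<And>x. x \<in> F 0 \<Longrightarrow> (J \<star> g) x = \<eta> x" "\<And>x. x \<in> F 0 \<Longrightarrow> (g \<star> J) x = \<eta> x"
  obtains S where "clinear S" "S \<star> J = \<eta>" "J \<star> S = \<eta>"
proof -
  note lin = clinear_diff_fun[OF unit_map_linear star_linear]
  obtain N where N: "clinear N" "(\<lambda>x. \<eta> x - (\<eta> x - (J \<star> g) x)) \<star> N = \<eta>"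
    using neumann_series[OF lin[OF J g]] inv by (metis (no_types, lifting) cancel_comm_monoid_add_class.diff_cancel)
  obtain N' where N': "clinear N'" "N' \<star> (\<lambda>x. \<eta> x - (\<eta> x - (g \<star> J) x)) = \<eta>"
    using neumann_series[OF lin[OF g J]] inv by (metis (no_types, lifting) cancel_comm_monoid_add_class.diff_cancel)
  have R: "J \<star> (g \<star> N) = \<eta>" using N star_assoc[OF J g N(1)] by simp
  have L: "(N' \<star> g) \<star> J = \<eta>" using N' star_assoc[OF N'(1) g J] by simp
  have "N' \<star> g = g \<star> N"
    by (rule star_inverse_unique[OF _ J _ L R]) (intro star_linear N(1) N'(1) g)+
  then show ?thesis using that[of "g \<star> N"] R L star_linear[OF g N(1)] by simp
qed

end

section \<open>Hopf algebras\<close>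

text \<open>Think of a coproduct of x with legs a_k and \<open>b k\<close>, and of
  \<open>p k y\<close> as a_k y, up to a sign twist in the graded case. The hypothesis is then the
  antipode identity for the product xy, and the conclusion reads S(x_1 y) x_2 = eps(x) S(y).
  Convolving with \<open>S\<close> in y cancels the leg of y standing behind \<open>b k\<close>. The
  form covers the ungraded and the graded antipode.\<close>

lemma antipode_shift:
  fixes S :: "'c::complex_algebra_1 \<Rightarrow> 'c"
  assumes C: "coalgebra cop cou" and S: "is_antipode cop cou S"
    and p: "\<And>k. k \<in> K \<Longrightarrow> clinear (p k)"
    and sum: "\<And>y. (\<Sum>k\<in>K. convolve cop (*) (\<lambda>c. S (p k c)) (\<lambda>d. b k * d) y) = (e * cou y) *\<^sub>C 1"
  shows "(\<Sum>k\<in>K. S (p k y) * b k) = e *\<^sub>C S y"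
proof -
  have Slin: "clinear S" using S by (simp add: is_antipode_def)
  note M = cbilinear_mult[where 'a = 'c] and cop = coalgebraD(1)[OF C]
  have Sp: "clinear (\<lambda>c. S (p k c))" if "k \<in> K" for k by (rule clinear_comp[OF Slin p[OF that]])
  note bd = cbilinearD(1)[OF M]
  have inner: "convolve cop (*) (\<lambda>d. b k * d) S = (\<lambda>y. cou y *\<^sub>C b k)" for k
  proof
    fix y
    have "convolve cop (*) (\<lambda>d. b k * d) S y = convolve cop (\<lambda>p q. b k * (p * q)) id S y"
      by (rule convolve_cong) (simp add: mult.assoc)
    also have "\<dots> = b k * convolve cop (*) id S y"
      by (rule convolve_comp[symmetric, OF bd M clinear_ident(2) Slin])
    also have "convolve cop (*) id S y = cou y *\<^sub>C 1"
      using S by (simp add: is_antipode_def convolve_def)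
    finally show "convolve cop (*) (\<lambda>d. b k * d) S y = cou y *\<^sub>C b k"
      by (simp add: complex_algebra_1_scaleC_1_mult)
  qed
  have "(\<Sum>k\<in>K. S (p k y) * b k) =
      (\<Sum>k\<in>K. convolve cop (*) (\<lambda>c. S (p k c)) (convolve cop (*) (\<lambda>d. b k * d) S) y)"
    unfolding inner by (intro sum.cong refl) (simp add: convolve_counit_right[OF C M Sp])
  also have "\<dots> = (\<Sum>k\<in>K. convolve cop (*) (convolve cop (*) (\<lambda>c. S (p k c)) (\<lambda>d. b k * d)) S y)"
    by (intro sum.cong refl convolve_assoc[OF C M M M M, symmetric] Sp Slin bd) (auto simp: mult.assoc)
  also have "\<dots> = convolve cop (*) (\<lambda>y. \<Sum>k\<in>K. convolve cop (*) (\<lambda>c. S (p k c)) (\<lambda>d. b k * d) y) S y"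
    by (rule convolve_sum_left[symmetric, OF M convolve_linear[OF cop M Sp bd] Slin])
  also have "\<dots> = convolve cop (*) (\<lambda>y. cou y *\<^sub>C (e *\<^sub>C 1)) S y"
    by (simp add: sum scaleC_scaleC mult.commute)
  also have "\<dots> = e *\<^sub>C S y"
    by (subst convolve_counit_left[OF C M Slin]) (simp add: complex_algebra_1_scaleC_1_mult)
  finally show ?thesis .
qed

locale hopf_structure =
  fixes cop :: "'a::complex_algebra_1 \<Rightarrow> ('a, 'a) tensor" and cou :: "'a \<Rightarrow> complex" and S :: "'a \<Rightarrow> 'a"
  assumes hopf: "hopf_algebra cop cou S"
begin

lemma coalg: "coalgebra cop cou"
  and cop_one: "cop 1 = 1 \<otimes> 1"
  and cop_mult: "cop (x * y) = tensor_mult (*) (*) (cop x) (cop y)"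
  and cou_one: "cou 1 = 1"
  and cou_mult: "cou (x * y) = cou x * cou y"
  and antipode: "is_antipode cop cou S"
  using hopf by (auto simp: hopf_algebra_def)

lemmas cop_linear = coalgebraD(1)[OF coalg]
lemmas cou_linear = coalgebraD(2)[OF coalg]

lemma S_linear: "clinear S"
  and S_left: "convolve cop (*) S (\<lambda>x. x) x = cou x *\<^sub>C 1"
  and S_right: "convolve cop (*) (\<lambda>x. x) S x = cou x *\<^sub>C 1"
  using antipode by (auto simp: is_antipode_def convolve_def)

section \<open>The antipode reverses products and coproducts\<close>

lemma S_one: "S 1 = 1"
  using S_left[of 1]
  by (simp add: convolve_def cop_one cou_one scaleC_one
      tensor_lift_pure[OF cbilinear_comp[OF cbilinear_mult S_linear clinear_ident(1)]])

lemma S_shift: "convolve cop (*) (\<lambda>a. S (a * y)) (\<lambda>x. x) x = cou x *\<^sub>C S y"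
proof -
  obtain n :: nat and a b where cop_x: "cop x = (\<Sum>k<n. a k \<otimes> b k)" by (rule tensor_finite_sum)
  have B: "cbilinear (\<lambda>a b. S a * b)"
    by (rule cbilinear_comp[OF cbilinear_mult S_linear clinear_ident(1)])
  have Bk: "cbilinear (\<lambda>c d. S (a k * c) * (b k * d))" for k
    by (rule cbilinear_comp[OF cbilinear_mult clinear_comp[OF S_linear cbilinearD(1)[OF cbilinear_mult]]
          cbilinearD(1)[OF cbilinear_mult]])
  have outer: "cbilinear (\<lambda>a b. tensor_lift (\<lambda>c d. S (a * c) * (b * d)) t)" for t
    by (intro cbilinearI clinear_lift_param
        cbilinear_comp[OF cbilinear_mult clinear_comp[OF S_linear cbilinearD(1)[OF cbilinear_mult]]
          cbilinearD(1)[OF cbilinear_mult]]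
        clinear_bilinear_left[OF cbilinear_mult clinear_comp[OF S_linear cbilinearD(2)[OF cbilinear_mult]]]
        clinear_bilinear_right[OF cbilinear_mult cbilinearD(2)[OF cbilinear_mult]])
  have "(\<Sum>k<n. S (a k * y) * b k) = cou x *\<^sub>C S y"
  proof (rule antipode_shift[OF coalg antipode])
    fix y
    have "(\<Sum>k<n. convolve cop (*) (\<lambda>c. S (a k * c)) (\<lambda>d. b k * d) y) =
        tensor_lift (\<lambda>a b. S a * b) (cop (x * y))"
      by (simp add: cop_mult tensor_lift_mult[OF cbilinear_mult cbilinear_mult B] cop_x
          tensor_lift_sum_pure[OF outer] convolve_def)
    then show "(\<Sum>k<n. convolve cop (*) (\<lambda>c. S (a k * c)) (\<lambda>d. b k * d) y) = (cou x * cou y) *\<^sub>C 1"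
      using S_left[of "x * y"] by (simp add: convolve_def cou_mult)
  qed (rule cbilinearD(1)[OF cbilinear_mult])
  moreover have "cbilinear (\<lambda>a b. S (a * y) * b)"
    by (rule cbilinear_comp[OF cbilinear_mult clinear_comp[OF S_linear cbilinearD(2)[OF cbilinear_mult]]
          clinear_ident(1)])
  ultimately show ?thesis
    by (simp add: convolve_def cop_x tensor_lift_sum_pure)
qed

text \<open>S(y) S(x) = eps(x_1) S(y) S(x_2) = S(x_1 y) x_2 S(x_3) = S(xy), where the second
  equality is \<open>S_shift\<close>.\<close>

lemma S_mult: "S (x * y) = S y * S x"
proof -
  note M = cbilinear_mult[where 'a = 'a]
  have Sy: "clinear (\<lambda>a. S (a * y))" by (rule clinear_comp[OF S_linear cbilinearD(2)[OF M]])
  have "S y * S x = convolve cop (*) (\<lambda>x. cou x *\<^sub>C S y) S x"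
    by (simp add: convolve_counit_left[OF coalg M S_linear])
  also have "\<dots> = convolve cop (*) (convolve cop (*) (\<lambda>a. S (a * y)) (\<lambda>x. x)) S x"
    by (simp add: S_shift[abs_def])
  also have "\<dots> = convolve cop (*) (\<lambda>a. S (a * y)) (convolve cop (*) (\<lambda>x. x) S) x"
    by (rule convolve_assoc[OF coalg M M M M Sy clinear_ident(1) S_linear]) (simp add: mult.assoc)
  also have "convolve cop (*) (\<lambda>x. x) S = (\<lambda>x. cou x *\<^sub>C 1)" by (rule ext) (rule S_right)
  also have "convolve cop (*) (\<lambda>a. S (a * y)) \<dots> x = S (x * y)"
    by (simp add: convolve_counit_right[OF coalg M Sy])
  finally show ?thesis ..
qed

lemma convolve_pure: "convolve cop (\<otimes>) (\<lambda>x. x) (\<lambda>x. x) = cop"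
proof -
  have "tensor_lift (\<otimes>) = (\<lambda>s. s :: ('a, 'a) tensor)"
    by (rule tensor_linear_unique[OF tensor_lift_linear[OF tensor_pure_bilinear] clinear_ident(1)])
      (simp add: tensor_lift_pure tensor_pure_bilinear)
  then show ?thesis by (intro ext) (simp add: convolve_def)
qed

text \<open>Among maps from A to its tensor square under convolution, \<open>cop \<circ> S\<close>
  is a left inverse of \<open>cop\<close> and the flipped expression is a right inverse, so they
  coincide.\<close>

lemma cop_S: "cop (S x) = convolve cop (\<lambda>p q. q \<otimes> p) S S x"
proof -
  let ?M = "tensor_mult (*) (*) :: ('a, 'a) tensor \<Rightarrow> _"
  note M = tensor_mult_bilinear[OF cbilinear_mult[where 'a = 'a] cbilinear_mult[where 'a = 'a]]
  note T = tensor_pure_bilinear[where 'a = 'a and 'b = 'a]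
  note T' = cbilinear_swap[OF T] and id = clinear_ident(1)[where 'a = 'a]
  note mult = cbilinear_mult[where 'a = 'a]
  interpret CA: convolution_algebra cop cou ?M "1 \<otimes> 1"
    by unfold_locales (simp_all add: coalg M tensor_mult_assoc tensor_mult_one)
  let ?Y = "convolve cop (\<lambda>p q. q \<otimes> p) S S"
  have Y: "clinear ?Y" by (rule convolve_linear[OF cop_linear T' S_linear S_linear])
  have 1: "convolve cop ?M (\<lambda>x. cop (S x)) cop = (\<lambda>x. cou x *\<^sub>C (1 \<otimes> 1))"
  proof
    fix x
    have "convolve cop ?M (\<lambda>x. cop (S x)) cop x = convolve cop (\<lambda>p q. cop (p * q)) S (\<lambda>x. x) x"
      by (rule convolve_cong) (simp add: cop_mult)
    also have "\<dots> = cop (convolve cop (*) S (\<lambda>x. x) x)"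
      by (rule convolve_comp[OF cop_linear mult S_linear id, symmetric])
    finally show "convolve cop ?M (\<lambda>x. cop (S x)) cop x = cou x *\<^sub>C (1 \<otimes> 1)"
      by (simp add: S_left clinear_scale[OF cop_linear] cop_one)
  qed
  \<comment> \<open>In legs, (1 \<otimes> x_1)(S(x_3) \<otimes> S(x_2)) = S(x_3) \<otimes> x_1
    S(x_2), and the pair in the second leg cancels.\<close>
  have "convolve cop (\<lambda>q. ?M (1 \<otimes> q)) (\<lambda>x. x) ?Y x = S x \<otimes> 1" for x
  proof -
    have m4: "cbilinear (\<lambda>q. ?M (1 \<otimes> q))"
      by (rule cbilinear_comp[OF M cbilinearD(1)[OF T] clinear_ident(1)])
    have "convolve cop (\<lambda>q. ?M (1 \<otimes> q)) (\<lambda>x. x) ?Y x =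
        convolve cop (\<lambda>p q. q \<otimes> p) (convolve cop (*) (\<lambda>x. x) S) S x"
      by (rule convolve_assoc[OF coalg T' mult m4 T' id S_linear S_linear, symmetric])
        (simp add: tensor_mult_alg_pure)
    also have "\<dots> = S x \<otimes> 1"
      by (simp add: S_right[abs_def] convolve_counit_left[OF coalg T' S_linear])
    finally show ?thesis .
  qed
  note inner = this
  have 2: "convolve cop ?M cop ?Y = (\<lambda>x. cou x *\<^sub>C (1 \<otimes> 1))"
  proof
    fix x
    have m3: "cbilinear (\<lambda>p. ?M (p \<otimes> 1))"
      by (rule cbilinear_comp[OF M cbilinearD(2)[OF T] clinear_ident(1)])
    have m4: "cbilinear (\<lambda>q. ?M (1 \<otimes> q))"
      by (rule cbilinear_comp[OF M cbilinearD(1)[OF T] clinear_ident(1)])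
    have "convolve cop ?M cop ?Y x = convolve cop ?M (convolve cop (\<otimes>) (\<lambda>x. x) (\<lambda>x. x)) ?Y x"
      by (simp add: convolve_pure)
    also have "\<dots> = convolve cop (\<lambda>p. ?M (p \<otimes> 1)) (\<lambda>x. x) (convolve cop (\<lambda>q. ?M (1 \<otimes> q)) (\<lambda>x. x) ?Y) x"
      by (rule convolve_assoc[OF coalg M T m3 m4 id id Y])
        (simp add: tensor_mult_assoc[symmetric] tensor_mult_alg_pure)
    also have "\<dots> = convolve cop (\<lambda>p q. (p * q) \<otimes> 1) (\<lambda>x. x) S x"
      unfolding inner[abs_def] by (rule convolve_cong) (simp add: tensor_mult_alg_pure)
    also have "\<dots> = convolve cop (*) (\<lambda>x. x) S x \<otimes> 1"
      by (rule convolve_comp[OF cbilinearD(2)[OF T] mult id S_linear, symmetric])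
    finally show "convolve cop ?M cop ?Y x = cou x *\<^sub>C (1 \<otimes> 1)"
      by (simp add: S_right tensor_scale_left)
  qed
  have "(\<lambda>x. cop (S x)) = ?Y"
    by (rule CA.star_inverse_unique[OF clinear_comp[OF cop_linear S_linear] cop_linear Y 1 2])
  then show ?thesis by (rule fun_cong)
qed

text \<open>Because the antipode reverses coproducts, composing functionals with it reverses their
  convolution.\<close>

lemma conv_antipode:
  assumes "clinear g" "clinear h"
  shows "conv cop g h (S x) = conv cop (h \<circ> S) (g \<circ> S) x"
proof -
  have B: "cbilinear (\<lambda>a b. g a * h b)"
    by (rule cbilinear_comp[OF cbilinear_mult assms])
  show ?thesis
    unfolding conv_def cop_S convolve_def
    by (subst tensor_lift_comp[OF tensor_lift_linear[OF B] cbilinear_comp[OF cbilinear_swap[OF tensor_pure_bilinear] S_linear S_linear]])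
      (simp add: tensor_lift_pure[OF B] mult.commute)
qed

section \<open>The convolution algebra of functionals and its left action on A\<close>

lemma conv_eq: "conv cop g h = convolve cop (*) g h"
  by (simp add: fun_eq_iff conv_def convolve_def)

lemma conv_linear: "clinear g \<Longrightarrow> clinear h \<Longrightarrow> clinear (conv cop g h)"
  unfolding conv_eq by (rule convolve_linear[OF cop_linear cbilinear_mult])

lemma conv_cou: "clinear g \<Longrightarrow> conv cop cou g = g" "clinear g \<Longrightarrow> conv cop g cou = g"
proof -
  have e: "cou = (\<lambda>a. cou a *\<^sub>C 1)" by (simp add: scaleC_complex_def)
  show "clinear g \<Longrightarrow> conv cop cou g = g" "clinear g \<Longrightarrow> conv cop g cou = g"
    by (subst e, simp add: conv_eq fun_eq_iff convolve_counit_left[OF coalg cbilinear_mult]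
      convolve_counit_right[OF coalg cbilinear_mult])+
qed

lemma conv_assoc:
  "clinear g \<Longrightarrow> clinear h \<Longrightarrow> clinear k \<Longrightarrow>
    conv cop (conv cop g h) k = conv cop g (conv cop h k)"
  unfolding conv_eq
  by (rule ext, rule convolve_assoc[OF coalg]) (simp_all add: cbilinear_mult mult.assoc)

lemma dual_act_eq: "dual_act cop f = convolve cop (\<lambda>a c. c *\<^sub>C a) (\<lambda>x. x) f"
  by (simp add: fun_eq_iff dual_act_def convolve_def)

lemma dual_act_linear: "clinear f \<Longrightarrow> clinear (dual_act cop f)"
  unfolding dual_act_eq
  by (rule convolve_linear[OF cop_linear cbilinear_swap[OF cbilinear_scale] clinear_ident(1)])

lemma apply_dual_act:
  assumes "clinear g" "clinear f"
  shows "g (dual_act cop f x) = conv cop g f x"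
  unfolding conv_eq dual_act_eq
  by (subst convolve_comp[OF assms(1) cbilinear_swap[OF cbilinear_scale] clinear_ident(1) assms(2)])
    (rule convolve_cong, simp add: clinear_scale[OF assms(1)] scaleC_complex_def)

lemma dual_act_conv:
  assumes "clinear g" "clinear f"
  shows "dual_act cop g (dual_act cop f x) = dual_act cop (conv cop g f) x"
proof -
  note sc = cbilinear_swap[OF cbilinear_scale] and id = clinear_ident(1)
  have "dual_act cop g (dual_act cop f x) = convolve cop (\<lambda>a c. c *\<^sub>C dual_act cop g a) (\<lambda>x. x) f x"
    unfolding dual_act_eq[of f]
    by (subst convolve_comp[OF dual_act_linear[OF assms(1)] sc id assms(2)])
      (simp add: clinear_scale[OF dual_act_linear[OF assms(1)]])
  also have "\<dots> = convolve cop (\<lambda>a c. c *\<^sub>C a) (convolve cop (\<lambda>a c. c *\<^sub>C a) (\<lambda>x. x) g) f x"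
    by (rule convolve_cong) (simp add: dual_act_eq)
  also have "\<dots> = convolve cop (\<lambda>a c. c *\<^sub>C a) (\<lambda>x. x) (convolve cop (*) g f) x"
    by (rule convolve_assoc[OF coalg sc sc sc cbilinear_mult id assms])
      (simp add: scaleC_scaleC mult.commute)
  finally show ?thesis by (simp add: dual_act_eq conv_eq)
qed

lemma dual_act_cou: "dual_act cop cou x = x"
  by (simp add: dual_act_def coalgebraD(5)[OF coalg])

text \<open>The counit recovers a functional from its action, so the action is faithful. This is
  what later detects the elements of \<E> inside a representation.\<close>

lemma cou_dual_act: "clinear f \<Longrightarrow> cou (dual_act cop f x) = f x"
  by (simp add: apply_dual_act cou_linear conv_cou)

end

text \<open>Otherwise the simplifier turns \<open>{1..N}\<close> into \<open>{Suc 0..N}\<close>, which no index hypothesis matches.\<close>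

declare One_nat_def [simp del]

context hopf_structure
begin

lemma cou_S: "cou (S x) = cou x"
proof -
  have "conv cop (\<lambda>x. cou (S x)) cou x = convolve cop (\<lambda>p q. cou (p * q)) S (\<lambda>x. x) x"
    unfolding conv_eq by (rule convolve_cong) (simp add: cou_mult)
  also have "\<dots> = cou (convolve cop (*) S (\<lambda>x. x) x)"
    by (rule convolve_comp[OF cou_linear cbilinear_mult S_linear clinear_ident(1), symmetric])
  also have "\<dots> = cou x"
    by (simp add: S_left clinear_scale[OF cou_linear] cou_one scaleC_complex_def)
  finally show ?thesis
    using conv_cou(2)[OF clinear_comp[OF cou_linear S_linear]] by metis
qed

end

section \<open>Bicovariant calculi\<close>

lemma span_image_atLeastAtMost:
  assumes "v \<in> cvs.span (e ` {1..N::nat})" "inj_on e {1..N}"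
  obtains c where "v = (\<Sum>i=1..N. c i *\<^sub>C e i)"
proof -
  have "v \<in> range (\<lambda>u. \<Sum>x\<in>e ` {1..N}. u x *\<^sub>C x)"
    using assms(1) by (simp add: cvs.span_finite)
  then obtain u where "v = (\<Sum>x\<in>e ` {1..N}. u x *\<^sub>C x)" by blast
  then have "v = (\<Sum>i=1..N. u (e i) *\<^sub>C e i)"
    using sum.reindex[OF assms(2), of "\<lambda>x. u x *\<^sub>C x"] by (simp add: o_def)
  then show ?thesis by (rule that[of "\<lambda>i. u (e i)"])
qed

lemma sum_fun_apply: "(\<Sum>i\<in>I. g i) x = (\<Sum>i\<in>I. g i x)"
  by (induction I rule: infinite_finite_induct) simp_all

locale fodc_structure = hopf_structure cop cou S
  for cop :: "'a::complex_algebra_1 \<Rightarrow> ('a, 'a) tensor" and cou :: "'a \<Rightarrow> complex" and S :: "'a \<Rightarrow> 'a" +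
  fixes lm :: "'a \<Rightarrow> 'g::complex_vector \<Rightarrow> 'g" and rm :: "'g \<Rightarrow> 'a \<Rightarrow> 'g" and d :: "'a \<Rightarrow> 'g"
    and lco :: "'g \<Rightarrow> ('a, 'g) tensor" and rco :: "'g \<Rightarrow> ('g, 'a) tensor"
    and N :: nat and \<omega> :: "nat \<Rightarrow> 'g" and f :: "nat \<Rightarrow> nat \<Rightarrow> 'a \<Rightarrow> complex"
    and J :: "nat \<Rightarrow> nat \<Rightarrow> 'a" and X :: "nat \<Rightarrow> 'a \<Rightarrow> complex"
  assumes calculus: "bicovariant_fodc cop cou lm rm d lco rco"
    and inv_basis: "basis_of N \<omega> (left_invariants lco)"
    and f_linear: "\<And>i j. i \<in> {1..N} \<Longrightarrow> j \<in> {1..N} \<Longrightarrow> clinear (f i j)"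
    and f_comm: "\<And>i x. i \<in> {1..N} \<Longrightarrow>
      rm (\<omega> i) x = (\<Sum>j=1..N. lm (dual_act cop (f i j) x) (\<omega> j))"
    and J_coaction: "\<And>i. i \<in> {1..N} \<Longrightarrow> rco (\<omega> i) = (\<Sum>j=1..N. \<omega> j \<otimes> J j i)"
    and tangent_basis: "basis_of N X (tangent_space cop cou S lm d)"
    and dual_basis: "\<And>i j. i \<in> {1..N} \<Longrightarrow> j \<in> {1..N} \<Longrightarrow>
      tangent_pairing cou lm d (X i) (\<omega> j) = (if i = j then 1 else 0)"
begin

lemma lm_bilinear: "cbilinear lm" and rm_bilinear: "cbilinear rm"
  and lm_one: "lm 1 v = v" and lm_mult: "lm (x * y) v = lm x (lm y v)"
  and rm_mult: "rm v (x * y) = rm (rm v x) y"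
  and lm_rm: "rm (lm x v) y = lm x (rm v y)"
  and d_linear: "clinear d" and leibniz: "d (x * y) = rm (d x) y + lm x (d y)"
  and lco_linear: "clinear lco" and rco_linear: "clinear rco"
  and lco_lm_d: "lco (lm x (d y)) = tensor_mult (*) lm (cop x) (tensor_map id d (cop y))"
  and rco_lm_d: "rco (lm x (d y)) = tensor_mult lm (*) (cop x) (tensor_map d id (cop y))"
  and rco_coassoc: "tensor_assoc (tensor_map rco id (rco v)) = tensor_map id cop (rco v)"
  and rco_counit: "tensor_lift (\<lambda>w a. cou a *\<^sub>C w) (rco v) = v"
  using calculus
  by (auto simp: bicovariant_fodc_def fodc_def bimodule_def left_coaction_def right_coaction_def)

lemma form_expand:
  obtains n :: nat and x y where "v = (\<Sum>k<n. lm (x k) (d (y k)))"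
  using calculus unfolding bicovariant_fodc_def fodc_def by blast

lemma form_linear_unique:
  assumes "clinear g" "clinear h" "\<And>x y. g (lm x (d y)) = h (lm x (d y))"
  shows "g v = h v"
proof -
  obtain n :: nat and x y where "v = (\<Sum>k<n. lm (x k) (d (y k)))" by (rule form_expand)
  then show ?thesis by (simp add: clinear_sum[OF assms(1)] clinear_sum[OF assms(2)] assms(3))
qed

lemma d_one: "d 1 = 0"
proof -
  have "rm (d 1) 1 = d 1"
    using calculus by (simp add: bicovariant_fodc_def fodc_def bimodule_def)
  then show ?thesis using leibniz[of 1 1] by (simp add: lm_one)
qed

subsection \<open>The projection onto the left-invariant forms\<close>

text \<open>The map S(y_1) d y_2 of Woronowicz, a Maurer-Cartan form; its kernel inside the kernel
  of the counit is \<open>calculus_ideal\<close>.\<close>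

definition inv_form :: "'a \<Rightarrow> 'g" where
  "inv_form y = convolve cop lm S d y"

definition inv_proj :: "'g \<Rightarrow> 'g" where
  "inv_proj v = tensor_lift (\<lambda>a w. lm (S a) w) (lco v)"

lemma inv_form_linear: "clinear inv_form"
  unfolding inv_form_def[abs_def]
  using convolve_linear[OF cop_linear lm_bilinear S_linear d_linear] by simp

lemma lmS_bilinear: "cbilinear (\<lambda>a w. lm (S a) w)"
  by (rule cbilinear_comp[OF lm_bilinear S_linear clinear_ident(1)])

lemma inv_proj_linear: "clinear inv_proj"
  unfolding inv_proj_def[abs_def] by (rule clinear_lift[OF lmS_bilinear lco_linear])

text \<open>In legs the value is S(x_1 y_1) x_2 d y_2 = S(y_1) S(x_1) x_2 d y_2. The auxiliary map
  \<open>\<Psi>\<close> isolates the slot between S(y_1) and d y_2, where the antipode identity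
  collapses x.\<close>

lemma inv_proj_lm_d: "inv_proj (lm x (d y)) = cou x *\<^sub>C inv_form y"
proof -
  let ?t = "tensor_map id d (cop y)"
  define \<Psi> where "\<Psi> e = tensor_lift (\<lambda>c w. lm (S c) (lm e w)) ?t" for e
  have B: "cbilinear (\<lambda>c w. lm (S c) (lm e w))" for e
    by (rule cbilinear_comp[OF lm_bilinear S_linear cbilinearD(1)[OF lm_bilinear]])
  have \<Psi>: "clinear \<Psi>"
    unfolding \<Psi>_def[abs_def]
    by (rule clinear_lift_param[OF B])
      (rule clinear_bilinear_right[OF lm_bilinear cbilinearD(2)[OF lm_bilinear]])
  have "inv_proj (lm x (d y)) =
      tensor_lift (\<lambda>a b. tensor_lift (\<lambda>c w. lm (S (a * c)) (lm b w)) ?t) (cop x)"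
    unfolding inv_proj_def lco_lm_d
    by (rule tensor_lift_mult[OF cbilinear_mult lm_bilinear lmS_bilinear])
  also have "\<dots> = tensor_lift (\<lambda>a b. \<Psi> (S a * b)) (cop x)"
    by (simp add: \<Psi>_def S_mult lm_mult)
  also have "\<dots> = \<Psi> (convolve cop (*) S (\<lambda>x. x) x)"
    unfolding convolve_def
    by (rule tensor_lift_comp[symmetric, OF \<Psi> cbilinear_comp[OF cbilinear_mult S_linear clinear_ident(1)]])
  also have "\<dots> = cou x *\<^sub>C \<Psi> 1" by (simp add: S_left clinear_scale[OF \<Psi>])
  also have "\<Psi> 1 = inv_form y"
    unfolding \<Psi>_def lm_one inv_form_def convolve_def
    by (subst tensor_lift_map[OF clinear_ident(2) d_linear lmS_bilinear]) simp
  finally show ?thesis .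
qed

text \<open>The coaction produces S(y_2) y_3 \<otimes> S(y_1) d y_4, and the adjacent pair in the
  first leg cancels.\<close>

lemma lco_inv_form: "lco (inv_form y) = 1 \<otimes> inv_form y"
proof -
  let ?M = "tensor_mult ((*) :: 'a \<Rightarrow> 'a \<Rightarrow> 'a) lm"
  note M = tensor_mult_bilinear[OF cbilinear_mult[where 'a = 'a] lm_bilinear]
  note mp = tensor_mult_pure[OF cbilinear_mult[where 'a = 'a] lm_bilinear]
  note T = tensor_pure_bilinear and id = clinear_ident(1)
  note AG = tensor_pure_bilinear[where 'a = 'a and 'b = 'g]
  note AA = tensor_pure_bilinear[where 'a = 'a and 'b = 'a]
  have m3: "cbilinear (\<lambda>p. ?M (1 \<otimes> p))"
    by (rule cbilinear_comp[OF M cbilinearD(1)[OF AA] clinear_ident(1)])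
  have m4: "cbilinear (\<lambda>q. ?M (q \<otimes> 1))"
    by (rule cbilinear_comp[OF M cbilinearD(2)[OF AA] clinear_ident(1)])
  have cd: "clinear (convolve cop (\<otimes>) (\<lambda>x. x) d)"
    by (rule convolve_linear[OF cop_linear AG id d_linear])
  have fac: "?M (q \<otimes> p) r = ?M (1 \<otimes> p) (?M (q \<otimes> 1) r)" for p q :: 'a and r
    by (induction r rule: tensor_induct)
      (simp_all add: mp lm_one clinear_add[OF cbilinearD(1)[OF M]])
  have inner: "convolve cop (\<lambda>q. ?M (q \<otimes> 1)) S (convolve cop (\<otimes>) (\<lambda>x. x) d) x = 1 \<otimes> d x" for x
  proof -
    have "convolve cop (\<lambda>q. ?M (q \<otimes> 1)) S (convolve cop (\<otimes>) (\<lambda>x. x) d) x =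
        convolve cop (\<otimes>) (convolve cop (*) S (\<lambda>x. x)) d x"
      by (rule convolve_assoc[OF coalg AG cbilinear_mult m4 AG S_linear id d_linear, symmetric])
        (simp add: mp lm_one)
    then show ?thesis by (simp add: S_left[abs_def] convolve_counit_left[OF coalg AG d_linear])
  qed
  have "lco (inv_form y) = convolve cop (\<lambda>a v. lco (lm a v)) S d y"
    unfolding inv_form_def by (rule convolve_comp[OF lco_linear lm_bilinear S_linear d_linear])
  also have "\<dots> = convolve cop ?M (convolve cop (\<lambda>p q. q \<otimes> p) S S) (convolve cop (\<otimes>) (\<lambda>x. x) d) y"
    by (rule convolve_cong) (simp add: lco_lm_d cop_S tensor_map_def convolve_def)
  also have "\<dots> = convolve cop (\<lambda>p. ?M (1 \<otimes> p)) S
      (convolve cop (\<lambda>q. ?M (q \<otimes> 1)) S (convolve cop (\<otimes>) (\<lambda>x. x) d)) y"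
    by (rule convolve_assoc[OF coalg M cbilinear_swap[OF AA] m3 m4 S_linear S_linear cd]) (rule fac)
  also have "\<dots> = convolve cop (\<lambda>p v. 1 \<otimes> lm p v) S d y"
    unfolding inner[abs_def] by (rule convolve_cong) (simp add: mp)
  also have "\<dots> = 1 \<otimes> inv_form y"
    unfolding inv_form_def
    by (rule convolve_comp[OF cbilinearD(1)[OF AG] lm_bilinear S_linear d_linear, symmetric])
  finally show ?thesis .
qed

subsection \<open>The pairing with the tangent space\<close>

text \<open>Justifies the definite description in \<open>tangent_pairing\<close>. A tangent
  functional \<open>Y\<close> factors through \<open>inv_form\<close>; composing it with a linear
  section \<open>g\<close> of \<open>inv_form\<close> and with \<open>inv_proj\<close> gives the
  functional, and forms x dy span, which gives uniqueness.\<close>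

lemma tangent_functional:
  assumes "Y \<in> tangent_space cop cou S lm d"
  shows "clinear (tangent_pairing cou lm d Y) \<and>
    (\<forall>x y. tangent_pairing cou lm d Y (lm x (d y)) = cou x * Y y)"
proof -
  have Y: "clinear Y" "Y 1 = 0" "\<And>z. cou z = 0 \<Longrightarrow> inv_form z = 0 \<Longrightarrow> Y z = 0"
    using assms by (auto simp: tangent_space_def calculus_ideal_def inv_form_def convolve_def)
  interpret vp: vector_space_pair "scaleC :: complex \<Rightarrow> 'a \<Rightarrow> 'a" "scaleC :: complex \<Rightarrow> 'g \<Rightarrow> 'g" ..
  obtain g where g: "clinear g" "\<And>y. inv_form (g (inv_form y)) = inv_form y"
    using vp.linear_exists_right_inverse_on[OF inv_form_linear, of UNIV] by auto
  have Yg: "Y (g (inv_form y)) = Y y" for y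
  proof -
    let ?z = "g (inv_form y) - y"
    have "inv_form 1 = 0"
      by (simp add: inv_form_def convolve_def cop_one d_one
          tensor_lift_pure[OF cbilinear_comp[OF lm_bilinear S_linear d_linear]]
          clinear_0[OF cbilinearD(1)[OF lm_bilinear]])
    \<comment> \<open>Removing the counit part of \<open>?z\<close> does not change its
      \<open>inv_form\<close>, and puts it into \<open>calculus_ideal\<close>, where
      \<open>Y\<close> vanishes.\<close>
    then have "inv_form (?z - cou ?z *\<^sub>C 1) = 0"
      by (simp add: clinear_diff[OF inv_form_linear] clinear_scale[OF inv_form_linear] g)
    moreover have "cou (?z - cou ?z *\<^sub>C 1) = 0"
      by (simp add: clinear_diff[OF cou_linear] clinear_scale[OF cou_linear] cou_one scaleC_complex_def)
    ultimately have "Y (?z - cou ?z *\<^sub>C 1) = 0" by (intro Y(3))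
    then show ?thesis by (simp add: clinear_diff[OF Y(1)] clinear_scale[OF Y(1)] Y(2))
  qed
  have "\<exists>!\<phi>. clinear \<phi> \<and> (\<forall>x y. \<phi> (lm x (d y)) = cou x * Y y)"
  proof
    show "clinear (\<lambda>v. Y (g (inv_proj v))) \<and> (\<forall>x y. Y (g (inv_proj (lm x (d y)))) = cou x * Y y)"
      by (simp add: clinear_comp[OF Y(1) clinear_comp[OF g(1) inv_proj_linear]] inv_proj_lm_d
          clinear_scale[OF g(1)] clinear_scale[OF Y(1)] Yg) (simp add: scaleC_complex_def)
  next
    fix \<phi> assume *: "clinear \<phi> \<and> (\<forall>x y. \<phi> (lm x (d y)) = cou x * Y y)"
    show "\<phi> = (\<lambda>v. Y (g (inv_proj v)))"
      by (rule ext, rule form_linear_unique[where g = \<phi>])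
        (use * in \<open>simp_all add: clinear_comp[OF Y(1) clinear_comp[OF g(1) inv_proj_linear]] inv_proj_lm_d
          clinear_scale[OF g(1)] clinear_scale[OF Y(1)] Yg\<close>, simp add: scaleC_complex_def)
  qed
  then show ?thesis unfolding tangent_pairing_def by (rule theI')
qed

abbreviation \<phi> :: "nat \<Rightarrow> 'g \<Rightarrow> complex" where "\<phi> i \<equiv> tangent_pairing cou lm d (X i)"

context
  fixes i assumes i: "i \<in> {1..N}"
begin

lemma X_tangent: "X i \<in> tangent_space cop cou S lm d"
proof -
  have "X i \<in> cvs.span (X ` {1..N})" by (intro cvs.span_base imageI i)
  then show ?thesis using tangent_basis by (simp add: basis_of_def)
qed

lemma X_linear: "clinear (X i)" and X_one: "X i 1 = 0"
  using X_tangent by (auto simp: tangent_space_def)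

lemma phi_linear: "clinear (\<phi> i)" and phi_lm_d: "\<phi> i (lm x (d y)) = cou x * X i y"
  using tangent_functional[OF X_tangent] by auto

lemma phi_lm: "\<phi> i (lm x v) = cou x * \<phi> i v"
proof -
  have "\<phi> i (lm x v) = cou x *\<^sub>C \<phi> i v"
    by (rule form_linear_unique[OF clinear_comp[OF phi_linear cbilinearD(1)[OF lm_bilinear]]
          clinear_scale_fun[OF phi_linear]])
      (simp add: lm_mult[symmetric] phi_lm_d cou_mult scaleC_complex_def)
  then show ?thesis by (simp add: scaleC_complex_def)
qed

lemma phi_d: "\<phi> i (d y) = X i y"
  using phi_lm_d[of 1 y] by (simp add: lm_one cou_one)

end

section \<open>Product rules for the functionals f and X\<close>

lemma phi_rm_basis:
  assumes "i \<in> {1..N}" "j \<in> {1..N}"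
  shows "\<phi> j (rm (\<omega> i) x) = f i j x"
  using assms
  by (simp add: f_comm clinear_sum[OF phi_linear] phi_lm dual_basis cou_dual_act f_linear
      if_distrib cong: if_cong)

text \<open>Associativity of the right action, read in the left-invariant basis; together with
  \<open>f_one\<close> it makes \<open>f\<close> a matrix representation of A.\<close>

lemma f_mult:
  assumes "i \<in> {1..N}" "j \<in> {1..N}"
  shows "f i j (x * y) = (\<Sum>k=1..N. f i k x * f k j y)"
proof -
  have "f i j (x * y) = \<phi> j (rm (\<Sum>k=1..N. lm (dual_act cop (f i k) x) (\<omega> k)) y)"
    using assms by (simp add: phi_rm_basis[symmetric] rm_mult f_comm[of i x])
  also have "\<dots> = (\<Sum>k=1..N. f i k x * f k j y)"
    using assms
    by (simp add: clinear_sum[OF cbilinearD(2)[OF rm_bilinear]] clinear_sum[OF phi_linear]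
        lm_rm phi_lm phi_rm_basis cou_dual_act f_linear)
  finally show ?thesis .
qed

lemma f_one:
  assumes "i \<in> {1..N}" "j \<in> {1..N}"
  shows "f i j 1 = (if i = j then 1 else 0)"
proof -
  have "rm (\<omega> i) 1 = \<omega> i"
    using calculus by (simp add: bicovariant_fodc_def fodc_def bimodule_def)
  then show ?thesis
    using phi_rm_basis[OF assms, of 1] dual_basis[OF assms(2,1)] by auto
qed

lemma inv_form_expand: "inv_form y = (\<Sum>i=1..N. X i y *\<^sub>C \<omega> i)"
proof -
  have "inv_form y \<in> cvs.span (\<omega> ` {1..N})" "inj_on \<omega> {1..N}"
    using inv_basis lco_inv_form by (auto simp: basis_of_def left_invariants_def)
  then obtain c where c: "inv_form y = (\<Sum>i=1..N. c i *\<^sub>C \<omega> i)" by (rule span_image_atLeastAtMost)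
  have "c i = X i y" if i: "i \<in> {1..N}" for i
  proof -
    have "c i = \<phi> i (inv_form y)"
      using i by (simp add: c clinear_sum[OF phi_linear] clinear_scale[OF phi_linear] dual_basis
          scaleC_complex_def if_distrib cong: if_cong)
    also have "\<dots> = convolve cop (\<lambda>a v. \<phi> i (lm a v)) S d y"
      unfolding inv_form_def by (rule convolve_comp[OF phi_linear[OF i] lm_bilinear S_linear d_linear])
    also have "\<dots> = conv cop cou (X i) y"
      unfolding conv_eq by (rule convolve_cong) (use i in \<open>simp add: phi_lm phi_d cou_S\<close>)
    finally show ?thesis using i by (simp add: conv_cou X_linear)
  qed
  then show ?thesis by (simp add: c)
qed

text \<open>Write d x = x_1 S(x_2) d x_3; the factor S(x_2) d x_3 is left-invariant and has the
  coordinates given by \<open>inv_form_expand\<close>.\<close>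

lemma d_expand: "d x = (\<Sum>i=1..N. lm (dual_act cop (X i) x) (\<omega> i))"
proof -
  note id = clinear_ident(1)
  have Xw: "clinear (\<lambda>y. X i y *\<^sub>C \<omega> i)" if "i \<in> {1..N}" for i
    by (rule clinear_bilinear_left[OF cbilinear_scale X_linear[OF that]])
  have "d x = convolve cop lm (convolve cop (*) (\<lambda>x. x) S) d x"
    by (simp add: S_right[abs_def] convolve_counit_left[OF coalg lm_bilinear d_linear] lm_one)
  also have "\<dots> = convolve cop lm (\<lambda>x. x) inv_form x"
    unfolding inv_form_def[abs_def]
    using convolve_assoc[OF coalg lm_bilinear cbilinear_mult lm_bilinear lm_bilinear id S_linear d_linear]
    by (simp add: lm_mult)
  also have "\<dots> = (\<Sum>i=1..N. convolve cop lm (\<lambda>x. x) (\<lambda>y. X i y *\<^sub>C \<omega> i) x)"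
    unfolding inv_form_expand[abs_def] by (rule convolve_sum_right[OF lm_bilinear id Xw])
  also have "\<dots> = (\<Sum>i=1..N. lm (dual_act cop (X i) x) (\<omega> i))"
  proof (rule sum.cong[OF refl])
    fix i assume i: "i \<in> {1..N}"
    have "lm (dual_act cop (X i) x) (\<omega> i) = convolve cop (\<lambda>a c. lm (c *\<^sub>C a) (\<omega> i)) (\<lambda>x. x) (X i) x"
      unfolding dual_act_eq
      by (rule convolve_comp[OF cbilinearD(2)[OF lm_bilinear] cbilinear_swap[OF cbilinear_scale] id X_linear[OF i]])
    also have "\<dots> = convolve cop lm (\<lambda>x. x) (\<lambda>y. X i y *\<^sub>C \<omega> i) x"
      by (rule convolve_cong)
        (simp add: clinear_scale[OF cbilinearD(1)[OF lm_bilinear]] clinear_scale[OF cbilinearD(2)[OF lm_bilinear]])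
    finally show "convolve cop lm (\<lambda>x. x) (\<lambda>y. X i y *\<^sub>C \<omega> i) x = lm (dual_act cop (X i) x) (\<omega> i)" ..
  qed
  finally show ?thesis .
qed

text \<open>The Leibniz rule seen through \<open>\<phi> i\<close>: the summand (dx) y contributes
  the sum with \<open>f\<close>, the summand x dy the term with the counit.\<close>

lemma X_mult:
  assumes i: "i \<in> {1..N}"
  shows "X i (x * y) = (\<Sum>j=1..N. X j x * f j i y) + cou x * X i y"
proof -
  have "\<phi> i (rm (d x) y) = (\<Sum>j=1..N. X j x * f j i y)"
    unfolding d_expand[of x]
    using i
    by (simp add: clinear_sum[OF cbilinearD(2)[OF rm_bilinear]] clinear_sum[OF phi_linear]
        lm_rm phi_lm phi_rm_basis cou_dual_act X_linear)
  then show ?thesis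
    using phi_d[OF i, of "x * y"] by (simp add: leibniz clinear_add[OF phi_linear[OF i]] phi_lm_d[OF i])
qed

subsection \<open>The right coaction\<close>

lemma rco_d: "rco (d y) = tensor_map d id (cop y)"
proof -
  have "tensor_mult lm (*) (1 \<otimes> 1) t = t" for t :: "('g, 'a) tensor"
    by (induction t rule: tensor_induct)
      (simp_all add: tensor_mult_pure[OF lm_bilinear cbilinear_mult] lm_one
        clinear_add[OF cbilinearD(1)[OF tensor_mult_bilinear[OF lm_bilinear cbilinear_mult]]])
  then show ?thesis using rco_lm_d[of 1 y] by (simp add: lm_one cop_one)
qed

lemma rco_lm: "rco (lm a v) = tensor_mult lm (*) (cop a) (rco v)"
proof -
  note M = tensor_mult_bilinear[OF lm_bilinear cbilinear_mult[where 'a = 'a]]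
  note A = tensor_mult_bilinear[OF cbilinear_mult[where 'a = 'a] cbilinear_mult[where 'a = 'a]]
  note lin = clinear_add[OF cbilinearD(1)[OF M]] clinear_add[OF cbilinearD(2)[OF M]]
    clinear_add[OF cbilinearD(1)[OF A]] clinear_add[OF cbilinearD(2)[OF A]]
  note mp = tensor_mult_pure[OF lm_bilinear cbilinear_mult[where 'a = 'a]] tensor_mult_alg_pure
  have 1: "tensor_mult lm (*) ((a * a') \<otimes> (b * b')) t =
      tensor_mult lm (*) (a \<otimes> b) (tensor_mult lm (*) (a' \<otimes> b') t)" for a b a' b' :: 'a and t
    by (induction t rule: tensor_induct) (simp_all add: mp lin lm_mult mult.assoc)
  have 2: "tensor_mult lm (*) (tensor_mult (*) (*) (a \<otimes> b) s) t =
      tensor_mult lm (*) (a \<otimes> b) (tensor_mult lm (*) s t)" for a b :: 'a and s t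
    by (induction s rule: tensor_induct) (simp_all add: mp lin 1)
  have 3: "tensor_mult lm (*) (tensor_mult (*) (*) r s) t =
      tensor_mult lm (*) r (tensor_mult lm (*) s t)" for r s :: "('a, 'a) tensor" and t
    by (induction r rule: tensor_induct) (simp_all add: lin 2)
  show ?thesis
    by (rule form_linear_unique[OF clinear_comp[OF rco_linear cbilinearD(1)[OF lm_bilinear]]
          clinear_comp[OF cbilinearD(1)[OF M] rco_linear]])
      (simp add: lm_mult[symmetric] rco_lm_d cop_mult 3)
qed

text \<open>The calculus prescribes the coaction on left multiples of differentials. Right
  multiplication is reduced to that case by (dy) a = d(ya) - y da.\<close>

lemma rco_rm: "rco (rm v a) = tensor_mult rm (*) (rco v) (cop a)"
proof -
  note L = tensor_mult_bilinear[OF lm_bilinear cbilinear_mult[where 'a = 'a]]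
  note R = tensor_mult_bilinear[OF rm_bilinear cbilinear_mult[where 'a = 'a]]
  note A = tensor_mult_bilinear[OF cbilinear_mult[where 'a = 'a] cbilinear_mult[where 'a = 'a]]
  note D = tensor_map_linear[OF d_linear clinear_ident(2)] tensor_map_linear[OF d_linear clinear_ident(1)]
  note lin = clinear_add[OF cbilinearD(1)[OF L]] clinear_add[OF cbilinearD(2)[OF L]]
    clinear_add[OF cbilinearD(1)[OF R]] clinear_add[OF cbilinearD(2)[OF R]]
    clinear_add[OF cbilinearD(1)[OF A]] clinear_add[OF cbilinearD(2)[OF A]] clinear_add[OF D(1)] clinear_add[OF D(2)]
  note mp = tensor_mult_pure[OF lm_bilinear cbilinear_mult[where 'a = 'a]] tensor_mult_alg_pure
    tensor_mult_pure[OF rm_bilinear cbilinear_mult[where 'a = 'a]]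
    tensor_map_pure[OF d_linear clinear_ident(2)] tensor_map_pure[OF d_linear clinear_ident(1)]
  have der1: "tensor_map d id (tensor_mult (*) (*) (a \<otimes> b) t) =
      tensor_mult rm (*) (d a \<otimes> b) t + tensor_mult lm (*) (a \<otimes> b) (tensor_map d id t)"
    for a b :: 'a and t
    by (induction t rule: tensor_induct) (simp_all add: mp lin leibniz tensor_add_left)
  have der: "tensor_map d id (tensor_mult (*) (*) s t) =
      tensor_mult rm (*) (tensor_map d id s) t + tensor_mult lm (*) s (tensor_map d id t)"
    for s t :: "('a, 'a) tensor"
    by (induction s rule: tensor_induct) (simp_all add: mp lin der1[unfolded id_def])
  have assoc1: "tensor_mult rm (*) (lm a w \<otimes> (b * b')) t =
      tensor_mult lm (*) (a \<otimes> b) (tensor_mult rm (*) (w \<otimes> b') t)" for a b b' :: 'a and w t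
    by (induction t rule: tensor_induct) (simp_all add: mp lin lm_rm mult.assoc)
  have assoc2: "tensor_mult rm (*) (tensor_mult lm (*) (a \<otimes> b) s) t =
      tensor_mult lm (*) (a \<otimes> b) (tensor_mult rm (*) s t)" for a b :: 'a and s t
    by (induction s rule: tensor_induct) (simp_all add: mp lin assoc1)
  have assoc: "tensor_mult rm (*) (tensor_mult lm (*) r s) t =
      tensor_mult lm (*) r (tensor_mult rm (*) s t)" for r t :: "('a, 'a) tensor" and s
    by (induction r rule: tensor_induct) (simp_all add: lin assoc2)
  have "rco (d (y * a)) = rco (rm (d y) a) + rco (lm y (d a))" for y
    by (simp add: leibniz clinear_add[OF rco_linear])
  then have rco_rm_d: "rco (rm (d y) a) = tensor_mult rm (*) (rco (d y)) (cop a)" for y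
    by (simp add: rco_d cop_mult der rco_lm)
  show ?thesis
    by (rule form_linear_unique[OF clinear_comp[OF rco_linear cbilinearD(2)[OF rm_bilinear]]
          clinear_comp[OF cbilinearD(2)[OF R] rco_linear]])
      (simp add: lm_rm rco_lm rco_rm_d assoc)
qed

definition \<Phi> :: "nat \<Rightarrow> ('g, 'a) tensor \<Rightarrow> 'a" where
  "\<Phi> k = tensor_lift (\<lambda>w a. \<phi> k w *\<^sub>C a)"

lemma Phi_bilinear: "k \<in> {1..N} \<Longrightarrow> cbilinear (\<lambda>w a. \<phi> k w *\<^sub>C a)"
  by (rule cbilinear_comp[OF cbilinear_scale phi_linear clinear_ident(1)])

lemma Phi_linear: "k \<in> {1..N} \<Longrightarrow> clinear (\<Phi> k)"
  unfolding \<Phi>_def by (rule tensor_lift_linear[OF Phi_bilinear])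

lemma Phi_pure: "k \<in> {1..N} \<Longrightarrow> \<Phi> k (w \<otimes> a) = \<phi> k w *\<^sub>C a"
  by (simp add: \<Phi>_def tensor_lift_pure Phi_bilinear)

text \<open>\<open>\<phi> k\<close> sees the first leg of the coproduct of \<open>a\<close> only
  through the counit, which restores \<open>a\<close> in the second leg.\<close>

lemma Phi_rco_lm_basis:
  assumes k: "k \<in> {1..N}" and i: "i \<in> {1..N}"
  shows "\<Phi> k (rco (lm a (\<omega> i))) = a * J k i"
proof -
  note L = tensor_mult_bilinear[OF lm_bilinear cbilinear_mult[where 'a = 'a]]
  have C: "clinear (\<lambda>s. tensor_lift (\<lambda>a b. cou a *\<^sub>C b) s * c)" for c :: 'a
    by (rule clinear_bilinear_left[OF cbilinear_mult tensor_lift_linear])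
      (rule cbilinear_comp[OF cbilinear_scale cou_linear clinear_ident(1)])
  have *: "\<Phi> k (tensor_mult lm (*) s (\<omega> j \<otimes> c)) =
      (if j = k then tensor_lift (\<lambda>a b. cou a *\<^sub>C b) s * c else 0)" if "j \<in> {1..N}" for s j and c :: 'a
    by (induction s rule: tensor_induct)
      (use k that in \<open>simp_all add: clinear_add[OF cbilinearD(2)[OF L]] clinear_add[OF Phi_linear] clinear_add[OF C]
        tensor_mult_pure[OF lm_bilinear cbilinear_mult] Phi_pure
        phi_lm dual_basis tensor_lift_pure[OF cbilinear_comp[OF cbilinear_scale cou_linear clinear_ident(1)]]
        scaleC_mult_left\<close>)
  show ?thesis
    using k i
    by (simp add: * rco_lm J_coaction clinear_sum[OF cbilinearD(1)[OF L]] clinear_sum[OF Phi_linear]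
        coalgebraD(4)[OF coalg] if_distrib cong: if_cong)
qed

text \<open>
  The next two identities compute the right coaction of \<open>d x\<close>, respectively of \<open>\<omega> i x\<close>, in two ways and
  apply \<open>\<phi> k\<close> to the first leg.  All relations of \<open>\<E>\<^sub>\<Gamma>\<close> follow from them by applying functionals.
\<close>

lemma X_cop_eq:
  assumes k: "k \<in> {1..N}"
  shows "convolve cop (\<lambda>c b. c *\<^sub>C b) (X k) (\<lambda>x. x) x = (\<Sum>i=1..N. dual_act cop (X i) x * J k i)"
proof -
  have "\<Phi> k (rco (d x)) = convolve cop (\<lambda>c b. c *\<^sub>C b) (X k) (\<lambda>x. x) x"
    unfolding \<Phi>_def rco_d convolve_def
    by (subst tensor_lift_map[OF d_linear clinear_ident(2) Phi_bilinear[OF k]]) (simp add: phi_d[OF k])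
  moreover have "\<Phi> k (rco (d x)) = (\<Sum>i=1..N. dual_act cop (X i) x * J k i)"
    using k by (subst d_expand)
      (simp add: clinear_sum[OF rco_linear] clinear_sum[OF Phi_linear] Phi_rco_lm_basis)
  ultimately show ?thesis by simp
qed

lemma yetter_drinfeld:
  assumes k: "k \<in> {1..N}" and i: "i \<in> {1..N}"
  shows "(\<Sum>j=1..N. convolve cop (\<lambda>c b. c *\<^sub>C (J j i * b)) (f j k) (\<lambda>x. x) x) =
    (\<Sum>j=1..N. dual_act cop (f i j) x * J k j)"
proof -
  note R = tensor_mult_bilinear[OF rm_bilinear cbilinear_mult[where 'a = 'a]]
  have B: "cbilinear (\<lambda>a b. f j k a *\<^sub>C (c * b))" if "j \<in> {1..N}" for j and c :: 'a
    by (rule cbilinear_comp[OF cbilinear_scale f_linear[OF that k] cbilinearD(1)[OF cbilinear_mult]])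
  have *: "\<Phi> k (tensor_mult rm (*) (\<omega> j \<otimes> c) t) = tensor_lift (\<lambda>a b. f j k a *\<^sub>C (c * b)) t"
    if j: "j \<in> {1..N}" for j and c :: 'a and t
    by (induction t rule: tensor_induct)
      (simp_all add: clinear_add[OF cbilinearD(1)[OF R]] clinear_add[OF Phi_linear[OF k]]
        clinear_add[OF tensor_lift_linear[OF B[OF j]]] tensor_mult_pure[OF rm_bilinear cbilinear_mult]
        Phi_pure[OF k] tensor_lift_pure[OF B[OF j]] phi_rm_basis[OF j k])
  have "\<Phi> k (rco (rm (\<omega> i) x)) = (\<Sum>j=1..N. convolve cop (\<lambda>c b. c *\<^sub>C (J j i * b)) (f j k) (\<lambda>x. x) x)"
    by (simp add: rco_rm J_coaction[OF i] clinear_sum[OF cbilinearD(2)[OF R]]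
        clinear_sum[OF Phi_linear[OF k]] * convolve_def)
  moreover have "\<Phi> k (rco (rm (\<omega> i) x)) = (\<Sum>j=1..N. dual_act cop (f i j) x * J k j)"
    using k by (simp add: f_comm[OF i] clinear_sum[OF rco_linear] clinear_sum[OF Phi_linear]
        Phi_rco_lm_basis)
  ultimately show ?thesis by simp
qed

text \<open>Apply \<open>f n l\<close> to \<open>X_cop_eq\<close>: by \<open>f_mult\<close> the
  value at \<open>J k j\<close> splits off and is a coefficient of the braiding.\<close>

lemma X_f_relation:
  assumes "k \<in> {1..N}" "n \<in> {1..N}" "l \<in> {1..N}"
  shows "conv cop (X k) (f n l) = (\<Sum>i=1..N. \<Sum>j=1..N. braid f J k l i j *\<^sub>C conv cop (f n i) (X j))"
proof
  fix x
  have "conv cop (X k) (f n l) x = f n l (convolve cop (\<lambda>c b. c *\<^sub>C b) (X k) (\<lambda>x. x) x)"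
    unfolding conv_eq
    by (subst convolve_comp[OF f_linear cbilinear_scale X_linear clinear_ident(1)])
      (use assms in \<open>auto intro!: convolve_cong simp: clinear_scale[OF f_linear] scaleC_complex_def\<close>)
  also have "\<dots> = (\<Sum>j=1..N. \<Sum>i=1..N. f n i (dual_act cop (X j) x) * f i l (J k j))"
    using assms by (simp add: X_cop_eq clinear_sum[OF f_linear] f_mult)
  also have "\<dots> = (\<Sum>i=1..N. \<Sum>j=1..N. braid f J k l i j * conv cop (f n i) (X j) x)"
    by (subst sum.swap)
      (intro sum.cong refl, use assms in \<open>simp add: apply_dual_act f_linear X_linear braid_def mult.commute\<close>)
  finally show "conv cop (X k) (f n l) x =
      (\<Sum>i=1..N. \<Sum>j=1..N. braid f J k l i j *\<^sub>C conv cop (f n i) (X j)) x"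
    by (simp add: sum_fun_apply scaleC_fun_def scaleC_complex_def)
qed

text \<open>Apply \<open>X l\<close> to \<open>X_cop_eq\<close>. In \<open>X_mult\<close> the sum
  with \<open>f\<close> produces the braiding, and the counit term produces the structure
  constants.\<close>

lemma X_X_relation:
  assumes "k \<in> {1..N}" "l \<in> {1..N}"
  shows "conv cop (X k) (X l) = (\<Sum>i=1..N. \<Sum>j=1..N. braid f J k l i j *\<^sub>C conv cop (X i) (X j))
    + (\<Sum>i=1..N. struct X J k l i *\<^sub>C X i)"
proof
  fix x
  have "conv cop (X k) (X l) x = X l (convolve cop (\<lambda>c b. c *\<^sub>C b) (X k) (\<lambda>x. x) x)"
    unfolding conv_eq
    by (subst convolve_comp[OF X_linear cbilinear_scale X_linear clinear_ident(1)])
      (use assms in \<open>auto intro!: convolve_cong simp: clinear_scale[OF X_linear] scaleC_complex_def\<close>)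
  also have "\<dots> = (\<Sum>j=1..N. \<Sum>i=1..N. X i (dual_act cop (X j) x) * f i l (J k j))
      + (\<Sum>j=1..N. X j x * X l (J k j))"
    using assms by (simp add: X_cop_eq clinear_sum[OF X_linear] X_mult sum.distrib cou_dual_act X_linear)
  also have "(\<Sum>j=1..N. \<Sum>i=1..N. X i (dual_act cop (X j) x) * f i l (J k j)) =
      (\<Sum>i=1..N. \<Sum>j=1..N. braid f J k l i j * conv cop (X i) (X j) x)"
    by (subst sum.swap)
      (intro sum.cong refl, use assms in \<open>simp add: apply_dual_act X_linear braid_def mult.commute\<close>)
  finally show "conv cop (X k) (X l) x =
      ((\<Sum>i=1..N. \<Sum>j=1..N. braid f J k l i j *\<^sub>C conv cop (X i) (X j)) + (\<Sum>i=1..N. struct X J k l i *\<^sub>C X i)) x"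
    by (simp add: sum_fun_apply scaleC_fun_def scaleC_complex_def struct_def mult.commute)
qed

end

context hopf_structure
begin

text \<open>The inverse of \<open>S\<close> is an antipode for the opposite product. Each identity
  follows by applying \<open>S\<close>, which turns it into a known one, and using
  injectivity.\<close>

lemma inv_S:
  assumes "bij S"
  shows "clinear (inv S)" "inv S (x * y) = inv S y * inv S x" "inv S 1 = 1"
    and "inv S (S x) = x" "S (inv S x) = x"
    and "convolve cop (\<lambda>p q. q * p) (\<lambda>x. x) (inv S) x = cou x *\<^sub>C 1"
    and "convolve cop (\<lambda>p q. q * p) (inv S) (\<lambda>x. x) x = cou x *\<^sub>C 1"
proof -
  show [simp]: "inv S (S x) = x" "S (inv S x) = x" for x
    using assms by (simp_all add: bij_is_inj bij_is_surj surj_f_inv_f)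
  have inj: "S x = S y \<Longrightarrow> x = y" for x y using bij_is_inj[OF assms] by (simp add: inj_eq)
  show lin: "clinear (inv S)"
    by (rule clinearI; rule inj; simp add: clinear_add[OF S_linear] clinear_scale[OF S_linear])
  show "inv S (x * y) = inv S y * inv S x" "inv S 1 = 1"
    by (rule inj; simp add: S_mult S_one)+
  have B: "cbilinear (\<lambda>p q :: 'a. q * p)" by (rule cbilinear_swap[OF cbilinear_mult])
  have id: "clinear (\<lambda>x::'a. x)" by (rule clinear_ident(1))
  have "S (convolve cop (\<lambda>p q. q * p) (\<lambda>x. x) (inv S) x) = convolve cop (\<lambda>p q. S (q * p)) (\<lambda>x. x) (inv S) x"
    by (rule convolve_comp[OF S_linear B id lin])
  also have "\<dots> = convolve cop (*) S (\<lambda>x. x) x" by (rule convolve_cong) (simp add: S_mult)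
  finally show "convolve cop (\<lambda>p q. q * p) (\<lambda>x. x) (inv S) x = cou x *\<^sub>C 1"
    by - (rule inj, simp add: S_left clinear_scale[OF S_linear] S_one)
  have "S (convolve cop (\<lambda>p q. q * p) (inv S) (\<lambda>x. x) x) = convolve cop (\<lambda>p q. S (q * p)) (inv S) (\<lambda>x. x) x"
    by (rule convolve_comp[OF S_linear B lin id])
  also have "\<dots> = convolve cop (*) (\<lambda>x. x) S x" by (rule convolve_cong) (simp add: S_mult)
  finally show "convolve cop (\<lambda>p q. q * p) (inv S) (\<lambda>x. x) x = cou x *\<^sub>C 1"
    by - (rule inj, simp add: S_right clinear_scale[OF S_linear] S_one)
qed

lemma conv_lin:
  assumes "\<And>i. i \<in> I \<Longrightarrow> clinear (g i)" "clinear h"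
  shows "conv cop (\<lambda>a. \<Sum>i\<in>I. c i * g i a) h x = (\<Sum>i\<in>I. c i * conv cop (g i) h x)"
    and "conv cop h (\<lambda>a. \<Sum>i\<in>I. c i * g i a) x = (\<Sum>i\<in>I. c i * conv cop h (g i) x)"
proof -
  have lin: "clinear (\<lambda>a. c i *\<^sub>C g i a)" if "i \<in> I" for i
    by (rule clinear_scale_fun[OF assms(1)[OF that]])
  have e: "c i * z = c i *\<^sub>C z" for i z by (simp add: scaleC_complex_def)
  note M = cbilinear_mult[where 'a = complex]
  show "conv cop (\<lambda>a. \<Sum>i\<in>I. c i * g i a) h x = (\<Sum>i\<in>I. c i * conv cop (g i) h x)"
    "conv cop h (\<lambda>a. \<Sum>i\<in>I. c i * g i a) x = (\<Sum>i\<in>I. c i * conv cop h (g i) x)"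
    unfolding conv_eq e
    by (simp_all add: convolve_sum_left[OF M lin assms(2)] convolve_sum_right[OF M assms(2) lin]
        convolve_scale_left[OF M assms] convolve_scale_right[OF M assms(2,1)])
qed

end

section \<open>The comatrix J, and the antipode on f and X\<close>

context fodc_structure
begin

text \<open>Coassociativity of the right coaction at a basis form, with \<open>\<phi> k\<close>
  applied to the first leg.\<close>

lemma J_cop:
  assumes k: "k \<in> {1..N}" and i: "i \<in> {1..N}"
  shows "cop (J k i) = (\<Sum>j=1..N. J k j \<otimes> J j i)"
proof -
  have B: "cbilinear (\<lambda>w (u :: ('a, 'a) tensor). \<phi> k w *\<^sub>C u)"
    by (rule cbilinear_comp[OF cbilinear_scale phi_linear[OF k] clinear_ident(1)])
  have pp: "cbilinear (\<lambda>(a::'g) (b::'a). a \<otimes> (b \<otimes> c))" for c :: 'a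
    by (rule cbilinear_comp[OF tensor_pure_bilinear clinear_ident(1) cbilinearD(2)[OF tensor_pure_bilinear]])
  have ass: "cbilinear (\<lambda>(s::('g, 'a) tensor) (c::'a). tensor_lift (\<lambda>a b. a \<otimes> (b \<otimes> c)) s)"
    by (intro cbilinearI tensor_lift_linear pp clinear_lift_param
        clinear_bilinear_right[OF tensor_pure_bilinear cbilinearD(1)[OF tensor_pure_bilinear]])
  have lin: "clinear (tensor_assoc :: (('g, 'a) tensor, 'a) tensor \<Rightarrow> _)"
    unfolding tensor_assoc_def by (rule tensor_lift_linear[OF ass])
  have pure: "tensor_assoc ((w \<otimes> a) \<otimes> b) = w \<otimes> (a \<otimes> b)" for w :: 'g and a b :: 'a
    unfolding tensor_assoc_def by (simp add: tensor_lift_pure[OF ass] tensor_lift_pure[OF pp])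
  have "tensor_lift (\<lambda>w u. \<phi> k w *\<^sub>C u) (tensor_assoc (tensor_map rco id (rco (\<omega> i)))) =
      (\<Sum>j=1..N. J k j \<otimes> J j i)"
    using i k
    by (simp add: J_coaction clinear_sum[OF tensor_map_linear[OF rco_linear clinear_ident(2)]]
        tensor_map_pure[OF rco_linear clinear_ident(2)] clinear_sum[OF lin] pure tensor_sum_left
        clinear_sum[OF tensor_lift_linear[OF B]] tensor_lift_pure[OF B] dual_basis
        if_distrib[of "\<lambda>c. c *\<^sub>C _"] scaleC_one sum.If_cases cong: if_cong)
  moreover have "tensor_lift (\<lambda>w u. \<phi> k w *\<^sub>C u) (tensor_map id cop (rco (\<omega> i))) = cop (J k i)"
    using i k
    by (simp add: J_coaction clinear_sum[OF tensor_map_linear[OF clinear_ident(2) cop_linear]]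
        tensor_map_pure[OF clinear_ident(2) cop_linear] clinear_sum[OF tensor_lift_linear[OF B]]
        tensor_lift_pure[OF B] dual_basis if_distrib[of "\<lambda>c. c *\<^sub>C _"] scaleC_one cong: if_cong)
  ultimately show ?thesis by (simp add: rco_coassoc)
qed

lemma J_cou:
  assumes k: "k \<in> {1..N}" and i: "i \<in> {1..N}"
  shows "cou (J k i) = (if k = i then 1 else 0)"
proof -
  have B: "cbilinear (\<lambda>(w::'g) a. cou a *\<^sub>C w)"
    by (rule cbilinear_swap[OF cbilinear_comp[OF cbilinear_scale cou_linear clinear_ident(1)]])
  have "\<omega> i = (\<Sum>j=1..N. cou (J j i) *\<^sub>C \<omega> j)"
    using rco_counit[of "\<omega> i"] i
    by (simp add: J_coaction clinear_sum[OF tensor_lift_linear[OF B]] tensor_lift_pure[OF B])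
  then have "\<phi> k (\<omega> i) = \<phi> k (\<Sum>j=1..N. cou (J j i) *\<^sub>C \<omega> j)" by simp
  then show ?thesis
    using k i
    by (simp add: clinear_sum[OF phi_linear] clinear_scale[OF phi_linear] dual_basis
        scaleC_complex_def if_distrib[where f = "\<lambda>c. _ * c"] cong: if_cong)
qed

lemma J_S:
  assumes "k \<in> {1..N}" "i \<in> {1..N}"
  shows "(\<Sum>j=1..N. S (J k j) * J j i) = (if k = i then 1 else 0)"
proof -
  have B: "cbilinear (\<lambda>a b. S a * b)"
    by (rule cbilinear_comp[OF cbilinear_mult S_linear clinear_ident(1)])
  show ?thesis
    using S_left[of "J k i"] assms
    by (simp add: convolve_def J_cop clinear_sum[OF tensor_lift_linear[OF B]] tensor_lift_pure[OF B]
        J_cou scaleC_one split: if_splits)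
qed

lemma f_S:
  assumes i: "i \<in> {1..N}" and j: "j \<in> {1..N}"
  shows "(\<Sum>k=1..N. conv cop (f i k \<circ> S) (f k j) x) = (if i = j then cou x else 0)"
    and "(\<Sum>k=1..N. conv cop (f i k) (f k j \<circ> S) x) = (if i = j then cou x else 0)"
proof -
  note M = cbilinear_mult
  have fl: "clinear (f i k)" "clinear (f k j)" "clinear (\<lambda>x. f i k (S x))" "clinear (\<lambda>x. f k j (S x))"
    if "k \<in> {1..N}" for k
    using that i j by (auto intro!: f_linear clinear_comp[OF f_linear S_linear])
  have "tensor_lift (\<lambda>a b. \<Sum>k=1..N. f i k (S a) * f k j b) (cop x) =
      (\<Sum>k=1..N. conv cop (f i k \<circ> S) (f k j) x)"
    unfolding conv_def comp_def by (rule tensor_lift_sum) (intro cbilinear_comp[OF M] fl)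
  then have "(\<Sum>k=1..N. conv cop (f i k \<circ> S) (f k j) x) = tensor_lift (\<lambda>a b. f i j (S a * b)) (cop x)"
    using i j by (simp add: f_mult)
  also have "\<dots> = f i j (convolve cop (*) S (\<lambda>x. x) x)"
    unfolding convolve_def
    by (rule tensor_lift_comp[OF f_linear[OF i j] cbilinear_comp[OF M S_linear clinear_ident(1)], symmetric])
  finally show "(\<Sum>k=1..N. conv cop (f i k \<circ> S) (f k j) x) = (if i = j then cou x else 0)"
    using i j by (simp add: S_left clinear_scale[OF f_linear] f_one scaleC_complex_def)
  have "tensor_lift (\<lambda>a b. \<Sum>k=1..N. f i k a * f k j (S b)) (cop x) =
      (\<Sum>k=1..N. conv cop (f i k) (f k j \<circ> S) x)"
    unfolding conv_def comp_def by (rule tensor_lift_sum) (intro cbilinear_comp[OF M] fl)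
  then have "(\<Sum>k=1..N. conv cop (f i k) (f k j \<circ> S) x) = tensor_lift (\<lambda>a b. f i j (a * S b)) (cop x)"
    using i j by (simp add: f_mult)
  also have "\<dots> = f i j (convolve cop (*) (\<lambda>x. x) S x)"
    unfolding convolve_def
    by (rule tensor_lift_comp[OF f_linear[OF i j] cbilinear_comp[OF M clinear_ident(1) S_linear], symmetric])
  finally show "(\<Sum>k=1..N. conv cop (f i k) (f k j \<circ> S) x) = (if i = j then cou x else 0)"
    using i j by (simp add: S_right clinear_scale[OF f_linear] f_one scaleC_complex_def)
qed

text \<open>Expand 0 = X_i(x_1 S(x_2)) by \<open>X_mult\<close>; the counit term is the value
  sought.\<close>

lemma X_S:
  assumes i: "i \<in> {1..N}"
  shows "X i (S x) = - (\<Sum>j=1..N. conv cop (X j) (f j i \<circ> S) x)"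
proof -
  note M = cbilinear_mult[where 'a = complex]
  have lin: "clinear (X j)" "clinear (\<lambda>x. f j i (S x))" if "j \<in> {1..N}" for j
    using that i by (auto intro!: X_linear clinear_comp[OF f_linear S_linear])
  have B: "cbilinear (\<lambda>a b. X j a * f j i (S b))" if "j \<in> {1..N}" for j
    by (rule cbilinear_comp[OF M lin[OF that]])
  have B': "cbilinear (\<lambda>a b. \<Sum>j=1..N. X j a * f j i (S b))"
    by (intro cbilinearI clinear_sum_fun cbilinearD[OF B])
  have XS: "clinear (\<lambda>x. X i (S x))" by (rule clinear_comp[OF X_linear[OF i] S_linear])
  have "0 = X i (convolve cop (*) (\<lambda>x. x) S x)"
    using i by (simp add: S_right clinear_scale[OF X_linear] X_one)
  also have "\<dots> = tensor_lift (\<lambda>a b. X i (a * S b)) (cop x)"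
    unfolding convolve_def
    by (rule tensor_lift_comp[OF X_linear[OF i] cbilinear_comp[OF cbilinear_mult clinear_ident(1) S_linear]])
  finally have 0: "tensor_lift (\<lambda>a b. X i (a * S b)) (cop x) = 0" ..
  have "tensor_lift (\<lambda>a b. \<Sum>j=1..N. X j a * f j i (S b)) (cop x) =
      (\<Sum>j=1..N. conv cop (X j) (f j i \<circ> S) x)"
    unfolding conv_def comp_def by (rule tensor_lift_sum) (rule B)
  then have "tensor_lift (\<lambda>a b. X i (a * S b)) (cop x) =
      (\<Sum>j=1..N. conv cop (X j) (f j i \<circ> S) x) + conv cop cou (\<lambda>x. X i (S x)) x"
    unfolding X_mult[OF i] conv_def
    by (simp add: tensor_lift_add[OF B' cbilinear_comp[OF M cou_linear XS]])
  then show ?thesis using XS 0 by (simp add: conv_cou eq_neg_iff_add_eq_0 add.commute)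
qed

end

text \<open>
  On the Yetter-Drinfeld module of left-invariant forms the map
  \<open>v \<mapsto> S(v\<^sub>(\<^sub>1\<^sub>)) v\<^sub>(\<^sub>0\<^sub>)\<close> is invertible and intertwines the action with its twist by the square of
  the antipode.  Its matrix is \<open>drinfeld\<close>.
\<close>

context fodc_structure
begin

definition drinfeld :: "nat \<Rightarrow> nat \<Rightarrow> complex" where
  "drinfeld p k = (\<Sum>x=1..N. f p x (S (J k x)))"

text \<open>The formula of \<open>drinfeld\<close> with the antipode replaced by the square of its
  inverse; this is the usual shape of the inverse of a Drinfeld element.\<close>

definition drinfeld_inv :: "nat \<Rightarrow> nat \<Rightarrow> complex" where
  "drinfeld_inv u p = (\<Sum>z=1..N. f u z (inv S (inv S (J p z))))"

lemma fS_linear: "i \<in> {1..N} \<Longrightarrow> j \<in> {1..N} \<Longrightarrow> clinear (f i j \<circ> S)"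
  unfolding comp_def by (rule clinear_comp[OF f_linear S_linear])

text \<open>Evaluate \<open>f p i \<circ> S\<close> on both sides of \<open>yetter_drinfeld\<close>
  and sum over \<open>i\<close>. On one side the sum over \<open>i\<close> assembles
  \<open>drinfeld\<close>; on the other it runs over the product of \<open>f r i \<circ> S\<close>
  and \<open>f i j\<close>, which is the antipode identity for \<open>f\<close>.\<close>

lemma drinfeld_conv:
  assumes p: "p \<in> {1..N}" and k: "k \<in> {1..N}"
  shows "(\<Sum>r=1..N. \<Sum>j=1..N. drinfeld r j * conv cop (f j k) (f p r \<circ> S) x) = drinfeld p k * cou x"
proof -
  let ?YD = "\<lambda>i. \<Sum>j=1..N. convolve cop (\<lambda>c b. c *\<^sub>C (J j i * b)) (f j k) (\<lambda>x. x) x"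
  have "f p i (S (?YD i)) = (\<Sum>j=1..N. \<Sum>r=1..N. f r i (S (J j i)) * conv cop (f j k) (f p r \<circ> S) x)"
    if i: "i \<in> {1..N}" for i
  proof -
    have lin: "clinear (\<lambda>x. f p i (S x))" by (rule clinear_comp[OF f_linear[OF p i] S_linear])
    have "f p i (S (convolve cop (\<lambda>c b. c *\<^sub>C (J j i * b)) (f j k) (\<lambda>x. x) x)) =
        (\<Sum>r=1..N. f r i (S (J j i)) * conv cop (f j k) (f p r \<circ> S) x)" if j: "j \<in> {1..N}" for j
    proof -
      have "f p i (S (convolve cop (\<lambda>c b. c *\<^sub>C (J j i * b)) (f j k) (\<lambda>x. x) x)) =
          convolve cop (\<lambda>c b. f p i (S (c *\<^sub>C (J j i * b)))) (f j k) (\<lambda>x. x) x"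
        by (rule convolve_comp[OF lin cbilinear_comp[OF cbilinear_scale clinear_ident(1)
              cbilinearD(1)[OF cbilinear_mult]] f_linear[OF j k] clinear_ident(1)])
      also have "\<dots> = conv cop (f j k) (\<lambda>b. \<Sum>r=1..N. f r i (S (J j i)) * (f p r \<circ> S) b) x"
        unfolding conv_eq
        by (rule convolve_cong)
          (use p i in \<open>simp add: clinear_scale[OF lin] S_mult f_mult scaleC_complex_def mult.commute\<close>)
      also have "\<dots> = (\<Sum>r=1..N. f r i (S (J j i)) * conv cop (f j k) (f p r \<circ> S) x)"
        using p j k by (intro conv_lin(2) fS_linear f_linear)
      finally show ?thesis .
    qed
    then show ?thesis by (simp add: clinear_sum[OF lin])
  qed
  then have "(\<Sum>i=1..N. f p i (S (?YD i))) =
      (\<Sum>i=1..N. \<Sum>j=1..N. \<Sum>r=1..N. f r i (S (J j i)) * conv cop (f j k) (f p r \<circ> S) x)"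
    by (rule sum.cong[OF refl])
  also have "\<dots> = (\<Sum>i=1..N. \<Sum>r=1..N. \<Sum>j=1..N. f r i (S (J j i)) * conv cop (f j k) (f p r \<circ> S) x)"
    by (rule sum.cong[OF refl], rule sum.swap)
  also have "\<dots> = (\<Sum>r=1..N. \<Sum>i=1..N. \<Sum>j=1..N. f r i (S (J j i)) * conv cop (f j k) (f p r \<circ> S) x)"
    by (rule sum.swap)
  also have "\<dots> = (\<Sum>r=1..N. \<Sum>j=1..N. \<Sum>i=1..N. f r i (S (J j i)) * conv cop (f j k) (f p r \<circ> S) x)"
    by (rule sum.cong[OF refl], rule sum.swap)
  also have "\<dots> = (\<Sum>r=1..N. \<Sum>j=1..N. drinfeld r j * conv cop (f j k) (f p r \<circ> S) x)"
    by (simp add: drinfeld_def sum_distrib_right)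
  finally have 1: "(\<Sum>i=1..N. f p i (S (?YD i))) =
      (\<Sum>r=1..N. \<Sum>j=1..N. drinfeld r j * conv cop (f j k) (f p r \<circ> S) x)" .
  have "f p i (S (?YD i)) = (\<Sum>j=1..N. \<Sum>r=1..N. f p r (S (J k j)) * conv cop (f r i \<circ> S) (f i j) x)"
    if i: "i \<in> {1..N}" for i
  proof -
    have lin: "clinear (\<lambda>x. f p i (S x))" by (rule clinear_comp[OF f_linear[OF p i] S_linear])
    have "f r i (S (dual_act cop (f i j) x)) = conv cop (f r i \<circ> S) (f i j) x"
      if "r \<in> {1..N}" "j \<in> {1..N}" for r j
      using apply_dual_act[OF fS_linear[OF that(1) i] f_linear[OF i that(2)]] by simp
    then show ?thesis
      using p i by (simp add: yetter_drinfeld[OF k i] clinear_sum[OF lin] S_mult f_mult)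
  qed
  then have "(\<Sum>i=1..N. f p i (S (?YD i))) =
      (\<Sum>i=1..N. \<Sum>j=1..N. \<Sum>r=1..N. f p r (S (J k j)) * conv cop (f r i \<circ> S) (f i j) x)" by simp
  also have "\<dots> = (\<Sum>j=1..N. \<Sum>r=1..N. \<Sum>i=1..N. f p r (S (J k j)) * conv cop (f r i \<circ> S) (f i j) x)"
    by (subst sum.swap, rule sum.cong[OF refl], rule sum.swap)
  also have "\<dots> = (\<Sum>j=1..N. \<Sum>r=1..N. f p r (S (J k j)) * (if r = j then cou x else 0))"
    by (intro sum.cong refl) (simp add: sum_distrib_left[symmetric] f_S(1))
  also have "\<dots> = drinfeld p k * cou x"
    by (simp add: drinfeld_def sum_distrib_right if_distrib cong: if_cong)
  finally show ?thesis using 1 by simp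
qed

text \<open>Convolve \<open>drinfeld_conv\<close> on the right with
  \<open>f w p \<circ> S \<circ> S\<close> and sum over \<open>p\<close>. Since composing with
  \<open>S\<close> reverses convolution, \<open>f_S\<close> cancels the factor
  \<open>f p r \<circ> S\<close> and leaves the intertwining relation.\<close>

lemma drinfeld_twist:
  assumes w: "w \<in> {1..N}" and k: "k \<in> {1..N}"
  shows "(\<Sum>p=1..N. drinfeld p k * f w p (S (S x))) = (\<Sum>j=1..N. drinfeld w j * f j k x)"
proof -
  have fSS: "clinear (f w p \<circ> S \<circ> S)" if "p \<in> {1..N}" for p
    unfolding comp_def by (rule clinear_comp[OF f_linear[OF w that] clinear_comp[OF S_linear S_linear]])
  have inner: "(\<Sum>p=1..N. conv cop (f p r \<circ> S) (f w p \<circ> S \<circ> S) y) = (if w = r then cou y else 0)"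
    if r: "r \<in> {1..N}" for r y
  proof -
    have "conv cop (f p r \<circ> S) (f w p \<circ> S \<circ> S) y = conv cop (f w p \<circ> S) (f p r) (S y)"
      if "p \<in> {1..N}" for p
      by (rule conv_antipode[symmetric, OF fS_linear[OF w that] f_linear[OF that r]])
    then show ?thesis using f_S(1)[OF w r, of "S y"] by (simp add: cou_S)
  qed
  have "drinfeld p k * f w p (S (S x)) =
      (\<Sum>r=1..N. \<Sum>j=1..N. drinfeld r j * conv cop (f j k) (conv cop (f p r \<circ> S) (f w p \<circ> S \<circ> S)) x)"
    if p: "p \<in> {1..N}" for p
  proof -
    have lin: "clinear (conv cop (f j k) (f p r \<circ> S))" if "j \<in> {1..N}" "r \<in> {1..N}" for j r
      by (rule conv_linear[OF f_linear[OF that(1) k] fS_linear[OF p that(2)]])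
    have "drinfeld p k * f w p (S (S x)) = drinfeld p k * conv cop cou (f w p \<circ> S \<circ> S) x"
      by (simp add: conv_cou(1)[OF fSS[OF p]])
    \<comment> \<open>The sum over a single dummy index puts a scalar multiple into the form
      required by \<open>conv_lin\<close>.\<close>
    also have "\<dots> = conv cop (\<lambda>x. \<Sum>i\<in>{()}. drinfeld p k * cou x) (f w p \<circ> S \<circ> S) x"
      by (subst conv_lin(1)) (simp_all only: cou_linear fSS[OF p], simp)
    also have "\<dots> = conv cop (\<lambda>x. \<Sum>r=1..N. 1 * (\<Sum>j=1..N. drinfeld r j * conv cop (f j k) (f p r \<circ> S) x))
        (f w p \<circ> S \<circ> S) x"
      using drinfeld_conv[OF p k] by simp
    also have "\<dots> = (\<Sum>r=1..N. conv cop (\<lambda>x. \<Sum>j=1..N. drinfeld r j * conv cop (f j k) (f p r \<circ> S) x)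
        (f w p \<circ> S \<circ> S) x)"
    proof (subst conv_lin(1))
      show "clinear (\<lambda>x. \<Sum>j = 1..N. drinfeld i j * conv cop (f j k) (f p i \<circ> S) x)"
        if "i \<in> {1..N}" for i
        using that
        by (intro clinear_sum_fun clinear_bilinear_right[OF cbilinear_mult lin])
    qed (simp_all only: fSS[OF p] mult_1_left)
    also have "\<dots> = (\<Sum>r=1..N. \<Sum>j=1..N. drinfeld r j * conv cop (conv cop (f j k) (f p r \<circ> S)) (f w p \<circ> S \<circ> S) x)"
      by (intro sum.cong refl conv_lin(1) lin fSS p)
    also have "\<dots> = (\<Sum>r=1..N. \<Sum>j=1..N. drinfeld r j * conv cop (f j k) (conv cop (f p r \<circ> S) (f w p \<circ> S \<circ> S)) x)"
      using p k by (intro sum.cong refl) (simp add: conv_assoc f_linear fS_linear fSS)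
    finally show ?thesis .
  qed
  then have "(\<Sum>p=1..N. drinfeld p k * f w p (S (S x))) =
      (\<Sum>p=1..N. \<Sum>r=1..N. \<Sum>j=1..N. drinfeld r j * conv cop (f j k) (conv cop (f p r \<circ> S) (f w p \<circ> S \<circ> S)) x)"
    by (rule sum.cong[OF refl])
  also have "\<dots> =
      (\<Sum>r=1..N. \<Sum>j=1..N. \<Sum>p=1..N. drinfeld r j * conv cop (f j k) (conv cop (f p r \<circ> S) (f w p \<circ> S \<circ> S)) x)"
    by (subst sum.swap, rule sum.cong[OF refl], rule sum.swap)
  also have "\<dots> = (\<Sum>r=1..N. \<Sum>j=1..N. drinfeld r j *
      conv cop (f j k) (\<lambda>y. \<Sum>p=1..N. 1 * conv cop (f p r \<circ> S) (f w p \<circ> S \<circ> S) y) x)"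
    using k by (intro sum.cong refl, subst conv_lin(2))
      (simp_all add: f_linear conv_linear fS_linear fSS sum_distrib_left)
  also have "\<dots> = (\<Sum>r=1..N. \<Sum>j=1..N. drinfeld r j * (if w = r then f j k x else 0))"
  proof (intro sum.cong refl)
    fix r j assume rj: "r \<in> {1..N}" "j \<in> {1..N}"
    have "conv cop (f j k) (\<lambda>y. 0) x = 0"
      using conv_lin(2)[of "{}" "\<lambda>_. cou" "f j k" "\<lambda>_. 0" x] f_linear[OF rj(2) k] by simp
    then show "drinfeld r j * conv cop (f j k) (\<lambda>y. \<Sum>p=1..N. 1 * conv cop (f p r \<circ> S) (f w p \<circ> S \<circ> S) y) x =
        drinfeld r j * (if w = r then f j k x else 0)"
      using inner[OF rj(1)] conv_cou(2)[OF f_linear[OF rj(2) k]] by simp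
  qed
  also have "\<dots> = (\<Sum>j=1..N. \<Sum>r=1..N. if w = r then drinfeld r j * f j k x else 0)"
    by (subst sum.swap) (intro sum.cong refl, simp)
  also have "\<dots> = (\<Sum>j=1..N. drinfeld w j * f j k x)" using w by simp
  finally show ?thesis .
qed

end

context fodc_structure
begin

text \<open>The Yetter-Drinfeld identity solved for \<open>J\<close>: convolving with
  \<open>S\<close> on the right removes the free factor that follows \<open>J\<close> on its left
  hand side.\<close>

lemma f_J_commute:
  assumes x: "x \<in> {1..N}" and z: "z \<in> {1..N}"
  shows "(\<Sum>p=1..N. f p x y *\<^sub>C J p z) =
    (\<Sum>j=1..N. convolve cop (\<lambda>a b. a * J x j * b) (dual_act cop (f z j)) S y)"
proof -
  note M = cbilinear_mult[where 'a = 'a] and id = clinear_ident(1)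
  have B: "cbilinear (\<lambda>c b. c *\<^sub>C (J p z * b))" for p
    by (rule cbilinear_comp[OF cbilinear_scale clinear_ident(1) cbilinearD(1)[OF M]])
  have l: "clinear (convolve cop (\<lambda>c b. c *\<^sub>C (J p z * b)) (f p x) (\<lambda>x. x))" if "p \<in> {1..N}" for p
    by (rule convolve_linear[OF cop_linear B f_linear[OF that x] id])
  have r: "clinear (\<lambda>y. dual_act cop (f z j) y * J x j)" if "j \<in> {1..N}" for j
    by (rule clinear_bilinear_left[OF M dual_act_linear[OF f_linear[OF z that]]])
  have "(\<Sum>p=1..N. f p x y *\<^sub>C J p z) =
      (\<Sum>p=1..N. convolve cop (*) (convolve cop (\<lambda>c b. c *\<^sub>C (J p z * b)) (f p x) (\<lambda>x. x)) S y)"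
  proof (rule sum.cong[OF refl])
    fix p assume p: "p \<in> {1..N}"
    have "convolve cop (*) (convolve cop (\<lambda>c b. c *\<^sub>C (J p z * b)) (f p x) (\<lambda>x. x)) S y =
        convolve cop (\<lambda>c b. c *\<^sub>C (J p z * b)) (f p x) (convolve cop (*) (\<lambda>x. x) S) y"
      by (rule convolve_assoc[OF coalg M B B M f_linear[OF p x] id S_linear])
        (simp add: scaleC_mult_left mult.assoc)
    then show "f p x y *\<^sub>C J p z =
        convolve cop (*) (convolve cop (\<lambda>c b. c *\<^sub>C (J p z * b)) (f p x) (\<lambda>x. x)) S y"
      by (simp add: S_right[abs_def] convolve_counit_right[OF coalg B f_linear[OF p x]])
  qed
  also have "\<dots> = convolve cop (*)
      (\<lambda>y. \<Sum>p=1..N. convolve cop (\<lambda>c b. c *\<^sub>C (J p z * b)) (f p x) (\<lambda>x. x) y) S y"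
    by (rule convolve_sum_left[symmetric, OF M l S_linear])
  also have "\<dots> = (\<Sum>j=1..N. convolve cop (*) (\<lambda>y. dual_act cop (f z j) y * J x j) S y)"
    unfolding yetter_drinfeld[OF x z] by (rule convolve_sum_left[OF M r S_linear])
  finally show ?thesis by (simp add: convolve_def)
qed

text \<open>Let T be the square of the inverse antipode, an algebra map. By
  \<open>f_J_commute\<close>, multiplying \<open>drinfeld_inv\<close> with the matrix of
  \<open>f\<close> at \<open>y\<close> gives the sum over j of \<open>f u j (T (y * J x j))\<close>.
  Taking \<open>y = S (J k x)\<close> and summing over x, the argument collapses to a Kronecker
  symbol by \<open>J_S\<close>.\<close>

lemma drinfeld_inverse:
  assumes bij: "bij S" and u: "u \<in> {1..N}" and k: "k \<in> {1..N}"
  shows "(\<Sum>p=1..N. drinfeld_inv u p * drinfeld p k) = (if u = k then 1 else 0)"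
proof -
  let ?T = "\<lambda>x. inv S (inv S x)"
  note M = cbilinear_mult[where 'a = 'a] and id = clinear_ident(1) and SC = cbilinear_scale
  note iS = inv_S[OF bij]
  have T: "clinear ?T" by (rule clinear_comp[OF iS(1) iS(1)])
  have T_mult: "?T (x * y) = ?T x * ?T y" for x y by (simp add: iS(2))
  have fT: "clinear (\<lambda>x. f u z (?T x))" if "z \<in> {1..N}" for z
    by (rule clinear_comp[OF f_linear[OF u that] T])
  define r where "r j z = convolve cop (\<lambda>c b. c *\<^sub>C b) (f z j) S" for j z
  have r_linear: "clinear (r j z)" if "j \<in> {1..N}" "z \<in> {1..N}" for j z
    unfolding r_def by (rule convolve_linear[OF cop_linear SC f_linear[OF that(2,1)] S_linear])
  \<comment> \<open>T composed with \<open>S\<close> is the inverse antipode, and the sum over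
    \<open>z\<close> merges the two values of \<open>f\<close> into one at \<open>P\<close> times
    the inverse antipode of b_2 times b_1, which equals eps(b) \<open>P\<close>.\<close>
  have absorb: "(\<Sum>z=1..N. f u z (P * ?T (r j z b))) = cou b * f u j P"
    if j: "j \<in> {1..N}" for j P b
  proof -
    have lin: "clinear (\<lambda>x. f u z (P * ?T x))" if "z \<in> {1..N}" for z
      by (rule clinear_comp[OF f_linear[OF u that] clinear_bilinear_right[OF M T]])
    have B: "cbilinear (\<lambda>c b. f z j c * f u z (P * inv S b))" if "z \<in> {1..N}" for z
      by (rule cbilinear_comp[OF cbilinear_mult f_linear[OF that j]
            clinear_comp[OF f_linear[OF u that] clinear_bilinear_right[OF M iS(1)]]])
    have "f u z (P * ?T (r j z b)) = tensor_lift (\<lambda>c b. f z j c * f u z (P * inv S b)) (cop b)"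
      if z: "z \<in> {1..N}" for z
      unfolding r_def
      by (subst convolve_comp[OF lin[OF z] SC f_linear[OF z j] S_linear])
        (simp add: convolve_def clinear_scale[OF lin[OF z]] iS(4) scaleC_complex_def)
    then have "(\<Sum>z=1..N. f u z (P * ?T (r j z b))) =
        (\<Sum>z=1..N. tensor_lift (\<lambda>c b. f z j c * f u z (P * inv S b)) (cop b))" by simp
    also have "\<dots> = tensor_lift (\<lambda>c b. \<Sum>z=1..N. f z j c * f u z (P * inv S b)) (cop b)"
      by (rule tensor_lift_sum[symmetric]) (rule B)
    also have "\<dots> = convolve cop (\<lambda>c b. f u j (P * (b * c))) (\<lambda>x. x) (inv S) b"
      using u j by (simp add: convolve_def f_mult mult.assoc[symmetric] mult.commute)
    also have "\<dots> = f u j (P * convolve cop (\<lambda>c b. b * c) (\<lambda>x. x) (inv S) b)"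
      by (rule convolve_comp[symmetric, OF clinear_comp[OF f_linear[OF u j] cbilinearD(1)[OF M]]
            cbilinear_swap[OF M] id iS(1)])
    finally show ?thesis
      by (simp add: iS(6) complex_algebra_1_scaleC_1_mult clinear_scale[OF f_linear[OF u j]] scaleC_complex_def)
  qed
  \<comment> \<open>Coassociativity moves the functional from the first leg, where
    \<open>dual_act\<close> has it, onto the leg carrying the antipode; the result has the shape
    treated by \<open>absorb\<close>.\<close>
  have conj: "(\<Sum>z=1..N. f u z (?T (convolve cop (\<lambda>a b. a * J x j * b) (dual_act cop (f z j)) S y))) =
      f u j (?T (y * J x j))" if x: "x \<in> {1..N}" and j: "j \<in> {1..N}" for x j y
  proof -
    have B: "cbilinear (\<lambda>a b. a * J x j * b)"
      by (rule cbilinear_comp[OF M cbilinearD(2)[OF M] clinear_ident(1)])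
    have Bz: "cbilinear (\<lambda>a b. f u z (?T (a * J x j) * ?T (r j z b)))" if "z \<in> {1..N}" for z
      by (rule cbilinear_post[OF f_linear[OF u that] cbilinear_comp[OF M
            clinear_comp[OF T cbilinearD(2)[OF M]] clinear_comp[OF T r_linear[OF j that]]]])
    have "f u z (?T (convolve cop (\<lambda>a b. a * J x j * b) (dual_act cop (f z j)) S y)) =
        tensor_lift (\<lambda>a b. f u z (?T (a * J x j) * ?T (r j z b))) (cop y)" if z: "z \<in> {1..N}" for z
    proof -
      have "convolve cop (\<lambda>a b. a * J x j * b) (dual_act cop (f z j)) S y =
          convolve cop (\<lambda>a b. a * J x j * b) (\<lambda>x. x) (r j z) y"
        unfolding dual_act_eq r_def
        by (rule convolve_assoc[OF coalg B cbilinear_swap[OF SC] B SC id f_linear[OF z j] S_linear])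
          (simp add: scaleC_mult_left scaleC_mult_right)
      then show ?thesis
        using convolve_comp[OF fT[OF z] B id r_linear[OF j z], of cop y]
        by (simp add: convolve_def T_mult)
    qed
    then have "(\<Sum>z=1..N. f u z (?T (convolve cop (\<lambda>a b. a * J x j * b) (dual_act cop (f z j)) S y))) =
        (\<Sum>z=1..N. tensor_lift (\<lambda>a b. f u z (?T (a * J x j) * ?T (r j z b))) (cop y))" by simp
    also have "\<dots> = tensor_lift (\<lambda>a b. \<Sum>z=1..N. f u z (?T (a * J x j) * ?T (r j z b))) (cop y)"
      by (rule tensor_lift_sum[symmetric]) (rule Bz)
    also have "\<dots> = conv cop (\<lambda>a. f u j (?T (a * J x j))) cou y"
      by (simp add: absorb[OF j] conv_def mult.commute)
    also have "\<dots> = f u j (?T (y * J x j))"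
      by (simp add: conv_cou(2)[OF clinear_comp[OF fT[OF j] cbilinearD(2)[OF M]]])
    finally show ?thesis .
  qed
  have "(\<Sum>p=1..N. drinfeld_inv u p * f p x y) = (\<Sum>j=1..N. f u j (?T (y * J x j)))"
    if x: "x \<in> {1..N}" for x y
  proof -
    have "(\<Sum>p=1..N. drinfeld_inv u p * f p x y) = (\<Sum>p=1..N. \<Sum>z=1..N. f p x y * f u z (?T (J p z)))"
      by (simp add: drinfeld_inv_def sum_distrib_right sum_distrib_left mult.commute)
    also have "\<dots> = (\<Sum>z=1..N. \<Sum>p=1..N. f p x y * f u z (?T (J p z)))"
      by (rule sum.swap)
    also have "\<dots> = (\<Sum>z=1..N. f u z (?T (\<Sum>p=1..N. f p x y *\<^sub>C J p z)))"
      by (rule sum.cong[OF refl])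
        (simp only: clinear_sum[OF fT] clinear_scale[OF fT] scaleC_complex_def)
    also have "\<dots> = (\<Sum>z=1..N. \<Sum>j=1..N.
        f u z (?T (convolve cop (\<lambda>a b. a * J x j * b) (dual_act cop (f z j)) S y)))"
      by (rule sum.cong[OF refl]) (simp only: f_J_commute[OF x] clinear_sum[OF fT])
    also have "\<dots> = (\<Sum>j=1..N. \<Sum>z=1..N.
        f u z (?T (convolve cop (\<lambda>a b. a * J x j * b) (dual_act cop (f z j)) S y)))"
      by (rule sum.swap)
    also have "\<dots> = (\<Sum>j=1..N. f u j (?T (y * J x j)))"
      by (rule sum.cong[OF refl]) (rule conj[OF x])
    finally show ?thesis .
  qed
  note commute = this
  have "(\<Sum>p=1..N. drinfeld_inv u p * drinfeld p k) =
      (\<Sum>p=1..N. \<Sum>x=1..N. drinfeld_inv u p * f p x (S (J k x)))"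
    by (simp add: drinfeld_def sum_distrib_left)
  also have "\<dots> = (\<Sum>x=1..N. \<Sum>p=1..N. drinfeld_inv u p * f p x (S (J k x)))"
    by (rule sum.swap)
  also have "\<dots> = (\<Sum>x=1..N. \<Sum>j=1..N. f u j (?T (S (J k x) * J x j)))"
    by (rule sum.cong[OF refl]) (rule commute)
  also have "\<dots> = (\<Sum>j=1..N. \<Sum>x=1..N. f u j (?T (S (J k x) * J x j)))"
    by (rule sum.swap)
  also have "\<dots> = (\<Sum>j=1..N. f u j (?T (\<Sum>x=1..N. S (J k x) * J x j)))"
    by (rule sum.cong[OF refl]) (simp only: clinear_sum[OF fT])
  also have "\<dots> = (\<Sum>j=1..N. if j = k then f u j (?T 1) else 0)"
    using k by (intro sum.cong refl) (auto simp: J_S clinear_0[OF fT])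
  also have "\<dots> = (if u = k then 1 else 0)" using u k by (simp add: iS(3) f_one)
  finally show ?thesis .
qed

lemma f_eq_antipode_square:
  assumes "bij S" and m: "m \<in> {1..N}" and k: "k \<in> {1..N}"
  shows "f m k x = (\<Sum>w=1..N. \<Sum>p=1..N. drinfeld_inv m w * drinfeld p k * f w p (S (S x)))"
proof -
  have "(\<Sum>w=1..N. \<Sum>p=1..N. drinfeld_inv m w * drinfeld p k * f w p (S (S x))) =
      (\<Sum>w=1..N. drinfeld_inv m w * (\<Sum>j=1..N. drinfeld w j * f j k x))"
    by (rule sum.cong[OF refl]) (simp add: drinfeld_twist[OF _ k, symmetric] sum_distrib_left mult.assoc)
  also have "\<dots> = (\<Sum>j=1..N. \<Sum>w=1..N. drinfeld_inv m w * drinfeld w j * f j k x)"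
    by (subst sum.swap) (simp add: sum_distrib_left mult.assoc)
  also have "\<dots> = (\<Sum>j=1..N. (if m = j then 1 else 0) * f j k x)"
    by (rule sum.cong[OF refl]) (simp add: sum_distrib_right[symmetric] drinfeld_inverse[OF assms(1) m])
  also have "\<dots> = f m k x" using m by (simp add: if_distrib[of "\<lambda>c. c * _"] cong: if_cong)
  finally show ?thesis ..
qed

end

subsection \<open>The bialgebra generated by the calculus\<close>

locale compatible_fodc = fodc_structure +
  assumes bij_S: "bij S"
    and S_compatible: "\<And>i j. i \<in> {1..N} \<Longrightarrow> j \<in> {1..N} \<Longrightarrow>
      dual_antipode S (f i j) \<in> calc_subalgebra cop cou N X f"
begin

abbreviation \<E> :: "('a \<Rightarrow> complex) set" where "\<E> \<equiv> calc_subalgebra cop cou N X f"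

lemma E_linear: "h \<in> \<E> \<Longrightarrow> clinear h"
proof (induction rule: calc_subalgebra.induct)
  case (add g h)
  show ?case unfolding plus_fun_def by (rule clinear_add_fun[OF add.IH])
next
  case (scale g c)
  show ?case unfolding scaleC_fun_def by (rule clinear_scale_fun[OF scale.IH])
qed (simp_all add: cou_linear X_linear f_linear conv_linear)

lemma E_neg: "h \<in> \<E> \<Longrightarrow> - h \<in> \<E>"
  by (drule calc_subalgebra.scale[where c = "- 1"]) simp

lemma E_zero: "0 \<in> \<E>"
  using calc_subalgebra.scale[OF calc_subalgebra.unit, where c = 0] by simp

lemma E_sum: "(\<And>i. i \<in> I \<Longrightarrow> g i \<in> \<E>) \<Longrightarrow> (\<Sum>i\<in>I. g i) \<in> \<E>"
  by (induction I rule: infinite_finite_induct) (simp_all add: E_zero calc_subalgebra.add)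

lemma E_subspace: "cvs.subspace \<E>"
  by (rule cvs.subspaceI) (simp_all add: E_zero calc_subalgebra.add calc_subalgebra.scale)

lemma fS_E: "i \<in> {1..N} \<Longrightarrow> j \<in> {1..N} \<Longrightarrow> f i j \<circ> S \<in> \<E>"
  using S_compatible by (simp add: dual_antipode_def)

lemma conv_S: "clinear g \<Longrightarrow> clinear h \<Longrightarrow> conv cop g h \<circ> S = conv cop (h \<circ> S) (g \<circ> S)"
  by (rule ext) (simp add: conv_antipode)

lemma XS_eq: "i \<in> {1..N} \<Longrightarrow> X i \<circ> S = - (\<Sum>j=1..N. conv cop (X j) (f j i \<circ> S))"
  by (rule ext) (simp add: X_S sum_fun_apply)

lemma E_antipode: "h \<in> \<E> \<Longrightarrow> h \<circ> S \<in> \<E>"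
proof (induction rule: calc_subalgebra.induct)
  case unit
  have "cou \<circ> S = cou" by (rule ext) (simp add: cou_S)
  then show ?case by (simp add: calc_subalgebra.unit)
next
  case (gen_X i)
  then show ?case
    unfolding XS_eq[OF gen_X]
    by (intro E_neg E_sum calc_subalgebra.mult calc_subalgebra.gen_X fS_E)
next
  case (gen_f i j)
  then show ?case by (rule fS_E)
next
  case (add g h)
  have "(g + h) \<circ> S = (g \<circ> S) + (h \<circ> S)" by (rule ext) simp
  then show ?case using calc_subalgebra.add[OF add.IH] by (simp only:)
next
  case (scale g c)
  have "(c *\<^sub>C g) \<circ> S = c *\<^sub>C (g \<circ> S)" by (rule ext) (simp add: scaleC_fun_def)
  then show ?case using calc_subalgebra.scale[OF scale.IH] by (simp only:)
next
  case (mult g h)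
  then show ?case by (simp only: conv_S E_linear calc_subalgebra.mult)
qed

lemma f_inverse_antipode: "i \<in> {1..N} \<Longrightarrow> j \<in> {1..N} \<Longrightarrow> \<exists>g\<in>\<E>. g \<circ> S = f i j"
proof
  assume ij: "i \<in> {1..N}" "j \<in> {1..N}"
  \<comment> \<open>This is the expansion \<open>f_eq_antipode_square\<close> with one application
    of \<open>S\<close> removed, so that compatibility places every summand in \<E>.\<close>
  let ?g = "\<Sum>w=1..N. \<Sum>p=1..N. (drinfeld_inv i w * drinfeld p j) *\<^sub>C (f w p \<circ> S)"
  show "?g \<in> \<E>" by (intro E_sum calc_subalgebra.scale fS_E)
  show "?g \<circ> S = f i j"
    by (rule ext) (simp add: f_eq_antipode_square[OF bij_S ij] sum_fun_apply scaleC_fun_def scaleC_complex_def)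
qed

lemma E_inverse_antipode: "h \<in> \<E> \<Longrightarrow> \<exists>g\<in>\<E>. g \<circ> S = h"
proof (induction rule: calc_subalgebra.induct)
  case unit
  have "cou \<circ> S = cou" by (rule ext) (simp add: cou_S)
  then show ?case using calc_subalgebra.unit by blast
next
  case (gen_X k)
  obtain g where g: "\<And>i. i \<in> {1..N} \<Longrightarrow> g i \<in> \<E> \<and> g i \<circ> S = f i k"
    using f_inverse_antipode[OF _ gen_X] by metis
  \<comment> \<open>With \<open>g i\<close> the preimage of \<open>f i k\<close>, this solves the
    skew antipode identity for the coproduct of X_k: the inverse antipode of the second leg, times
    the first leg, sums to zero.\<close>
  let ?h = "- (\<Sum>i=1..N. conv cop (g i) (X i))"
  have "?h \<in> \<E>"
    using g by (intro E_neg E_sum calc_subalgebra.mult calc_subalgebra.gen_X) auto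
  moreover have "(?h \<circ> S) x = X k x" for x
  proof -
    have lin: "clinear (X i)" "clinear (f i j \<circ> S)" "clinear (f i j)" if "i \<in> {1..N}" "j \<in> {1..N}" for i j
      using that by (simp_all add: X_linear fS_linear f_linear)
    have "conv cop (g i) (X i) (S x) = - (\<Sum>j=1..N. conv cop (X j) (conv cop (f j i \<circ> S) (f i k)) x)"
      if i: "i \<in> {1..N}" for i
    proof -
      have "conv cop (g i) (X i) (S x) = conv cop (X i \<circ> S) (f i k) x"
        using g[OF i] conv_antipode[of "g i" "X i" x] E_linear X_linear[OF i] by simp
      also have "X i \<circ> S = (\<lambda>x. \<Sum>j=1..N. - 1 * conv cop (X j) (f j i \<circ> S) x)"
        by (rule ext) (simp add: X_S[OF i] sum_negf)
      also have "conv cop \<dots> (f i k) x = (\<Sum>j=1..N. - 1 * conv cop (conv cop (X j) (f j i \<circ> S)) (f i k) x)"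
        using i gen_X by (intro conv_lin(1) conv_linear lin) auto
      also have "\<dots> = - (\<Sum>j=1..N. conv cop (X j) (conv cop (f j i \<circ> S) (f i k)) x)"
        using i gen_X by (simp add: conv_assoc lin sum_negf)
      finally show ?thesis .
    qed
    then have "(?h \<circ> S) x = (\<Sum>i=1..N. \<Sum>j=1..N. conv cop (X j) (conv cop (f j i \<circ> S) (f i k)) x)"
      by (simp add: sum_fun_apply sum_negf)
    also have "\<dots> = (\<Sum>j=1..N. \<Sum>i=1..N. 1 * conv cop (X j) (conv cop (f j i \<circ> S) (f i k)) x)"
      by (subst sum.swap) simp
    also have "\<dots> = (\<Sum>j=1..N. conv cop (X j) (\<lambda>x. \<Sum>i=1..N. 1 * conv cop (f j i \<circ> S) (f i k) x) x)"
      using gen_X by (intro sum.cong refl conv_lin(2)[symmetric] conv_linear lin) auto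
    also have "\<dots> = (\<Sum>j=1..N. if j = k then X k x else 0)"
    proof (rule sum.cong[OF refl])
      fix j assume j: "j \<in> {1..N}"
      have "conv cop (X j) (\<lambda>x. 0) x = 0"
        using conv_lin(2)[of "{}" "\<lambda>_. cou" "X j" "\<lambda>_. 0" x] lin(1)[OF j j] by simp
      then show "conv cop (X j) (\<lambda>x. \<Sum>i=1..N. 1 * conv cop (f j i \<circ> S) (f i k) x) x =
          (if j = k then X k x else 0)"
        using conv_cou(2)[OF lin(1)[OF gen_X gen_X]] by (simp add: f_S(1)[OF j gen_X])
    qed
    also have "\<dots> = X k x" using gen_X by simp
    finally show ?thesis .
  qed
  ultimately show ?case by blast
next
  case (gen_f i j)
  then show ?case by (rule f_inverse_antipode)
next
  case (add g h)
  then obtain g' h' where "g' \<in> \<E>" "h' \<in> \<E>" "g' \<circ> S = g" "h' \<circ> S = h" by blast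
  moreover have "(g' + h') \<circ> S = (g' \<circ> S) + (h' \<circ> S)" by (rule ext) simp
  ultimately show ?case by (intro bexI[of _ "g' + h'"]) (simp_all only: calc_subalgebra.add)
next
  case (scale g c)
  then obtain g' where "g' \<in> \<E>" "g' \<circ> S = g" by blast
  moreover have "(c *\<^sub>C g') \<circ> S = c *\<^sub>C (g' \<circ> S)" by (rule ext) (simp add: scaleC_fun_def)
  ultimately show ?case by (intro bexI[of _ "c *\<^sub>C g'"]) (simp_all add: calc_subalgebra.scale)
next
  case (mult g h)
  then obtain g' h' where "g' \<in> \<E>" "h' \<in> \<E>" "g' \<circ> S = g" "h' \<circ> S = h" by blast
  then show ?case
    by (intro bexI[of _ "conv cop h' g'"]) (simp_all add: conv_S E_linear calc_subalgebra.mult)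
qed

lemma E_inv_S: "h \<in> \<E> \<Longrightarrow> h \<circ> inv S \<in> \<E>"
proof -
  assume "h \<in> \<E>"
  then obtain g where g: "g \<in> \<E>" "g \<circ> S = h" using E_inverse_antipode by blast
  have "h \<circ> inv S = g"
    by (rule ext) (simp add: g(2)[symmetric] inv_S(5)[OF bij_S])
  then show ?thesis using g by simp
qed

end

section \<open>Algebras given by generators and relations\<close>

text \<open>Words act as composites of operators with the last letter acting first, so products in
  the free algebra become composites; \<open>free_eval\<close> is the case of left
  multiplications.\<close>

definition operator_eval :: "('x \<Rightarrow> 'v \<Rightarrow> 'v::complex_vector) \<Rightarrow> 'x free_algebra \<Rightarrow> 'v \<Rightarrow> 'v" where
  "operator_eval T p v = (\<Sum>w\<in>Poly_Mapping.keys p. Poly_Mapping.lookup p w *\<^sub>C foldr T w v)"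

lemma operator_eval_linear: "clinear (\<lambda>p. operator_eval T p v)"
proof -
  have sup: "operator_eval T p v = (\<Sum>w\<in>K. Poly_Mapping.lookup p w *\<^sub>C foldr T w v)"
    if "finite K" "Poly_Mapping.keys p \<subseteq> K" for p K
    unfolding operator_eval_def
    by (rule sum.mono_neutral_left) (use that in \<open>auto simp: in_keys_iff\<close>)
  show ?thesis
  proof (rule clinearI)
    fix p q :: "'a free_algebra" and c
    let ?K = "Poly_Mapping.keys p \<union> Poly_Mapping.keys q"
    have K: "finite ?K" by simp
    have "Poly_Mapping.keys (p + q) \<subseteq> ?K" by (rule Poly_Mapping.keys_add)
    then show "operator_eval T (p + q) v = operator_eval T p v + operator_eval T q v"
      by (simp add: sup[OF K] lookup_add scaleC_add_left sum.distrib)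
    have "Poly_Mapping.keys (c *\<^sub>C p) \<subseteq> Poly_Mapping.keys p"
      by (auto simp: in_keys_iff scaleC_poly_mapping.rep_eq)
    then show "operator_eval T (c *\<^sub>C p) v = c *\<^sub>C operator_eval T p v"
      using sup[of "Poly_Mapping.keys p" "c *\<^sub>C p"]
      by (simp add: operator_eval_def scaleC_poly_mapping.rep_eq scaleC_scaleC
          cvs.scale_sum_right scaleC_complex_def)
  qed
qed

lemma operator_eval_single: "operator_eval T (Poly_Mapping.single w c) v = c *\<^sub>C foldr T w v"
  by (cases "c = 0") (simp_all add: operator_eval_def)

lemma operator_eval_letter: "operator_eval T (letter x) v = T x v"
  by (simp add: letter_def operator_eval_single scaleC_one)

lemma operator_eval_one:
  fixes T :: "'a \<Rightarrow> 'v \<Rightarrow> 'v::complex_vector"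
  shows "operator_eval T 1 v = v"
proof -
  have one: "(1 :: 'a free_algebra) = Poly_Mapping.single [] 1"
    by (simp add: single_one[symmetric] zero_list_def)
  show ?thesis by (subst one) (simp add: operator_eval_single scaleC_one)
qed

lemma poly_mapping_sum_single:
  "p = (\<Sum>k\<in>Poly_Mapping.keys p. Poly_Mapping.single k (Poly_Mapping.lookup p k :: complex))"
proof -
  have "c *\<^sub>C Poly_Mapping.single k (1::complex) = Poly_Mapping.single k c" for k :: 'a and c
    by (rule poly_mapping_eqI)
      (simp add: scaleC_poly_mapping.rep_eq lookup_single scaleC_complex_def when_def)
  then show ?thesis using poly_mapping_expand[of p] by simp
qed

lemma operator_eval_vector_linear:
  assumes "\<And>x. clinear (T x)"
  shows "clinear (operator_eval T p)"
proof -
  have "clinear (foldr T w)" for w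
    by (induction w) (simp_all add: clinear_ident clinear_comp[OF assms] comp_def)
  then show ?thesis
    unfolding operator_eval_def[abs_def] by (intro clinear_sum_fun clinear_scale_fun)
qed

lemma operator_eval_mult:
  assumes "\<And>x. clinear (T x)"
  shows "operator_eval T (p * q) v = operator_eval T p (operator_eval T q v)"
proof -
  note P = operator_eval_linear and V = operator_eval_vector_linear[OF assms]
  have single: "operator_eval T (Poly_Mapping.single k a * Poly_Mapping.single l b) v =
      operator_eval T (Poly_Mapping.single k a) (operator_eval T (Poly_Mapping.single l b) v)" for k l a b
    by (simp add: mult_single operator_eval_single plus_list_def)
      (simp add: operator_eval_single[symmetric, where c = 1, unfolded scaleC_one] clinear_scale[OF V] scaleC_scaleC)
  let ?p = "\<Sum>k\<in>Poly_Mapping.keys p. Poly_Mapping.single k (Poly_Mapping.lookup p k)"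
  let ?q = "\<Sum>k\<in>Poly_Mapping.keys q. Poly_Mapping.single k (Poly_Mapping.lookup q k)"
  have "operator_eval T (?p * ?q) v = operator_eval T ?p (operator_eval T ?q v)"
    unfolding sum_product clinear_sum[OF P] clinear_sum[OF V] single by (rule sum.swap)
  then show ?thesis by (simp only: poly_mapping_sum_single[symmetric])
qed

lemma free_eval_eq: "free_eval \<gamma> p = operator_eval (\<lambda>x c. \<gamma> x * c) p 1"
proof -
  have "foldr (\<lambda>x c. \<gamma> x * c) w 1 = prod_list (map \<gamma> w)" for w
    by (induction w) simp_all
  then show ?thesis by (simp add: free_eval_def operator_eval_def)
qed

lemma free_eval_linear: "clinear (free_eval \<gamma>)"
  unfolding free_eval_eq[abs_def] by (rule operator_eval_linear)

lemma free_eval_mult: "free_eval \<gamma> (p * q) = free_eval \<gamma> p * free_eval \<gamma> q"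
proof -
  have lin: "clinear (\<lambda>c. \<gamma> x * c)" for x by (rule cbilinearD(1)[OF cbilinear_mult])
  have eval: "operator_eval (\<lambda>x c. \<gamma> x * c) p v = free_eval \<gamma> p * v" for p v
  proof -
    have "foldr (\<lambda>x c. \<gamma> x * c) w v = prod_list (map \<gamma> w) * v" for w
      by (induction w) (simp_all add: mult.assoc)
    then show ?thesis
      by (simp add: free_eval_def operator_eval_def sum_distrib_right scaleC_mult_left)
  qed
  have "free_eval \<gamma> (p * q) = operator_eval (\<lambda>x c. \<gamma> x * c) p (operator_eval (\<lambda>x c. \<gamma> x * c) q 1)"
    unfolding free_eval_eq by (rule operator_eval_mult[OF lin])
  then show ?thesis by (simp only: eval mult_1_right)
qed

lemma free_eval_letter: "free_eval \<gamma> (letter x) = \<gamma> x"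
  by (simp add: free_eval_eq operator_eval_letter)

lemma free_eval_one: "free_eval \<gamma> 1 = 1"
  by (simp add: free_eval_eq operator_eval_one)

lemma free_algebra_on_add: "p \<in> free_algebra_on G \<Longrightarrow> q \<in> free_algebra_on G \<Longrightarrow> p + q \<in> free_algebra_on G"
  using Poly_Mapping.keys_add[of p q] unfolding free_algebra_on_def by blast

lemma free_algebra_on_scale: "p \<in> free_algebra_on G \<Longrightarrow> c *\<^sub>C p \<in> free_algebra_on G"
  unfolding free_algebra_on_def by (auto simp: in_keys_iff scaleC_poly_mapping.rep_eq)

lemma free_algebra_on_diff: "p \<in> free_algebra_on G \<Longrightarrow> q \<in> free_algebra_on G \<Longrightarrow> p - q \<in> free_algebra_on G"
  using free_algebra_on_add[OF _ free_algebra_on_scale[of q G "- 1"], of p] by simp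

lemma free_algebra_on_letter: "x \<in> G \<Longrightarrow> letter x \<in> free_algebra_on G"
  by (simp add: free_algebra_on_def letter_def)

lemma free_algebra_on_one: "1 \<in> free_algebra_on G"
  by (simp add: free_algebra_on_def single_one[symmetric] zero_list_def)

lemma free_algebra_on_mult: "p \<in> free_algebra_on G \<Longrightarrow> q \<in> free_algebra_on G \<Longrightarrow> p * q \<in> free_algebra_on G"
  using keys_mult[of p q] unfolding free_algebra_on_def by (fastforce simp: plus_list_def)

lemma presented_relator:
  assumes "presented_algebra G R \<gamma>" "r \<in> R" "r \<in> free_algebra_on G"
  shows "free_eval \<gamma> r = 0"
proof -
  have "1 * r * 1 \<in> two_sided_ideal G R"
    unfolding two_sided_ideal_def
    by (rule cvs.span_base) (use assms(2) free_algebra_on_one in blast)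
  then show ?thesis using assms(1,3) by (simp add: presented_algebra_def)
qed

text \<open>Linear operators in which all relators vanish represent the presented algebra, so an
  expression that evaluates to zero acts as zero. This is the way to show that an element is not
  forced to vanish by the relations.\<close>

lemma presented_representation:
  assumes "presented_algebra G R \<gamma>" and T: "\<And>x. clinear (T x)"
    and R: "\<And>r v. r \<in> R \<Longrightarrow> operator_eval T r v = 0"
    and p: "p \<in> free_algebra_on G" "free_eval \<gamma> p = 0"
  shows "operator_eval T p v = 0"
proof -
  have "p \<in> two_sided_ideal G R" using assms by (simp add: presented_algebra_def)
  then show ?thesis
    unfolding two_sided_ideal_def
  proof (induction rule: cvs.span_induct_alt)
    case base
    show ?case by (rule clinear_0[OF operator_eval_linear])
  next
    case (step c x y)
    then obtain p r q where "x = p * r * q" "r \<in> R" by blast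
    then have "operator_eval T x v = 0"
      by (simp add: operator_eval_mult[OF T] R clinear_0[OF operator_eval_vector_linear[OF T]])
    then show ?case
      using step by (simp add: clinear_add[OF operator_eval_linear] clinear_scale[OF operator_eval_linear])
  qed
qed

section \<open>The quantum Cartan algebra\<close>

context hopf_structure
begin

lemma dual_act_add: "clinear g \<Longrightarrow> clinear h \<Longrightarrow> dual_act cop (g + h) x = dual_act cop g x + dual_act cop h x"
  using convolve_add_right[OF cbilinear_swap[OF cbilinear_scale] clinear_ident(1), where Q = g and Q' = h and cop = cop and x = x]
  by (simp add: dual_act_eq plus_fun_def)

lemma dual_act_scale: "clinear g \<Longrightarrow> dual_act cop (c *\<^sub>C g) x = c *\<^sub>C dual_act cop g x"
  using convolve_scale_right[OF cbilinear_swap[OF cbilinear_scale] clinear_ident(1), where Q = g and c = c and cop = cop and x = x]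
  by (simp add: dual_act_eq scaleC_fun_def)

lemma dual_act_sum:
  assumes "\<And>i. i \<in> I \<Longrightarrow> clinear (g i)"
  shows "dual_act cop (\<Sum>i\<in>I. g i) x = (\<Sum>i\<in>I. dual_act cop (g i) x)"
proof -
  have "(\<Sum>i\<in>I. g i) = (\<lambda>a. \<Sum>i\<in>I. g i a)" by (rule ext) (rule sum_fun_apply)
  then show ?thesis
    using convolve_sum_right[OF cbilinear_swap[OF cbilinear_scale] clinear_ident(1), where Q = g and I = I and cop = cop and x = x] assms
    by (simp add: dual_act_eq)
qed

lemma scaleC_fun_apply: "(c *\<^sub>C g) x = c *\<^sub>C g x"
  by (simp add: scaleC_fun_def)

text \<open>
  Nonlinear functionals act by zero, which makes every operator below linear.
\<close>

definition act :: "('a \<Rightarrow> complex) \<Rightarrow> 'a \<Rightarrow> 'a" where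
  "act h x = (if clinear h then dual_act cop h x else 0)"

lemma act_linear: "clinear (act h)"
  by (cases "clinear h") (simp_all add: act_def[abs_def] dual_act_linear clinear_zero_fun)

end

text \<open>
  The representation by \<open>2 \<times> 2\<close> matrices over \<open>\<E>\<close> in which \<open>\<delta>\<close> is the matrix unit \<open>e\<^sub>2\<^sub>1\<close> and
  \<open>\<xi> i\<close> is \<open>X i e\<^sub>1\<^sub>2\<close>; the index \<open>False\<close> is the first one.
\<close>

fun (in hopf_structure) cartan_rep ::
  "(nat \<Rightarrow> 'a \<Rightarrow> complex) \<Rightarrow> ('a \<Rightarrow> complex) cartan_gen \<Rightarrow> (bool \<Rightarrow> 'a) \<Rightarrow> bool \<Rightarrow> 'a" where
  "cartan_rep X (Even h) v = (\<lambda>b. act h (v b))"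
| "cartan_rep X (Xi i) v = (\<lambda>b. if b then 0 else act (X i) (v True))"
| "cartan_rep X Delta v = (\<lambda>b. if b then v False else 0)"

lemma (in hopf_structure) cartan_rep_linear: "clinear (cartan_rep X g)"
proof (cases g)
  case (Even h)
  then show ?thesis
    by (intro clinearI) (simp_all add: fun_eq_iff scaleC_fun_def clinear_add[OF act_linear] clinear_scale[OF act_linear])
next
  case (Xi i)
  then show ?thesis
    by (intro clinearI) (simp_all add: fun_eq_iff scaleC_fun_def clinear_add[OF act_linear] clinear_scale[OF act_linear])
next
  case Delta
  then show ?thesis
    by (intro clinearI) (simp_all add: fun_eq_iff scaleC_fun_def)
qed

locale quantum_cartan = compatible_fodc cop cou S lm rm d lco rco N \<omega> f J X
  for cop :: "'a::complex_algebra_1 \<Rightarrow> ('a, 'a) tensor" and cou S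
    and lm :: "'a \<Rightarrow> 'g::complex_vector \<Rightarrow> 'g" and rm d lco rco N \<omega> f J X +
  fixes t :: "nat \<Rightarrow> nat \<Rightarrow> nat \<Rightarrow> nat \<Rightarrow> complex"
    and \<gamma> :: "('a \<Rightarrow> complex) cartan_gen \<Rightarrow> 'c::complex_algebra_1"
  assumes cartan: "quantum_cartan_algebra cop cou N X f J t \<gamma>"
begin

abbreviation gens :: "('a \<Rightarrow> complex) cartan_gen set" where "gens \<equiv> cartan_gens N \<E>"

lemma presentation:
  "presented_algebra gens
    (even_relators (conv cop) cou \<E> \<union> odd_relators N X f (braid f J) (struct X J) t) \<gamma>"
  using cartan by (simp add: quantum_cartan_algebra_def Let_def)

lemma gens_intro: "h \<in> \<E> \<Longrightarrow> Even h \<in> gens" "i \<in> {1..N} \<Longrightarrow> Xi i \<in> gens" "Delta \<in> gens"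
  by (auto simp: cartan_gens_def)

lemma even_relator_zero:
  "r \<in> even_relators (conv cop) cou \<E> \<Longrightarrow> r \<in> free_algebra_on gens \<Longrightarrow> free_eval \<gamma> r = 0"
  using presented_relator[OF presentation] by blast

lemma gamma_unit: "\<gamma> (Even cou) = 1"
proof -
  have "free_eval \<gamma> (letter (Even cou) - 1) = 0"
    by (rule even_relator_zero)
      (auto simp: even_relators_def
        intro!: free_algebra_on_diff free_algebra_on_letter free_algebra_on_one gens_intro calc_subalgebra.unit)
  then show ?thesis by (simp add: clinear_diff[OF free_eval_linear] free_eval_letter free_eval_one)
qed

lemma gamma_add:
  assumes "g \<in> \<E>" "h \<in> \<E>"
  shows "\<gamma> (Even (g + h)) = \<gamma> (Even g) + \<gamma> (Even h)"
proof -
  have "free_eval \<gamma> (letter (Even (g + h)) - letter (Even g) - letter (Even h)) = 0"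
  proof (rule even_relator_zero)
    show "letter (Even (g + h)) - letter (Even g) - letter (Even h) \<in> even_relators (conv cop) cou \<E>"
      unfolding even_relators_def using assms by blast
    show "letter (Even (g + h)) - letter (Even g) - letter (Even h) \<in> free_algebra_on gens"
      by (intro free_algebra_on_diff free_algebra_on_letter gens_intro calc_subalgebra.add assms)
  qed
  then show ?thesis
    by (simp add: clinear_diff[OF free_eval_linear] clinear_add[OF free_eval_linear] free_eval_letter algebra_simps)
qed

lemma gamma_scale:
  assumes "g \<in> \<E>"
  shows "\<gamma> (Even (c *\<^sub>C g)) = c *\<^sub>C \<gamma> (Even g)"
proof -
  have "free_eval \<gamma> (letter (Even (c *\<^sub>C g)) - c *\<^sub>C letter (Even g)) = 0"
  proof (rule even_relator_zero)
    show "letter (Even (c *\<^sub>C g)) - c *\<^sub>C letter (Even g) \<in> even_relators (conv cop) cou \<E>"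
      unfolding even_relators_def using assms by blast
    show "letter (Even (c *\<^sub>C g)) - c *\<^sub>C letter (Even g) \<in> free_algebra_on gens"
      by (intro free_algebra_on_diff free_algebra_on_scale free_algebra_on_letter gens_intro
          calc_subalgebra.scale assms)
  qed
  then show ?thesis
    by (simp add: clinear_diff[OF free_eval_linear] clinear_scale[OF free_eval_linear] free_eval_letter)
qed

lemma gamma_conv:
  assumes "g \<in> \<E>" "h \<in> \<E>"
  shows "\<gamma> (Even (conv cop g h)) = \<gamma> (Even g) * \<gamma> (Even h)"
proof -
  have "free_eval \<gamma> (letter (Even (conv cop g h)) - letter (Even g) * letter (Even h)) = 0"
  proof (rule even_relator_zero)
    show "letter (Even (conv cop g h)) - letter (Even g) * letter (Even h) \<in> even_relators (conv cop) cou \<E>"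
      unfolding even_relators_def using assms by blast
    show "letter (Even (conv cop g h)) - letter (Even g) * letter (Even h) \<in> free_algebra_on gens"
      by (intro free_algebra_on_diff free_algebra_on_mult free_algebra_on_letter gens_intro
          calc_subalgebra.mult assms)
  qed
  then show ?thesis
    by (simp add: clinear_diff[OF free_eval_linear] free_eval_mult free_eval_letter)
qed

section \<open>The matrix representation respects the relators, and \<E> embeds\<close>

lemma even_relators_rep:
  assumes "r \<in> even_relators (conv cop) cou \<E>"
  shows "operator_eval (cartan_rep X) r v = 0"
proof -
  note E = clinear_add[OF operator_eval_linear] clinear_diff[OF operator_eval_linear]
    clinear_scale[OF operator_eval_linear] operator_eval_letter operator_eval_one
    operator_eval_mult[OF cartan_rep_linear]
  have act: "act h x = dual_act cop h x" if "h \<in> \<E>" for h x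
    using that by (simp add: act_def E_linear)
  show ?thesis
    using assms unfolding even_relators_def
    by (auto simp: E fun_eq_iff act calc_subalgebra.unit calc_subalgebra.add calc_subalgebra.scale
        calc_subalgebra.mult dual_act_cou dual_act_add dual_act_scale dual_act_conv E_linear scaleC_fun_apply)
qed

text \<open>Products of two \<xi>, and of two \<delta>, act as zero since the matrix units square to
  zero, and e12 e21 + e21 e12 = 1 gives the relation between \<xi> and \<delta>. Even generators act
  by the same operator on both components, hence commute with \<delta>. The relations of \<xi> with
  \<open>f\<close> and \<open>X\<close> become \<open>X_f_relation\<close> and
  \<open>X_X_relation\<close> in the corner e12.\<close>

lemma odd_relators_rep:
  assumes "r \<in> odd_relators N X f (braid f J) (struct X J) t"
  shows "operator_eval (cartan_rep X) r v = 0"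
proof -
  let ?e = "\<lambda>r. operator_eval (cartan_rep X) r v"
  note E = clinear_add[OF operator_eval_linear] clinear_diff[OF operator_eval_linear]
    clinear_scale[OF operator_eval_linear] clinear_sum[OF operator_eval_linear]
    operator_eval_letter operator_eval_mult[OF cartan_rep_linear] scaleC_fun_apply sum_fun_apply
  have act: "act (X i) x = dual_act cop (X i) x" "act (f i j) x = dual_act cop (f i j) x"
    if "i \<in> {1..N}" "j \<in> {1..N}" for i j x
    using that by (simp_all add: act_def X_linear f_linear)
  have act0: "act h 0 = 0" for h by (rule clinear_0[OF act_linear])
  note lin = X_linear f_linear conv_linear
  have Xf: "act (X i) (act (f k j) x) =
      (\<Sum>n=1..N. \<Sum>m=1..N. braid f J i j n m *\<^sub>C act (f k n) (act (X m) x))"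
    if "i \<in> {1..N}" "j \<in> {1..N}" "k \<in> {1..N}" for i j k x
  proof -
    have l: "clinear (braid f J i j n m *\<^sub>C conv cop (f k n) (X m))" if "n \<in> {1..N}" "m \<in> {1..N}" for n m
      by (intro E_linear calc_subalgebra.intros that \<open>k \<in> {1..N}\<close>)
    have l': "clinear (\<Sum>m=1..N. braid f J i j n m *\<^sub>C conv cop (f k n) (X m))" if "n \<in> {1..N}" for n
      by (intro E_linear E_sum calc_subalgebra.intros that \<open>k \<in> {1..N}\<close>)
    have "act (X i) (act (f k j) x) = dual_act cop (conv cop (X i) (f k j)) x"
      using that by (simp add: act dual_act_conv lin)
    also have "\<dots> = (\<Sum>n=1..N. dual_act cop (\<Sum>m=1..N. braid f J i j n m *\<^sub>C conv cop (f k n) (X m)) x)"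
      unfolding X_f_relation[OF that(1,3,2)] by (rule dual_act_sum) (rule l')
    also have "\<dots> = (\<Sum>n=1..N. \<Sum>m=1..N. dual_act cop (braid f J i j n m *\<^sub>C conv cop (f k n) (X m)) x)"
      by (rule sum.cong[OF refl], rule dual_act_sum) (rule l)
    also have "\<dots> = (\<Sum>n=1..N. \<Sum>m=1..N. braid f J i j n m *\<^sub>C dual_act cop (conv cop (f k n) (X m)) x)"
      using that by (simp add: dual_act_scale lin)
    finally show ?thesis using that by (simp add: act dual_act_conv lin)
  qed
  have XX: "act (X i) (act (X j) x) =
      (\<Sum>k=1..N. \<Sum>l=1..N. braid f J i j k l *\<^sub>C act (X k) (act (X l) x)) +
      (\<Sum>k=1..N. struct X J i j k *\<^sub>C act (X k) x)"
    if "i \<in> {1..N}" "j \<in> {1..N}" for i j x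
  proof -
    have l: "clinear (braid f J i j n m *\<^sub>C conv cop (X n) (X m))" if "n \<in> {1..N}" "m \<in> {1..N}" for n m
      by (intro E_linear calc_subalgebra.intros that)
    have l': "clinear (\<Sum>m=1..N. braid f J i j n m *\<^sub>C conv cop (X n) (X m))" if "n \<in> {1..N}" for n
      by (intro E_linear E_sum calc_subalgebra.intros that)
    have l'': "clinear (\<Sum>n=1..N. \<Sum>m=1..N. braid f J i j n m *\<^sub>C conv cop (X n) (X m))"
      by (intro E_linear E_sum calc_subalgebra.intros)
    have c: "clinear (struct X J i j n *\<^sub>C X n)" if "n \<in> {1..N}" for n
      by (intro E_linear calc_subalgebra.intros that)
    have c': "clinear (\<Sum>k=1..N. struct X J i j k *\<^sub>C X k)"
      by (intro E_linear E_sum calc_subalgebra.intros)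
    have "act (X i) (act (X j) x) = dual_act cop (conv cop (X i) (X j)) x"
      using that by (simp add: act dual_act_conv lin)
    also have "\<dots> = dual_act cop (\<Sum>n=1..N. \<Sum>m=1..N. braid f J i j n m *\<^sub>C conv cop (X n) (X m)) x +
        dual_act cop (\<Sum>k=1..N. struct X J i j k *\<^sub>C X k) x"
      unfolding X_X_relation[OF that] by (rule dual_act_add[OF l'' c'])
    also have "dual_act cop (\<Sum>k=1..N. struct X J i j k *\<^sub>C X k) x =
        (\<Sum>k=1..N. dual_act cop (struct X J i j k *\<^sub>C X k) x)"
      by (rule dual_act_sum) (rule c)
    also have "dual_act cop (\<Sum>n=1..N. \<Sum>m=1..N. braid f J i j n m *\<^sub>C conv cop (X n) (X m)) x =
        (\<Sum>n=1..N. dual_act cop (\<Sum>m=1..N. braid f J i j n m *\<^sub>C conv cop (X n) (X m)) x)"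
      by (rule dual_act_sum) (rule l')
    also have "\<dots> = (\<Sum>n=1..N. \<Sum>m=1..N. dual_act cop (braid f J i j n m *\<^sub>C conv cop (X n) (X m)) x)"
      by (rule sum.cong[OF refl], rule dual_act_sum) (rule l)
    also have "\<dots> = (\<Sum>n=1..N. \<Sum>m=1..N. braid f J i j n m *\<^sub>C dual_act cop (conv cop (X n) (X m)) x)"
      using that by (simp add: dual_act_scale lin)
    also have "(\<Sum>k=1..N. dual_act cop (struct X J i j k *\<^sub>C X k) x) =
        (\<Sum>k=1..N. struct X J i j k *\<^sub>C dual_act cop (X k) x)"
      by (simp add: dual_act_scale lin)
    finally show ?thesis using that by (simp add: act dual_act_conv lin)
  qed
  from assms show ?thesis
    unfolding odd_relators_def Let_def
    by (elim UnE) (auto simp: E fun_eq_iff act0 Xf XX)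
qed

text \<open>The generator \<open>Even h\<close> acts on each component by
  \<open>dual_act cop h\<close>, from which the counit recovers \<open>h\<close>.\<close>

lemma gamma_injective:
  assumes h: "h \<in> \<E>" and "\<gamma> (Even h) = 0"
  shows "h = 0"
proof
  fix x
  have "operator_eval (cartan_rep X) (letter (Even h)) v = 0" for v
    by (rule presented_representation[OF presentation cartan_rep_linear])
      (use assms even_relators_rep odd_relators_rep in
        \<open>auto simp: free_eval_letter intro!: free_algebra_on_letter gens_intro\<close>)
  from fun_cong[OF this[of "\<lambda>_. x"], of True] have "dual_act cop h x = 0"
    using E_linear[OF h] by (simp add: operator_eval_letter act_def)
  then have "cou (dual_act cop h x) = 0" by (simp add: clinear_0[OF cou_linear])
  then show "h x = 0 x" by (simp add: cou_dual_act E_linear h)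
qed

end

section \<open>Graded bialgebras\<close>

locale graded_bialg =
  fixes G :: "bit \<Rightarrow> 'c::complex_algebra_1 set" and cop :: "'c \<Rightarrow> ('c, 'c) tensor" and cou :: "'c \<Rightarrow> complex"
  assumes bialgebra: "graded_bialgebra G cop cou"
begin

lemma graded: "graded_algebra G" and coalg: "coalgebra cop cou"
  and cop_grade: "x \<in> G k \<Longrightarrow> cop x \<in> tensor_grade G k"
  and cou_odd: "x \<in> G 1 \<Longrightarrow> cou x = 0"
  and cop_one: "cop 1 = 1 \<otimes> 1"
  and cop_mult: "cop (x * y) = graded_tensor_mult G (cop x) (cop y)"
  and cou_one: "cou 1 = 1" and cou_mult: "cou (x * y) = cou x * cou y"
  using bialgebra by (auto simp: graded_bialgebra_def)

lemmas cop_linear = coalgebraD(1)[OF coalg]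
lemmas cou_linear = coalgebraD(2)[OF coalg]

abbreviation part :: "bit \<Rightarrow> 'c \<Rightarrow> 'c" where "part \<equiv> hom_part G"

lemmas part_linear = hom_part_linear[OF graded]
lemmas part_homogeneous = hom_part_homogeneous[OF graded]

lemma grade_subspace: "cvs.subspace (G i)"
  and grade_mult: "x \<in> G i \<Longrightarrow> y \<in> G j \<Longrightarrow> x * y \<in> G (i + j)"
  and grade_one: "1 \<in> G 0"
  using graded by (auto simp: graded_algebra_def)

lemma part_in: "part i x \<in> G i" by (rule hom_part_props[OF graded])

lemma part_sum: "part 0 x + part 1 x = x"
proof -
  have "x - part 0 x \<in> G 1" using hom_part_props(2)[OF graded, of x 0] by simp
  then have "part 1 (x - part 0 x) = x - part 0 x" by (simp add: part_homogeneous)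
  moreover have "part 1 (part 0 x) = 0" using part_homogeneous[OF part_in, of 1 0 x] by simp
  ultimately show ?thesis by (simp add: clinear_diff[OF part_linear])
qed

lemma homogeneous_induct [case_names homogeneous add]:
  assumes "\<And>i x. x \<in> G i \<Longrightarrow> P x" "\<And>x y. P x \<Longrightarrow> P y \<Longrightarrow> P (x + y)"
  shows "P x"
  using assms(2)[OF assms(1)[OF part_in[of 0 x]] assms(1)[OF part_in[of 1 x]]] by (simp add: part_sum)

lemma homogeneous_tensor_induct [case_names pure add]:
  assumes pure: "\<And>a b i j. a \<in> G i \<Longrightarrow> b \<in> G j \<Longrightarrow> P (a \<otimes> b)"
    and add: "\<And>s u. P s \<Longrightarrow> P u \<Longrightarrow> P (s + u)"
  shows "P s"
proof (induction s rule: tensor_induct)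
  case (pure a b)
  have "P (x \<otimes> b)" if x: "x \<in> G i" for x i
    by (induction b rule: homogeneous_induct) (use assms x in \<open>auto simp: tensor_add_right\<close>)
  then show ?case
    by (induction a rule: homogeneous_induct) (use add in \<open>auto simp: tensor_add_left\<close>)
qed (rule add)

lemma tensor_grade_induct [consumes 1, case_names pure add zero]:
  assumes s: "s \<in> tensor_grade G k"
    and pure: "\<And>a b i j. a \<in> G i \<Longrightarrow> b \<in> G j \<Longrightarrow> i + j = k \<Longrightarrow> P (a \<otimes> b)"
    and add: "\<And>s u. P s \<Longrightarrow> P u \<Longrightarrow> P (s + u)" and zero: "P 0"
  shows "P s"
  using s unfolding tensor_grade_def
proof (induction rule: cvs.span_induct_alt)
  case (step c x y)
  then obtain a b i j where ab: "x = a \<otimes> b" "a \<in> G i" "b \<in> G j" "i + j = k" by blast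
  have "P ((c *\<^sub>C a) \<otimes> b)" by (rule pure[OF cvs.subspace_scale[OF grade_subspace ab(2)] ab(3,4)])
  then show ?case using step add by (simp add: ab(1) tensor_scale_left)
qed (rule zero)

subsection \<open>The parity automorphism\<close>

text \<open>The parity automorphism raised to the power \<open>i\<close>. It records the sign for
  moving an element of degree \<open>i\<close> past an element that need not be homogeneous.\<close>

definition twist :: "bit \<Rightarrow> 'c \<Rightarrow> 'c" where
  "twist i x = (if i = 0 then x else part 0 x - part 1 x)"

lemma twist_linear: "clinear (twist i)"
  by (cases i) (simp_all add: twist_def[abs_def] clinear_ident clinear_diff_fun part_linear)

lemma twist_homogeneous: "x \<in> G j \<Longrightarrow> twist i x = koszul i j *\<^sub>C x"
  by (cases i; cases j) (simp_all add: twist_def koszul_def scaleC_one part_homogeneous)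

lemma twist_zero: "twist 0 x = x" by (simp add: twist_def)

lemma twist_twist: "twist i (twist i x) = x"
proof (induction x rule: homogeneous_induct)
  case (homogeneous j x)
  then show ?case
    by (simp add: twist_homogeneous clinear_scale[OF twist_linear] scaleC_scaleC)
      (simp add: koszul_def scaleC_one)
qed (simp add: clinear_add[OF twist_linear])

lemma koszul_add: "koszul i (j + k) = koszul i j * koszul i k" "koszul (j + k) i = koszul j i * koszul k i"
  by (cases i; cases j; cases k; simp add: koszul_def)+

lemma koszul_square: "koszul i j * koszul i j = 1" and koszul_commute: "koszul i j = koszul j i"
  by (auto simp: koszul_def)

lemma twist_mult: "twist i (x * y) = twist i x * twist i y"
proof (induction x rule: homogeneous_induct)
  case (homogeneous j x)
  then show ?case
  proof (induction y rule: homogeneous_induct)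
    case (homogeneous k y)
    then show ?case
      by (cases i; cases j; cases k) (simp_all add: twist_homogeneous[OF grade_mult] twist_homogeneous
          koszul_def scaleC_mult_left scaleC_mult_right scaleC_scaleC scaleC_one)
  qed (simp add: clinear_add[OF twist_linear] algebra_simps)
qed (simp add: clinear_add[OF twist_linear] algebra_simps)

lemma twist_one: "twist i 1 = 1"
  by (simp add: twist_homogeneous[OF grade_one] koszul_def scaleC_one)

lemma cou_twist: "cou (twist i x) = cou x"
proof (induction x rule: homogeneous_induct)
  case (homogeneous j x)
  then show ?case
    by (cases j) (simp_all add: twist_homogeneous clinear_scale[OF cou_linear] koszul_def scaleC_one cou_odd
        clinear_0[OF cou_linear])
qed (simp add: clinear_add[OF twist_linear] clinear_add[OF cou_linear])

lemma cop_twist: "cop (twist i x) = tensor_map (twist i) (twist i) (cop x)"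
proof (induction x rule: homogeneous_induct)
  note T = tensor_map_linear[OF twist_linear twist_linear]
  case (homogeneous j x)
  have "tensor_map (twist i) (twist i) s = koszul i j *\<^sub>C s" if "s \<in> tensor_grade G j" for s
    using that
  proof (induction rule: tensor_grade_induct)
    case (pure a b k l)
    then have "koszul i k * koszul i l = koszul i j" using koszul_add(1)[of i k l] by simp
    then have "koszul i l * koszul i k = koszul i j" by (simp only: mult.commute)
    then show ?case
      using pure by (simp add: tensor_map_pure twist_linear twist_homogeneous tensor_scale_left
        tensor_scale_right scaleC_scaleC)
  qed (simp_all add: clinear_add[OF T] scaleC_add_right clinear_0[OF T])
  then show ?case
    using homogeneous by (simp add: cop_grade twist_homogeneous clinear_scale[OF cop_linear])
qed (simp add: clinear_add[OF twist_linear] clinear_add[OF cop_linear]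
    clinear_add[OF tensor_map_linear[OF twist_linear twist_linear]])

text \<open>The homogeneous components are the eigenspaces of the parity automorphism: the component
  of the wrong degree equals its own negative, and 2 is invertible.\<close>

lemma grade_iff_twist: "x \<in> G i \<longleftrightarrow> twist 1 x = koszul 1 i *\<^sub>C x"
proof
  assume "twist 1 x = koszul 1 i *\<^sub>C x"
  then have "part 0 x - part 1 x = koszul 1 i *\<^sub>C (part 0 x + part 1 x)"
    by (simp add: twist_def part_sum)
  then have "part 0 x + part 1 x = part i x"
  proof (cases i)
    case zero
    then have "part 1 x + part 1 x = 0"
      using \<open>part 0 x - part 1 x = koszul 1 i *\<^sub>C (part 0 x + part 1 x)\<close>
      by (simp add: koszul_def scaleC_one algebra_simps)
    then have "(2::complex) *\<^sub>C part 1 x = 0"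
      by (simp add: scaleC_add_left[of 1 1, unfolded one_add_one] scaleC_one)
    then show ?thesis using zero by simp
  next
    case one
    then have "part 0 x + part 0 x = 0"
      using \<open>part 0 x - part 1 x = koszul 1 i *\<^sub>C (part 0 x + part 1 x)\<close>
      by (simp add: koszul_def scaleC_one algebra_simps)
    then have "(2::complex) *\<^sub>C part 0 x = 0"
      by (simp add: scaleC_add_left[of 1 1, unfolded one_add_one] scaleC_one)
    then show ?thesis using one by simp
  qed
  then show "x \<in> G i" using part_in[of i x] by (simp add: part_sum)
qed (rule twist_homogeneous)

subsection \<open>Graded products\<close>

abbreviation gmult :: "('c, 'c) tensor \<Rightarrow> ('c, 'c) tensor \<Rightarrow> ('c, 'c) tensor" where
  "gmult \<equiv> graded_tensor_mult G"

lemma gmult_bilinear: "cbilinear gmult"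
proof -
  have m: "cbilinear (\<lambda>a b. a * part l b)" "cbilinear (\<lambda>a b. part k a * b)" for k l
    using cbilinear_comp[OF cbilinear_mult clinear_ident(1) part_linear]
      cbilinear_comp[OF cbilinear_mult part_linear clinear_ident(1)] by simp_all
  note B = tensor_mult_bilinear[OF m]
  show ?thesis
    unfolding graded_tensor_mult_def
    by (intro cbilinearI clinear_sum_fun clinear_scale_fun cbilinearD[OF B])
qed

text \<open>Only the second leg of the left factor needs a degree, because \<open>twist\<close>
  absorbs the sign for an arbitrary \<open>c\<close>.\<close>

lemma gmult_left: "b \<in> G i \<Longrightarrow> gmult (a \<otimes> b) (c \<otimes> d) = (a * twist i c) \<otimes> (b * d)"
proof (induction c rule: homogeneous_induct)
  case (homogeneous j c)
  then show ?case
    by (simp add: graded_tensor_mult_homogeneous[OF graded] twist_homogeneous scaleC_mult_right tensor_scale_left)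
qed (simp add: clinear_add[OF twist_linear] tensor_add_left distrib_left
    clinear_add[OF cbilinearD(1)[OF gmult_bilinear]])

lemma gmult_right_even: "c \<in> G 0 \<Longrightarrow> gmult (a \<otimes> b) (c \<otimes> d) = (a * c) \<otimes> (b * d)"
proof (induction b rule: homogeneous_induct)
  case (homogeneous j b)
  then show ?case by (simp add: graded_tensor_mult_homogeneous[OF graded] koszul_def scaleC_one)
qed (simp add: tensor_add_right distrib_right clinear_add[OF cbilinearD(2)[OF gmult_bilinear]])

text \<open>The graded opposite product. A graded antihomomorphism becomes an ordinary homomorphism
  into it, so later arguments need no distinction of degrees.\<close>

definition gop :: "'c \<Rightarrow> 'c \<Rightarrow> 'c" where
  "gop a b = (\<Sum>i\<in>{0, 1}. \<Sum>j\<in>{0, 1}. koszul i j *\<^sub>C (part j b * part i a))"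

lemma gop_bilinear: "cbilinear gop"
proof -
  have "cbilinear (\<lambda>a b. part j b * part i a)" for i j
    using cbilinear_swap[OF cbilinear_comp[OF cbilinear_mult part_linear part_linear]] .
  note B = cbilinearD[OF this]
  show ?thesis
    unfolding gop_def by (intro cbilinearI clinear_sum_fun clinear_scale_fun B)
qed

lemma gop_homogeneous: "a \<in> G i \<Longrightarrow> b \<in> G j \<Longrightarrow> gop a b = koszul i j *\<^sub>C (b * a)"
  unfolding gop_def by (cases i; cases j) (simp_all add: part_homogeneous)

lemma gop_left: "a \<in> G i \<Longrightarrow> gop a b = twist i b * a"
proof (induction b rule: homogeneous_induct)
  case (homogeneous j b)
  then show ?case by (simp add: gop_homogeneous twist_homogeneous scaleC_mult_left)
qed (simp add: clinear_add[OF cbilinearD(1)[OF gop_bilinear]] clinear_add[OF twist_linear] distrib_right)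

lemma gop_even: "a \<in> G 0 \<Longrightarrow> gop a b = b * a"
  by (simp add: gop_left twist_zero)

lemma gop_assoc: "gop (gop a b) c = gop a (gop b c)"
proof -
  note l = clinear_add[OF cbilinearD(1)[OF gop_bilinear]] clinear_add[OF cbilinearD(2)[OF gop_bilinear]]
    clinear_scale[OF cbilinearD(1)[OF gop_bilinear]] clinear_scale[OF cbilinearD(2)[OF gop_bilinear]]
    clinear_neg[OF cbilinearD(1)[OF gop_bilinear]] clinear_neg[OF cbilinearD(2)[OF gop_bilinear]]
  have 1: "gop (gop a b) c = gop a (gop b c)" if "a \<in> G i" "b \<in> G j" "c \<in> G k" for a b c i j k
    using that
    by (cases i; cases j; cases k)
      (simp_all add: gop_homogeneous l gop_homogeneous[OF grade_mult] gop_homogeneous[OF _ grade_mult]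
        koszul_def scaleC_scaleC scaleC_one mult.assoc)
  have 2: "gop (gop a b) c = gop a (gop b c)" if "a \<in> G i" "b \<in> G j" for a b i j
    by (induction c rule: homogeneous_induct) (use that 1 in \<open>auto simp: l\<close>)
  have 3: "gop (gop a b) c = gop a (gop b c)" if "a \<in> G i" for a i
    by (induction b rule: homogeneous_induct) (use that 2 in \<open>auto simp: l\<close>)
  show ?thesis
    by (induction a rule: homogeneous_induct) (use 3 in \<open>auto simp: l\<close>)
qed

lemma gop_one: "gop 1 x = x" "gop x 1 = x"
proof -
  show "gop 1 x = x" by (simp add: gop_even grade_one)
  show "gop x 1 = x"
    by (induction x rule: homogeneous_induct)
      (simp_all add: gop_left twist_one clinear_add[OF cbilinearD(2)[OF gop_bilinear]])
qed

lemma twist_gop: "twist k (gop a b) = gop (twist k a) (twist k b)"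
proof -
  note l = clinear_add[OF cbilinearD(1)[OF gop_bilinear]] clinear_add[OF cbilinearD(2)[OF gop_bilinear]]
    clinear_scale[OF cbilinearD(1)[OF gop_bilinear]] clinear_scale[OF cbilinearD(2)[OF gop_bilinear]]
    clinear_neg[OF cbilinearD(1)[OF gop_bilinear]] clinear_neg[OF cbilinearD(2)[OF gop_bilinear]]
    clinear_add[OF twist_linear] clinear_scale[OF twist_linear] clinear_neg[OF twist_linear]
  have 1: "twist k (gop a b) = gop (twist k a) (twist k b)" if "a \<in> G i" "b \<in> G j" for a b i j
    using that
    by (cases i; cases j; cases k)
      (simp_all add: gop_homogeneous l twist_homogeneous twist_homogeneous[OF grade_mult] koszul_def
        scaleC_scaleC scaleC_one)
  have 2: "twist k (gop a b) = gop (twist k a) (twist k b)" if "a \<in> G i" for a i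
    by (induction b rule: homogeneous_induct) (use that 1 in \<open>auto simp: l\<close>)
  show ?thesis
    by (induction a rule: homogeneous_induct) (use 2 in \<open>auto simp: l\<close>)
qed

text \<open>The convolution inverse of the identity is unique, hence invariant under the parity automorphism.\<close>

lemma convolution_inverse_even:
  assumes CA: "convolution_algebra cop cou m 1"
    and tw: "\<And>a b. twist 1 (m a b) = m (twist 1 a) (twist 1 b)"
    and S: "clinear S" "\<And>x. convolve cop m S (\<lambda>x. x) x = cou x *\<^sub>C 1"
      "\<And>x. convolve cop m (\<lambda>x. x) S x = cou x *\<^sub>C 1"
  shows "S (twist i x) = twist i (S x)" "x \<in> G i \<Longrightarrow> S x \<in> G i"
proof -
  interpret CA: convolution_algebra cop cou m 1 by (rule CA)
  note m = CA.m_bilinear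
  define S' where "S' x = twist 1 (S (twist 1 x))" for x
  have S': "clinear S'"
    unfolding S'_def[abs_def] by (rule clinear_comp[OF twist_linear clinear_comp[OF S(1) twist_linear]])
  have "convolve cop m S' (\<lambda>x. x) x = cou x *\<^sub>C 1" for x
  proof -
    have B: "cbilinear (\<lambda>a b. m (S a) b)" by (rule cbilinear_comp[OF m S(1) clinear_ident(1)])
    have B': "cbilinear (\<lambda>a b. m (S (twist 1 a)) (twist 1 b))"
      by (rule cbilinear_comp[OF m clinear_comp[OF S(1) twist_linear] twist_linear])
    have "convolve cop m S' (\<lambda>x. x) x = tensor_lift (\<lambda>a b. twist 1 (m (S (twist 1 a)) (twist 1 b))) (cop x)"
      by (simp add: convolve_def S'_def tw twist_twist)
    also have "\<dots> = twist 1 (tensor_lift (\<lambda>a b. m (S (twist 1 a)) (twist 1 b)) (cop x))"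
      by (rule tensor_lift_comp[OF twist_linear B', symmetric])
    also have "tensor_lift (\<lambda>a b. m (S (twist 1 a)) (twist 1 b)) (cop x) = convolve cop m S (\<lambda>x. x) (twist 1 x)"
      by (simp add: convolve_def cop_twist tensor_lift_map[OF twist_linear twist_linear B])
    finally show ?thesis by (simp add: S(2) cou_twist clinear_scale[OF twist_linear] twist_one)
  qed
  then have "S' = S"
    using CA.star_inverse_unique[OF S' clinear_ident(1) S(1)] S(3) by blast
  then have 1: "S (twist 1 x) = twist 1 (S x)" for x
    unfolding S'_def by (metis twist_twist)
  show "S (twist i x) = twist i (S x)" using 1 by (cases i) (simp_all add: twist_zero)
  show "S x \<in> G i" if "x \<in> G i"
    using that 1[of x] by (simp add: grade_iff_twist[symmetric] twist_homogeneous clinear_scale[OF S(1)])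
      (simp add: grade_iff_twist)
qed

end

section \<open>The antipode of the quantum Cartan algebra\<close>

lemma clinear_sum_list: "clinear h \<Longrightarrow> h (sum_list (map g xs)) = sum_list (map (\<lambda>x. h (g x)) xs)"
  by (induction xs) (simp_all add: clinear_0 clinear_add)

lemma sum_sum_list_swap:
  "(\<Sum>k\<in>K. sum_list (map (g k) xs)) = sum_list (map (\<lambda>x. \<Sum>k\<in>K. g k x) xs)"
  for g :: "_ \<Rightarrow> _ \<Rightarrow> 'b::comm_monoid_add"
  by (induction xs) (simp_all add: sum.distrib)

lemma sum_list_map_concat_pairs:
  "sum_list (map H (concat (map (\<lambda>p. map (g p) qs) ps))) =
    sum_list (map (\<lambda>p. sum_list (map (\<lambda>q. H (g p q)) qs)) ps)"
  for H :: "_ \<Rightarrow> 'b::comm_monoid_add"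
  by (induction ps) (simp_all add: comp_def)

locale quantum_cartan_bialgebra =
  quantum_cartan cop cou S lm rm d lco rco N \<omega> f J X t \<gamma> +
  C: graded_bialg "cartan_grading cop cou N X f \<gamma>" copC couC
  for cop :: "'a::complex_algebra_1 \<Rightarrow> ('a, 'a) tensor" and cou S
    and lm :: "'a \<Rightarrow> 'g::complex_vector \<Rightarrow> 'g" and rm d lco rco N \<omega> f J X t
    and \<gamma> :: "('a \<Rightarrow> complex) cartan_gen \<Rightarrow> 'c::complex_algebra_1"
    and copC :: "'c \<Rightarrow> ('c, 'c) tensor" and couC :: "'c \<Rightarrow> complex" +
  assumes copC_X: "\<And>i. i \<in> {1..N} \<Longrightarrow> copC (\<gamma> (Even (X i))) =
      1 \<otimes> \<gamma> (Even (X i)) + (\<Sum>j=1..N. \<gamma> (Even (X j)) \<otimes> \<gamma> (Even (f j i)))"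
    and copC_f: "\<And>i j. i \<in> {1..N} \<Longrightarrow> j \<in> {1..N} \<Longrightarrow> copC (\<gamma> (Even (f i j))) =
      (\<Sum>k=1..N. \<gamma> (Even (f i k)) \<otimes> \<gamma> (Even (f k j)))"
    and copC_xi: "\<And>i. i \<in> {1..N} \<Longrightarrow> copC (\<gamma> (Xi i)) =
      1 \<otimes> \<gamma> (Xi i) + (\<Sum>j=1..N. \<gamma> (Xi j) \<otimes> \<gamma> (Even (f j i)))"
    and copC_delta: "copC (\<gamma> Delta) = 1 \<otimes> \<gamma> Delta + \<gamma> Delta \<otimes> 1"
    and couC_X: "\<And>i. i \<in> {1..N} \<Longrightarrow> couC (\<gamma> (Even (X i))) = 0"
    and couC_f: "\<And>i j. i \<in> {1..N} \<Longrightarrow> j \<in> {1..N} \<Longrightarrow>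
      couC (\<gamma> (Even (f i j))) = (if i = j then 1 else 0)"
    and couC_xi: "\<And>i. i \<in> {1..N} \<Longrightarrow> couC (\<gamma> (Xi i)) = 0"
    and couC_delta: "couC (\<gamma> Delta) = 0"
begin

abbreviation G :: "bit \<Rightarrow> 'c set" where "G \<equiv> cartan_grading cop cou N X f \<gamma>"
abbreviation ev :: "('a \<Rightarrow> complex) \<Rightarrow> 'c" where "ev h \<equiv> \<gamma> (Even h)"

lemma gen_grade: "x \<in> gens \<Longrightarrow> \<gamma> x \<in> G (gen_parity x)"
  unfolding cartan_grading_def
  by (intro image_eqI[where x = "letter x"])
    (simp_all add: free_eval_letter free_algebra_on_letter, simp add: letter_def)

lemma ev_grade: "h \<in> \<E> \<Longrightarrow> ev h \<in> G 0"
  and xi_grade: "i \<in> {1..N} \<Longrightarrow> \<gamma> (Xi i) \<in> G 1"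
  and delta_grade: "\<gamma> Delta \<in> G 1"
  using gen_grade gens_intro gen_parity.simps by metis+

lemma ev_zero: "ev 0 = 0"
  using gamma_scale[OF E_zero, of 0] by simp

lemma ev_sum: "(\<And>i. i \<in> I \<Longrightarrow> g i \<in> \<E>) \<Longrightarrow> ev (\<Sum>i\<in>I. g i) = (\<Sum>i\<in>I. ev (g i))"
  by (induction I rule: infinite_finite_induct) (simp_all add: ev_zero gamma_add E_sum)

lemma algebra_generated_words:
  obtains p where "p \<in> free_algebra_on gens" "x = free_eval \<gamma> p"
  using presentation unfolding presented_algebra_def by blast

text \<open>Words are built by left multiplication, and an even letter is a polynomial in the
  \<open>X i\<close> and \<open>f i j\<close> by the inductive definition of \<E>, so no case for a
  general element of \<E> is required.\<close>

lemma generator_induct [case_names one add scale f X xi delta]: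
  assumes one: "P 1" and add: "\<And>x y. P x \<Longrightarrow> P y \<Longrightarrow> P (x + y)"
    and scale: "\<And>c x. P x \<Longrightarrow> P (c *\<^sub>C x)"
    and f: "\<And>i j x. i \<in> {1..N} \<Longrightarrow> j \<in> {1..N} \<Longrightarrow> P x \<Longrightarrow> P (ev (f i j) * x)"
    and X: "\<And>i x. i \<in> {1..N} \<Longrightarrow> P x \<Longrightarrow> P (ev (X i) * x)"
    and xi: "\<And>i x. i \<in> {1..N} \<Longrightarrow> P x \<Longrightarrow> P (\<gamma> (Xi i) * x)"
    and delta: "\<And>x. P x \<Longrightarrow> P (\<gamma> Delta * x)"
  shows "P x"
proof -
  have ev: "P x \<Longrightarrow> P (ev h * x)" if "h \<in> \<E>" for h x
    using that
  proof (induction arbitrary: x rule: calc_subalgebra.induct)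
    case (mult g h)
    then show ?case by (simp add: gamma_conv mult.assoc)
  qed (simp_all add: gamma_unit gamma_add gamma_scale f X add scale distrib_right scaleC_mult_left)
  have "P (prod_list (map \<gamma> w))" if "set w \<subseteq> gens" for w
    using that
  proof (induction w)
    case (Cons g w)
    then show ?case by (cases g) (auto simp: cartan_gens_def ev xi delta)
  qed (simp add: one)
  note word = this
  have zero: "P 0" using scale[OF one, of 0] by simp
  obtain p where p: "p \<in> free_algebra_on gens" "x = free_eval \<gamma> p" by (rule algebra_generated_words)
  have "P (\<Sum>w\<in>K. Poly_Mapping.lookup p w *\<^sub>C prod_list (map \<gamma> w))" if "finite K" "K \<subseteq> Poly_Mapping.keys p" for K
    using that
    by (induction K) (use p in \<open>auto intro!: add scale word zero simp: free_algebra_on_def\<close>)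
  then show ?thesis by (simp add: p(2) free_eval_def)
qed

subsection \<open>Filtration by the number of odd generators\<close>

definition odd_letters :: "('a \<Rightarrow> complex) cartan_gen list \<Rightarrow> nat" where
  "odd_letters w = length (filter (\<lambda>x. gen_parity x = 1) w)"

definition F :: "nat \<Rightarrow> 'c set" where
  "F n = cvs.span {prod_list (map \<gamma> w) | w. set w \<subseteq> gens \<and> odd_letters w \<le> n}"

lemma F_subspace: "cvs.subspace (F n)" by (simp add: F_def)

lemma F_mono: "i \<le> j \<Longrightarrow> F i \<subseteq> F j"
  unfolding F_def by (rule cvs.span_mono) auto

lemma F_word: "set w \<subseteq> gens \<Longrightarrow> odd_letters w \<le> n \<Longrightarrow> prod_list (map \<gamma> w) \<in> F n"
  unfolding F_def by (rule cvs.span_base) blast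

lemma F_exhaust: "\<exists>n. x \<in> F n"
proof -
  obtain p where p: "p \<in> free_algebra_on gens" "x = free_eval \<gamma> p" by (rule algebra_generated_words)
  have "x \<in> F (\<Sum>w\<in>Poly_Mapping.keys p. odd_letters w)"
    unfolding p(2) free_eval_def
    by (intro cvs.subspace_sum[OF F_subspace] cvs.subspace_scale[OF F_subspace] F_word member_le_sum)
      (use p(1) in \<open>auto simp: free_algebra_on_def\<close>)
  then show ?thesis ..
qed

lemma F_induct [consumes 1, case_names word add zero]:
  assumes "x \<in> F n" "\<And>c w. set w \<subseteq> gens \<Longrightarrow> odd_letters w \<le> n \<Longrightarrow> P (c *\<^sub>C prod_list (map \<gamma> w))"
    and "\<And>x y. P x \<Longrightarrow> P y \<Longrightarrow> P (x + y)" "P 0"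
  shows "P x"
  using assms(1) unfolding F_def
proof (induction rule: cvs.span_induct_alt)
  case (step c x y)
  then show ?case using assms(2,3) by blast
qed (rule assms(4))

text \<open>A word without odd letters can be multiplied out inside \<E>, since
  \<open>gamma_conv\<close> turns products into convolutions.\<close>

lemma F_zero_ev: "x \<in> F 0 \<Longrightarrow> \<exists>h\<in>\<E>. x = ev h"
proof (induction rule: F_induct)
  case (word c w)
  have "\<exists>h\<in>\<E>. prod_list (map \<gamma> w) = ev h"
    using word
  proof (induction w)
    case Nil
    show ?case by (rule bexI[OF _ calc_subalgebra.unit]) (simp add: gamma_unit)
  next
    case (Cons g w)
    then obtain h where h: "h \<in> \<E>" "prod_list (map \<gamma> w) = ev h"
      by (auto simp: odd_letters_def split: if_splits)
    obtain k where k: "k \<in> \<E>" "g = Even k"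
      using Cons.prems by (cases g) (auto simp: odd_letters_def cartan_gens_def)
    then show ?case
      using h by (intro bexI[of _ "conv cop k h"]) (simp_all add: gamma_conv calc_subalgebra.mult)
  qed
  then show ?case using gamma_scale calc_subalgebra.scale by metis
next
  case (add x y)
  then show ?case using gamma_add calc_subalgebra.add by metis
next
  case zero
  then show ?case using ev_zero E_zero by metis
qed

lemma F_ev: "h \<in> \<E> \<Longrightarrow> ev h \<in> F n"
  using F_word[of "[Even h]" n] by (simp add: odd_letters_def gens_intro)

lemma F_mult: "x \<in> F i \<Longrightarrow> y \<in> F j \<Longrightarrow> x * y \<in> F (i + j)"
proof (induction rule: F_induct)
  case (word c w)
  note w = word(1,2)
  have y: "y \<in> F j" by fact
  show ?case
    using y
  proof (induction rule: F_induct)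
    case (word e v)
    have "prod_list (map \<gamma> (w @ v)) \<in> F (i + j)"
      using w word by (intro F_word) (auto simp: odd_letters_def)
    then show ?case
      by (simp add: scaleC_mult_left scaleC_mult_right cvs.subspace_scale[OF F_subspace])
  qed (simp_all add: distrib_left cvs.subspace_add[OF F_subspace] cvs.subspace_0[OF F_subspace])
qed (simp_all add: distrib_right cvs.subspace_add[OF F_subspace] cvs.subspace_0[OF F_subspace])

lemma word_grade: "set w \<subseteq> gens \<Longrightarrow> prod_list (map \<gamma> w) \<in> G (sum_list (map gen_parity w))"
  by (induction w) (simp_all add: C.grade_one C.grade_mult gen_grade del: add_bit_eq_xor)

text \<open>Words are homogeneous, so taking a homogeneous part keeps or deletes each word and
  cannot raise the level.\<close>

lemma F_part: "x \<in> F n \<Longrightarrow> C.part i x \<in> F n"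
proof (induction rule: F_induct)
  case (word c w)
  then show ?case
    by (auto simp: clinear_scale[OF C.part_linear] C.part_homogeneous[OF word_grade]
        cvs.subspace_scale[OF F_subspace] F_word cvs.subspace_0[OF F_subspace])
qed (simp_all add: clinear_add[OF C.part_linear] clinear_0[OF C.part_linear]
    cvs.subspace_add[OF F_subspace] cvs.subspace_0[OF F_subspace])

lemma F_twist: "x \<in> F n \<Longrightarrow> C.twist i x \<in> F n"
  by (simp add: C.twist_def F_part cvs.subspace_diff[OF F_subspace])

definition TF :: "nat \<Rightarrow> ('c, 'c) tensor set" where
  "TF n = cvs.span {a \<otimes> b | a b. \<exists>i j. a \<in> F i \<and> b \<in> F j \<and> i + j \<le> n}"

lemma TF_subspace: "cvs.subspace (TF n)" by (simp add: TF_def)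

lemma TF_pure: "a \<in> F i \<Longrightarrow> b \<in> F j \<Longrightarrow> i + j \<le> n \<Longrightarrow> a \<otimes> b \<in> TF n"
  unfolding TF_def by (rule cvs.span_base) blast

lemma TF_induct [consumes 1, case_names pure add zero]:
  assumes "s \<in> TF n" "\<And>a b i j. a \<in> F i \<Longrightarrow> b \<in> F j \<Longrightarrow> i + j \<le> n \<Longrightarrow> P (a \<otimes> b)"
    and "\<And>s u. P s \<Longrightarrow> P u \<Longrightarrow> P (s + u)" "P 0"
  shows "P s"
  using assms(1) unfolding TF_def
proof (induction rule: cvs.span_induct_alt)
  case (step c x y)
  then obtain a b i j where ab: "x = a \<otimes> b" "a \<in> F i" "b \<in> F j" "i + j \<le> n" by blast
  have "P ((c *\<^sub>C a) \<otimes> b)" by (rule assms(2)[OF cvs.subspace_scale[OF F_subspace ab(2)] ab(3,4)])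
  then show ?case using step assms(3) by (simp add: ab(1) tensor_scale_left)
qed (rule assms(4))

lemma gmult_expand:
  "C.gmult (a \<otimes> b) (c \<otimes> e) = (a * C.twist 0 c) \<otimes> (C.part 0 b * e) + (a * C.twist 1 c) \<otimes> (C.part 1 b * e)"
proof -
  have "a \<otimes> b = a \<otimes> C.part 0 b + a \<otimes> C.part 1 b"
    by (simp add: tensor_add_right[symmetric] C.part_sum)
  then show ?thesis
    by (simp add: clinear_add[OF cbilinearD(2)[OF C.gmult_bilinear]] C.gmult_left[OF C.part_in])
qed

text \<open>The signs of the graded product are expressed through \<open>twist\<close> and
  homogeneous parts, none of which raises the filtration level.\<close>

lemma TF_gmult: "s \<in> TF n \<Longrightarrow> u \<in> TF m \<Longrightarrow> C.gmult s u \<in> TF (n + m)"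
proof (induction rule: TF_induct)
  case (pure a b i j)
  have u: "u \<in> TF m" by fact
  show ?case
    using u
  proof (induction rule: TF_induct)
    case (pure c e k l)
    have "(a * C.twist q c) \<otimes> (C.part q b * e) \<in> TF (n + m)" for q
    proof (rule TF_pure)
      show "a * C.twist q c \<in> F (i + k)" "C.part q b * e \<in> F (j + l)"
        using pure \<open>a \<in> F i\<close> \<open>b \<in> F j\<close> by (auto intro!: F_mult F_twist F_part)
      show "(i + k) + (j + l) \<le> n + m" using pure \<open>i + j \<le> n\<close> by simp
    qed
    then show ?case by (simp add: gmult_expand cvs.subspace_add[OF TF_subspace])
  qed (simp_all add: clinear_add[OF cbilinearD(1)[OF C.gmult_bilinear]]
      clinear_0[OF cbilinearD(1)[OF C.gmult_bilinear]] cvs.subspace_add[OF TF_subspace] cvs.subspace_0[OF TF_subspace])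
qed (simp_all add: clinear_add[OF cbilinearD(2)[OF C.gmult_bilinear]]
      clinear_0[OF cbilinearD(2)[OF C.gmult_bilinear]] cvs.subspace_add[OF TF_subspace] cvs.subspace_0[OF TF_subspace])

subsection \<open>The coproduct on the even part\<close>

text \<open>The same pairs split \<open>h (x * y)\<close> and the coproduct of \<open>ev h\<close>.
  This ties the coproduct, prescribed on generators only, to the multiplication of A, which is where
  the antipode identities of A can be used. Lists make the decomposition of a convolution a
  concatenation.\<close>

lemma ev_decomposition_list:
  "h \<in> \<E> \<Longrightarrow> \<exists>ps. (\<forall>p\<in>set ps. fst p \<in> \<E> \<and> snd p \<in> \<E>) \<and>
    (\<forall>x y. h (x * y) = sum_list (map (\<lambda>p. fst p x * snd p y) ps)) \<and>
    copC (ev h) = sum_list (map (\<lambda>p. ev (fst p) \<otimes> ev (snd p)) ps)"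
proof (induction rule: calc_subalgebra.induct)
  case unit
  show ?case
    by (rule exI[of _ "[(cou, cou)]"])
      (simp add: calc_subalgebra.unit cou_mult gamma_unit C.cop_one)
next
  case (gen_X i)
  let ?ps = "(cou, X i) # map (\<lambda>j. (X j, f j i)) [1..<Suc N]"
  show ?case
  proof (intro exI[of _ ?ps] conjI ballI allI)
    fix p assume "p \<in> set ?ps"
    then show "fst p \<in> \<E>" "snd p \<in> \<E>"
      using gen_X by (auto intro!: calc_subalgebra.intros)
  next
    fix x y show "X i (x * y) = sum_list (map (\<lambda>p. fst p x * snd p y) ?ps)"
      using gen_X by (simp add: X_mult comp_def interv_sum_list_conv_sum_set_nat atLeastLessThanSuc_atLeastAtMost del: upt_Suc)
  next
    show "copC (ev (X i)) = sum_list (map (\<lambda>p. ev (fst p) \<otimes> ev (snd p)) ?ps)"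
      using gen_X by (simp add: copC_X comp_def gamma_unit interv_sum_list_conv_sum_set_nat atLeastLessThanSuc_atLeastAtMost del: upt_Suc)
  qed
next
  case (gen_f i j)
  let ?ps = "map (\<lambda>k. (f i k, f k j)) [1..<Suc N]"
  show ?case
  proof (intro exI[of _ ?ps] conjI ballI allI)
    fix p assume "p \<in> set ?ps"
    then show "fst p \<in> \<E>" "snd p \<in> \<E>"
      using gen_f by (auto intro!: calc_subalgebra.intros)
  next
    fix x y show "f i j (x * y) = sum_list (map (\<lambda>p. fst p x * snd p y) ?ps)"
      using gen_f by (simp add: f_mult comp_def interv_sum_list_conv_sum_set_nat atLeastLessThanSuc_atLeastAtMost del: upt_Suc)
  next
    show "copC (ev (f i j)) = sum_list (map (\<lambda>p. ev (fst p) \<otimes> ev (snd p)) ?ps)"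
      using gen_f by (simp add: copC_f comp_def interv_sum_list_conv_sum_set_nat atLeastLessThanSuc_atLeastAtMost del: upt_Suc)
  qed
next
  case (add g h)
  then obtain ps qs where
    "\<forall>p\<in>set ps. fst p \<in> \<E> \<and> snd p \<in> \<E>" "\<forall>x y. g (x * y) = sum_list (map (\<lambda>p. fst p x * snd p y) ps)"
    "copC (ev g) = sum_list (map (\<lambda>p. ev (fst p) \<otimes> ev (snd p)) ps)"
    "\<forall>p\<in>set qs. fst p \<in> \<E> \<and> snd p \<in> \<E>" "\<forall>x y. h (x * y) = sum_list (map (\<lambda>p. fst p x * snd p y) qs)"
    "copC (ev h) = sum_list (map (\<lambda>p. ev (fst p) \<otimes> ev (snd p)) qs)" by blast
  note pq = this
  have "copC (ev (g + h)) = copC (ev g) + copC (ev h)"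
    by (simp only: gamma_add[OF add.hyps] clinear_add[OF C.cop_linear])
  also have "\<dots> = sum_list (map (\<lambda>p. ev (fst p) \<otimes> ev (snd p)) (ps @ qs))"
    using pq by simp
  finally have "copC (ev (g + h)) = sum_list (map (\<lambda>p. ev (fst p) \<otimes> ev (snd p)) (ps @ qs))" .
  moreover have "\<forall>p\<in>set (ps @ qs). fst p \<in> \<E> \<and> snd p \<in> \<E>"
    "\<forall>x y. (g + h) (x * y) = sum_list (map (\<lambda>p. fst p x * snd p y) (ps @ qs))"
    using pq by auto
  ultimately show ?case by blast
next
  case (scale g c)
  then obtain ps where ps:
    "\<forall>p\<in>set ps. fst p \<in> \<E> \<and> snd p \<in> \<E>" "\<forall>x y. g (x * y) = sum_list (map (\<lambda>p. fst p x * snd p y) ps)"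
    "copC (ev g) = sum_list (map (\<lambda>p. ev (fst p) \<otimes> ev (snd p)) ps)" by blast
  let ?ps = "map (\<lambda>p. (c *\<^sub>C fst p, snd p)) ps"
  have "ev (c *\<^sub>C fst p) = c *\<^sub>C ev (fst p)" if "p \<in> set ps" for p
    using ps(1) that by (intro gamma_scale) auto
  then have mp: "map (\<lambda>p. ev (c *\<^sub>C fst p) \<otimes> ev (snd p)) ps = map (\<lambda>p. c *\<^sub>C (ev (fst p) \<otimes> ev (snd p))) ps"
    by (simp add: tensor_scale_left)
  have "copC (ev (c *\<^sub>C g)) = sum_list (map (\<lambda>p. ev (fst p) \<otimes> ev (snd p)) ?ps)"
    using scale.hyps ps(3)
    by (simp add: gamma_scale clinear_scale[OF C.cop_linear] comp_def
        clinear_sum_list[OF clinear_scale_fun[OF clinear_ident(1)]]) (simp only: mp)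
  moreover have "(c *\<^sub>C g) (x * y) = sum_list (map (\<lambda>p. fst p x * snd p y) ?ps)" for x y
    using ps(2) by (simp add: scaleC_fun_apply scaleC_complex_def comp_def sum_list_const_mult mult.assoc)
  ultimately show ?case
    using ps(1) by (intro exI[of _ ?ps]) (auto simp: calc_subalgebra.scale)
next
  case (mult g h)
  then obtain ps qs where ps:
    "\<forall>p\<in>set ps. fst p \<in> \<E> \<and> snd p \<in> \<E>" "\<forall>x y. g (x * y) = sum_list (map (\<lambda>p. fst p x * snd p y) ps)"
    "copC (ev g) = sum_list (map (\<lambda>p. ev (fst p) \<otimes> ev (snd p)) ps)" and qs:
    "\<forall>p\<in>set qs. fst p \<in> \<E> \<and> snd p \<in> \<E>" "\<forall>x y. h (x * y) = sum_list (map (\<lambda>p. fst p x * snd p y) qs)"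
    "copC (ev h) = sum_list (map (\<lambda>p. ev (fst p) \<otimes> ev (snd p)) qs)" by blast
  \<comment> \<open>All legs are even, so the graded product introduces no sign and decompositions
    multiply leg by leg, just as those of functionals do.\<close>
  let ?c = "\<lambda>p q. (conv cop (fst p) (fst q), conv cop (snd p) (snd q))"
  let ?ps = "concat (map (\<lambda>p. map (?c p) qs) ps)"
  have E: "fst p \<in> \<E>" "snd p \<in> \<E>" "fst q \<in> \<E>" "snd q \<in> \<E>" if "p \<in> set ps" "q \<in> set qs" for p q
    using that ps(1) qs(1) by auto
  have mem: "fst p \<in> \<E> \<and> snd p \<in> \<E>" if p: "p \<in> set ?ps" for p
  proof -
    have "\<exists>q\<in>set ps. p \<in> set (map (?c q) qs)" using p by simp
    then obtain q where q: "q \<in> set ps" "p \<in> set (map (?c q) qs)" ..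
    then have "p \<in> ?c q ` set qs" by simp
    then obtain r where "r \<in> set qs" "p = ?c q r" by (rule imageE)
    then show ?thesis using E[OF q(1)] by (simp add: calc_subalgebra.mult)
  qed
  have "conv cop g h (x * y) = sum_list (map (\<lambda>p. fst p x * snd p y) ?ps)" for x y
  proof -
    obtain n :: nat and a b where x: "cop x = (\<Sum>k<n. a k \<otimes> b k)" by (rule tensor_finite_sum)
    obtain m :: nat and u v where y: "cop y = (\<Sum>k<m. u k \<otimes> v k)" by (rule tensor_finite_sum)
    note lin = E_linear[OF mult.hyps(1)] E_linear[OF mult.hyps(2)]
    have gh: "cbilinear (\<lambda>a b. g' a * h' b)" if "clinear g'" "clinear h'" for g' h' :: "'a \<Rightarrow> complex"
      by (rule cbilinear_comp[OF cbilinear_mult that])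
    have "cop (x * y) = (\<Sum>k<n. \<Sum>l<m. (a k * u l) \<otimes> (b k * v l))"
      unfolding cop_mult x y
      by (simp add: clinear_sum[OF cbilinearD(1)[OF tensor_mult_alg_bilinear]]
          clinear_sum[OF cbilinearD(2)[OF tensor_mult_alg_bilinear]] tensor_mult_alg_pure)
        (rule sum.swap)
    then have "conv cop g h (x * y) = (\<Sum>k<n. \<Sum>l<m. g (a k * u l) * h (b k * v l))"
      by (simp add: conv_def clinear_sum[OF tensor_lift_linear[OF gh[OF lin]]] tensor_lift_pure[OF gh[OF lin]])
    also have "\<dots> = (\<Sum>k<n. \<Sum>l<m. sum_list (map (\<lambda>p. sum_list (map (\<lambda>q.
        (fst p (a k) * fst q (b k)) * (snd p (u l) * snd q (v l))) qs)) ps))"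
    proof (intro sum.cong refl)
      fix k l
      have "g (a k * u l) * h (b k * v l) =
        sum_list (map (\<lambda>p. sum_list (map (\<lambda>q. (fst p (a k) * snd p (u l)) * (fst q (b k) * snd q (v l))) qs)) ps)"
        using ps(2) qs(2) by (simp add: sum_list_mult_const[symmetric] sum_list_const_mult[symmetric])
          (simp add: sum_list_sum_nth, rule sum.swap)
      then show "g (a k * u l) * h (b k * v l) = sum_list (map (\<lambda>p. sum_list (map (\<lambda>q.
        (fst p (a k) * fst q (b k)) * (snd p (u l) * snd q (v l))) qs)) ps)"
        by (simp add: ac_simps)
    qed
    also have "\<dots> = sum_list (map (\<lambda>p. sum_list (map (\<lambda>q. \<Sum>k<n. \<Sum>l<m.
        (fst p (a k) * fst q (b k)) * (snd p (u l) * snd q (v l))) qs)) ps)"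
      by (simp only: sum_sum_list_swap)
    also have "\<dots> = sum_list (map (\<lambda>p. sum_list (map (\<lambda>q.
        conv cop (fst p) (fst q) x * conv cop (snd p) (snd q) y) qs)) ps)"
    proof (intro arg_cong[where f = sum_list] map_cong refl)
      fix p q assume pq: "p \<in> set ps" "q \<in> set qs"
      note l = gh[OF E_linear E_linear, OF E(1,3)[OF pq]] gh[OF E_linear E_linear, OF E(2,4)[OF pq]]
      show "(\<Sum>k<n. \<Sum>l<m. (fst p (a k) * fst q (b k)) * (snd p (u l) * snd q (v l))) =
        conv cop (fst p) (fst q) x * conv cop (snd p) (snd q) y"
        by (simp add: conv_def x y tensor_lift_sum_pure[OF l(1)] tensor_lift_sum_pure[OF l(2)] sum_product)
    qed
    finally show ?thesis by (simp add: sum_list_map_concat_pairs)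
  qed
  moreover have "copC (ev (conv cop g h)) = sum_list (map (\<lambda>p. ev (fst p) \<otimes> ev (snd p)) ?ps)"
  proof -
    note B = C.gmult_bilinear
    have "copC (ev (conv cop g h)) = C.gmult (copC (ev g)) (copC (ev h))"
      using mult.hyps by (simp add: gamma_conv C.cop_mult)
    also have "\<dots> = sum_list (map (\<lambda>p. sum_list (map (\<lambda>q.
        C.gmult (ev (fst p) \<otimes> ev (snd p)) (ev (fst q) \<otimes> ev (snd q))) qs)) ps)"
      unfolding ps(3) qs(3)
      by (simp add: clinear_sum_list[OF cbilinearD(1)[OF B]] clinear_sum_list[OF cbilinearD(2)[OF B]])
        (simp add: sum_list_sum_nth, rule sum.swap)
    also have "\<dots> = sum_list (map (\<lambda>p. sum_list (map (\<lambda>q.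
        ev (conv cop (fst p) (fst q)) \<otimes> ev (conv cop (snd p) (snd q))) qs)) ps)"
      using E by (intro arg_cong[where f = sum_list] map_cong refl)
        (simp add: C.gmult_right_even[OF ev_grade] gamma_conv)
    finally show ?thesis by (simp add: sum_list_map_concat_pairs)
  qed
  ultimately show ?case using mem by blast
qed

lemma ev_decomposition:
  assumes "h \<in> \<E>"
  obtains n :: nat and a b where "\<And>k. k < n \<Longrightarrow> a k \<in> \<E>" "\<And>k. k < n \<Longrightarrow> b k \<in> \<E>"
    "\<And>x y. h (x * y) = (\<Sum>k<n. a k x * b k y)" "copC (ev h) = (\<Sum>k<n. ev (a k) \<otimes> ev (b k))"
proof -
  obtain ps where ps: "\<forall>p\<in>set ps. fst p \<in> \<E> \<and> snd p \<in> \<E>"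
    "\<forall>x y. h (x * y) = sum_list (map (\<lambda>p. fst p x * snd p y) ps)"
    "copC (ev h) = sum_list (map (\<lambda>p. ev (fst p) \<otimes> ev (snd p)) ps)"
    using ev_decomposition_list[OF assms] by blast
  show ?thesis
    by (rule that[of "length ps" "\<lambda>k. fst (ps ! k)" "\<lambda>k. snd (ps ! k)"])
      (use ps in \<open>auto simp: sum_list_sum_nth lessThan_atLeast0\<close>)
qed

lemma couC_ev: "h \<in> \<E> \<Longrightarrow> couC (ev h) = h 1"
proof (induction rule: calc_subalgebra.induct)
  case (mult g h)
  have "conv cop g h 1 = g 1 * h 1"
    using mult.hyps
    by (simp add: conv_def cop_one tensor_lift_pure[OF cbilinear_comp[OF cbilinear_mult E_linear E_linear]])
  then show ?case using mult by (simp add: gamma_conv C.cou_mult)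
next
  case (add g h)
  have "couC (ev (g + h)) = couC (ev g) + couC (ev h)"
    by (simp only: gamma_add[OF add.hyps] clinear_add[OF C.cou_linear])
  also have "\<dots> = (g + h) 1" using add.IH by simp
  finally show ?case .
next
  case (scale g c)
  have "couC (ev (c *\<^sub>C g)) = c *\<^sub>C couC (ev g)"
    by (simp only: gamma_scale[OF scale.hyps] clinear_scale[OF C.cou_linear])
  also have "\<dots> = (c *\<^sub>C g) 1" using scale.IH by (simp add: scaleC_fun_apply)
  finally show ?case .
qed (simp_all add: gamma_unit C.cou_one cou_one couC_X X_one couC_f f_one)

lemma TF_copC_ev: "h \<in> \<E> \<Longrightarrow> copC (ev h) \<in> TF n"
proof -
  assume "h \<in> \<E>"
  then obtain m :: nat and a b where "\<And>k. k < m \<Longrightarrow> a k \<in> \<E>" "\<And>k. k < m \<Longrightarrow> b k \<in> \<E>"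
    "\<And>x y. h (x * y) = (\<Sum>k<m. a k x * b k y)" "copC (ev h) = (\<Sum>k<m. ev (a k) \<otimes> ev (b k))" by (rule ev_decomposition) (rule that)
  then show ?thesis
    by (auto intro!: cvs.subspace_sum[OF TF_subspace] TF_pure[of _ 0 _ 0] F_ev)
qed

lemma TF_copC_gen:
  assumes "x \<in> gens"
  shows "copC (\<gamma> x) \<in> TF (odd_letters [x])"
proof (cases x)
  case (Even h)
  then show ?thesis using assms by (auto simp: cartan_gens_def intro!: TF_copC_ev)
next
  case (Xi i)
  have one: "1 \<in> F 0" using F_word[of "[]" 0] by (simp add: odd_letters_def)
  have xi: "\<gamma> (Xi j) \<in> F 1" if "j \<in> {1..N}" for j
    using F_word[of "[Xi j]" 1] that by (simp add: odd_letters_def gens_intro)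
  have sum: "(\<Sum>j=1..N. \<gamma> (Xi j) \<otimes> ev (f j i)) \<in> TF 1" if "i \<in> {1..N}" for i
    using that by (intro cvs.subspace_sum[OF TF_subspace] TF_pure[of _ 1 _ 0] xi F_ev calc_subalgebra.gen_f) auto
  have "odd_letters [x] = 1" by (simp add: Xi odd_letters_def)
  moreover have "i \<in> {1..N}" using assms by (auto simp: Xi cartan_gens_def)
  ultimately show ?thesis
    using TF_pure[OF one xi, of i 1]
    by (auto simp: Xi copC_xi intro!: cvs.subspace_add[OF TF_subspace] sum)
next
  case Delta
  have one: "1 \<in> F 0" using F_word[of "[]" 0] by (simp add: odd_letters_def)
  have "\<gamma> Delta \<in> F 1"
    using F_word[of "[Delta]" 1] by (simp add: odd_letters_def gens_intro)
  moreover have "odd_letters [x] = 1" by (simp add: Delta odd_letters_def)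
  ultimately show ?thesis
    using cvs.subspace_add[OF TF_subspace TF_pure[OF one] TF_pure[OF _ one], of "\<gamma> Delta" 1 1 "\<gamma> Delta" 1]
    by (simp add: Delta copC_delta)
qed

lemma TF_mono: "n \<le> m \<Longrightarrow> TF n \<subseteq> TF m"
  unfolding TF_def by (rule cvs.span_mono) (use order_trans in blast)

text \<open>In every summand of its coproduct an odd generator passes its one odd letter to a single
  leg, and even letters stay at level 0; \<open>TF_gmult\<close> extends this from letters to
  words.\<close>

lemma F_copC: "x \<in> F n \<Longrightarrow> copC x \<in> TF n"
proof (induction rule: F_induct)
  case (word c w)
  have one: "1 \<in> F 0" using F_word[of "[]" 0] by (simp add: odd_letters_def)
  have "copC (prod_list (map \<gamma> w)) \<in> TF (odd_letters w)"
    using word(1)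
  proof (induction w)
    case Nil
    show ?case using TF_pure[OF one one, of 0] by (simp add: C.cop_one odd_letters_def)
  next
    case (Cons x w)
    have "odd_letters (x # w) = odd_letters [x] + odd_letters w" by (simp add: odd_letters_def)
    then show ?case using Cons TF_gmult[OF TF_copC_gen] by (simp add: C.cop_mult)
  qed
  then have "copC (prod_list (map \<gamma> w)) \<in> TF n" using TF_mono[OF word(2)] by blast
  then show ?case by (simp add: clinear_scale[OF C.cop_linear] cvs.subspace_scale[OF TF_subspace])
qed (simp_all add: clinear_add[OF C.cop_linear] clinear_0[OF C.cop_linear]
    cvs.subspace_add[OF TF_subspace] cvs.subspace_0[OF TF_subspace])

end

section \<open>Consequences of a given antipode on a graded bialgebra\<close>

context graded_bialg
begin

lemma antihom_gop:
  assumes "graded_algebra_antihom G T"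
  shows "T (a * b) = gop (T a) (T b)"
proof -
  have T: "clinear T" "\<And>i x. x \<in> G i \<Longrightarrow> T x \<in> G i"
    "\<And>i j a b. a \<in> G i \<Longrightarrow> b \<in> G j \<Longrightarrow> T (a * b) = koszul i j *\<^sub>C (T b * T a)"
    using assms by (auto simp: graded_algebra_antihom_def)
  have 1: "T (a * b) = gop (T a) (T b)" if "a \<in> G i" for a i b
  proof (induction b rule: homogeneous_induct)
    case (homogeneous j b)
    then show ?case using that by (simp add: T(3) gop_homogeneous[OF T(2) T(2)])
  qed (simp add: distrib_left clinear_add[OF T(1)] clinear_add[OF cbilinearD(1)[OF gop_bilinear]])
  show ?thesis
    by (induction a rule: homogeneous_induct)
      (auto simp: 1 distrib_right clinear_add[OF T(1)] clinear_add[OF cbilinearD(2)[OF gop_bilinear]])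
qed

end

locale graded_antipode = graded_bialg +
  fixes SC :: "'a \<Rightarrow> 'a"
  assumes SC: "is_antipode cop cou SC"
begin

lemma SC_linear: "clinear SC"
  and SC_left: "convolve cop (*) SC (\<lambda>x. x) x = cou x *\<^sub>C 1"
  and SC_right: "convolve cop (*) (\<lambda>x. x) SC x = cou x *\<^sub>C 1"
  using SC by (auto simp: is_antipode_def convolve_def)

sublocale CA: convolution_algebra cop cou "(*) :: 'a \<Rightarrow> 'a \<Rightarrow> 'a" 1
  by unfold_locales (simp_all add: coalg cbilinear_mult mult.assoc)

lemma SC_twist: "SC (twist i x) = twist i (SC x)" and SC_grade: "x \<in> G i \<Longrightarrow> SC x \<in> G i"
  using convolution_inverse_even[OF CA.convolution_algebra_axioms twist_mult SC_linear SC_left SC_right]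
  by auto

lemma SC_one: "SC 1 = 1"
  using SC_left[of 1]
  by (simp add: convolve_def cop_one cou_one scaleC_one
      tensor_lift_pure[OF cbilinear_comp[OF cbilinear_mult SC_linear clinear_ident(1)]])

lemma cou_SC: "cou (SC x) = cou x"
proof -
  have "cou x = cou (convolve cop (*) SC (\<lambda>x. x) x)"
    by (simp add: SC_left clinear_scale[OF cou_linear] cou_one scaleC_complex_def)
  also have "\<dots> = convolve cop (\<lambda>p q. cou (p * q)) SC (\<lambda>x. x) x"
    by (rule convolve_comp[OF cou_linear cbilinear_mult SC_linear clinear_ident(1)])
  also have "\<dots> = convolve cop (*) (\<lambda>x. cou (SC x)) (\<lambda>x. cou x *\<^sub>C 1) x"
    by (rule convolve_cong) (simp add: cou_mult scaleC_complex_def)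
  also have "\<dots> = cou (SC x)"
    by (simp add: convolve_counit_right[OF coalg cbilinear_mult clinear_comp[OF cou_linear SC_linear]])
  finally show ?thesis ..
qed

text \<open>The graded form of S(x_1 y) x_2 = eps(x) S(y), with the sign for moving \<open>y\<close>
  past the leg \<open>b k\<close>. For a generator x it becomes a system of linear equations for the
  antipode of the products x y.\<close>

lemma SC_shift:
  assumes x: "cop x = (\<Sum>k\<in>K. a k \<otimes> b k)" and b: "\<And>k. k \<in> K \<Longrightarrow> b k \<in> G (i k)"
  shows "(\<Sum>k\<in>K. SC (a k * twist (i k) y) * b k) = cou x *\<^sub>C SC y"
proof (rule antipode_shift[OF coalg SC])
  note M = cbilinear_mult[where 'a = 'a]
  have p: "clinear (\<lambda>c. a k * twist (i k) c)" for k
    by (rule clinear_comp[OF cbilinearD(1)[OF M] twist_linear])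
  then show "clinear (\<lambda>c. a k * twist (i k) c)" for k .
  fix y
  have B: "cbilinear (\<lambda>a b. SC a * b)" by (rule cbilinear_comp[OF M SC_linear clinear_ident(1)])
  have Bk: "cbilinear (\<lambda>c d. SC (a k * twist (i k) c) * (b k * d))" for k
    by (rule cbilinear_comp[OF M clinear_comp[OF SC_linear p] cbilinearD(1)[OF M]])
  have *: "tensor_lift (\<lambda>a b. SC a * b) (gmult (a k \<otimes> b k) s) =
      tensor_lift (\<lambda>c d. SC (a k * twist (i k) c) * (b k * d)) s" if "k \<in> K" for k s
    by (induction s rule: tensor_induct)
      (simp_all add: gmult_left[OF b[OF that]] tensor_lift_pure[OF B] tensor_lift_pure[OF Bk]
        clinear_add[OF cbilinearD(1)[OF gmult_bilinear]] clinear_add[OF tensor_lift_linear[OF B]]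
        clinear_add[OF tensor_lift_linear[OF Bk]])
  have "(\<Sum>k\<in>K. convolve cop (*) (\<lambda>c. SC (a k * twist (i k) c)) (\<lambda>d. b k * d) y) =
      tensor_lift (\<lambda>a b. SC a * b) (cop (x * y))"
    by (simp add: cop_mult x clinear_sum[OF cbilinearD(2)[OF gmult_bilinear]]
        clinear_sum[OF tensor_lift_linear[OF B]] * convolve_def)
  then show "(\<Sum>k\<in>K. convolve cop (*) (\<lambda>c. SC (a k * twist (i k) c)) (\<lambda>d. b k * d) y) = (cou x * cou y) *\<^sub>C 1"
    using SC_left[of "x * y"] by (simp add: convolve_def cou_mult)
qed

definition flip_SC :: "('a, 'a) tensor \<Rightarrow> ('a, 'a) tensor" where
  "flip_SC s = graded_flip G (tensor_map SC SC s)"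

lemma graded_flip_linear: "clinear (graded_flip G)"
proof -
  have "cbilinear (\<lambda>a b. part j b \<otimes> part i a)" for i j
    using cbilinear_swap[OF cbilinear_comp[OF tensor_pure_bilinear part_linear part_linear]] .
  note B = cbilinearD[OF this]
  show ?thesis
    unfolding graded_flip_def
    by (intro tensor_lift_linear cbilinearI clinear_sum_fun clinear_scale_fun B)
qed

lemma flip_SC_linear: "clinear flip_SC"
  unfolding flip_SC_def[abs_def]
  by (rule clinear_comp[OF graded_flip_linear tensor_map_linear[OF SC_linear SC_linear]])

lemma flip_SC_pure: "a \<in> G i \<Longrightarrow> b \<in> G j \<Longrightarrow> flip_SC (a \<otimes> b) = koszul i j *\<^sub>C (SC b \<otimes> SC a)"
  by (simp add: flip_SC_def tensor_map_pure SC_linear graded_flip_homogeneous[OF graded SC_grade SC_grade])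

lemma flip_SC_even: "a \<in> G 0 \<or> b \<in> G 0 \<Longrightarrow> flip_SC (a \<otimes> b) = SC b \<otimes> SC a"
proof -
  have 1: "flip_SC (a \<otimes> b) = SC b \<otimes> SC a" if "a \<in> G 0" for a b
    by (induction b rule: homogeneous_induct)
      (use that in \<open>auto simp: flip_SC_pure koszul_def scaleC_one tensor_add_left tensor_add_right
        clinear_add[OF flip_SC_linear] clinear_add[OF SC_linear]\<close>)
  have 2: "flip_SC (a \<otimes> b) = SC b \<otimes> SC a" if "b \<in> G 0" for a b
    by (induction a rule: homogeneous_induct)
      (use that in \<open>auto simp: flip_SC_pure koszul_def scaleC_one tensor_add_left tensor_add_right
        clinear_add[OF flip_SC_linear] clinear_add[OF SC_linear]\<close>)
  show "a \<in> G 0 \<or> b \<in> G 0 \<Longrightarrow> flip_SC (a \<otimes> b) = SC b \<otimes> SC a" using 1 2 by blast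
qed

lemma twist_flip_SC:
  "tensor_map (twist i) (twist i) (flip_SC s) = flip_SC (tensor_map (twist i) (twist i) s)"
proof -
  note T = tensor_map_linear[OF twist_linear[of i] twist_linear[of i]]
  show ?thesis
  proof (induction s rule: homogeneous_tensor_induct)
    case (pure a b k l)
    then show ?case
      by (simp add: flip_SC_pure clinear_scale[OF T] tensor_map_pure[OF twist_linear twist_linear]
          twist_homogeneous SC_twist[symmetric] clinear_scale[OF SC_linear]
          tensor_scale_left tensor_scale_right clinear_scale[OF flip_SC_linear] scaleC_scaleC)
  qed (simp add: clinear_add[OF T] clinear_add[OF flip_SC_linear])
qed

text \<open>Graded reversal of products on the tensor square, needed to pass from generators to
  products in the coalgebra identity. Only the total degree of \<open>s\<close> enters;
  \<open>twist i\<close> carries the sign for an arbitrary \<open>u\<close>.\<close>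

lemma flip_SC_gmult:
  assumes anti: "\<And>x y. SC (x * y) = gop (SC x) (SC y)"
    and s: "s \<in> tensor_grade G i"
  shows "flip_SC (gmult s u) = gmult (flip_SC (tensor_map (twist i) (twist i) u)) (flip_SC s)"
  using s
proof (induction rule: tensor_grade_induct)
  note T = tensor_map_linear[OF twist_linear[of i] twist_linear[of i]]
  note gl = clinear_scale[OF cbilinearD(1)[OF gmult_bilinear]] clinear_scale[OF cbilinearD(2)[OF gmult_bilinear]]
  case (pure a b p q)
  show ?case
  proof (induction u rule: homogeneous_tensor_induct)
    case (pure c e k l)
    note g = pure.hyps \<open>a \<in> G p\<close> \<open>b \<in> G q\<close> \<open>p + q = i\<close>
    note Sg = g(1-4)[THEN SC_grade]
    \<comment> \<open>With i = p + q both exponents are pk + pl + pq + ql + kl modulo 2, because qk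
      occurs twice on each side.\<close>
    have kz: "koszul q k * koszul (p + k) (q + l) * (koszul q l * koszul p k) =
        koszul i k * koszul i l * koszul k l * koszul p q * koszul k q"
      using g(5) unfolding koszul_add[of _ p q, folded g(5)] koszul_add
      by (auto simp: koszul_def)
    have "flip_SC (gmult (a \<otimes> b) (c \<otimes> e)) =
        (koszul q k * koszul (p + k) (q + l) * (koszul q l * koszul p k)) *\<^sub>C ((SC e * SC b) \<otimes> (SC c * SC a))"
      using g Sg
      by (simp add: graded_tensor_mult_homogeneous[OF graded] clinear_scale[OF flip_SC_linear]
          flip_SC_pure[OF grade_mult grade_mult] anti gop_homogeneous tensor_scale_left tensor_scale_right
          scaleC_scaleC mult.assoc del: add_bit_eq_xor)
    moreover have "gmult (flip_SC (tensor_map (twist i) (twist i) (c \<otimes> e))) (flip_SC (a \<otimes> b)) =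
        (koszul i k * koszul i l * koszul k l * koszul p q * koszul k q) *\<^sub>C ((SC e * SC b) \<otimes> (SC c * SC a))"
      using g Sg
      by (simp add: tensor_map_pure[OF twist_linear twist_linear] twist_homogeneous
          tensor_scale_left tensor_scale_right clinear_scale[OF flip_SC_linear] flip_SC_pure gl
          graded_tensor_mult_homogeneous[OF graded] scaleC_scaleC mult.assoc mult.left_commute mult.commute)
    ultimately show ?case by (simp only: kz)
  qed (simp add: clinear_add[OF cbilinearD(1)[OF gmult_bilinear]] clinear_add[OF flip_SC_linear] clinear_add[OF T]
      clinear_add[OF cbilinearD(2)[OF gmult_bilinear]])
qed (simp_all add: clinear_add[OF cbilinearD(1)[OF gmult_bilinear]] clinear_add[OF cbilinearD(2)[OF gmult_bilinear]]
    clinear_0[OF cbilinearD(1)[OF gmult_bilinear]] clinear_0[OF cbilinearD(2)[OF gmult_bilinear]]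
    clinear_add[OF flip_SC_linear] clinear_0[OF flip_SC_linear])

end

context quantum_cartan_bialgebra
begin

subsection \<open>Existence of the antipode\<close>

text \<open>\<open>gamma_injective\<close> makes the assignment well defined. The projection
  \<open>P\<close> onto \<E> makes \<open>ev (P h)\<close> linear in all functionals
  \<open>h\<close>, and its left inverse \<open>q\<close> on \<E> recovers \<open>h\<close> from
  \<open>ev h\<close>; outside the image of \<E> the resulting map is whatever the linear extension
  gives.\<close>

lemma ev_transport:
  assumes "\<And>h. h \<in> \<E> \<Longrightarrow> h \<circ> \<theta> \<in> \<E>"
  obtains g where "clinear g" "\<And>h. h \<in> \<E> \<Longrightarrow> g (ev h) = ev (h \<circ> \<theta>)"
proof -
  interpret vv: vector_space_pair "scaleC :: complex \<Rightarrow> ('a \<Rightarrow> complex) \<Rightarrow> _" "scaleC :: complex \<Rightarrow> ('a \<Rightarrow> complex) \<Rightarrow> _" ..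
  interpret vc: vector_space_pair "scaleC :: complex \<Rightarrow> ('a \<Rightarrow> complex) \<Rightarrow> _" "scaleC :: complex \<Rightarrow> 'c \<Rightarrow> _" ..
  obtain P where P: "range P \<subseteq> \<E>" "clinear P" "\<And>h. h \<in> \<E> \<Longrightarrow> P h = h"
    using vv.linear_exists_left_inverse_on[OF clinear_ident(1) E_subspace] by auto
  have PE: "P h \<in> \<E>" for h using P(1) by blast
  have ev_P: "clinear (\<lambda>h. ev (P h))"
    by (rule clinearI) (simp_all only: clinear_add[OF P(2)] clinear_scale[OF P(2)] gamma_add[OF PE PE] gamma_scale[OF PE])
  have "inj_on (\<lambda>h. ev (P h)) \<E>"
  proof (rule inj_onI)
    fix g h assume gh: "g \<in> \<E>" "h \<in> \<E>" "ev (P g) = ev (P h)"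
    have "ev (P (g - h)) = 0"
      using gh(3) by (simp only: clinear_diff[OF ev_P] diff_self)
    moreover have "g - h \<in> \<E>" by (rule cvs.subspace_diff[OF E_subspace gh(1,2)])
    ultimately have "g - h = 0" using P(3) gamma_injective by metis
    then show "g = h" by (simp only: right_minus_eq)
  qed
  then obtain q where q: "range q \<subseteq> \<E>" "clinear q" "\<And>h. h \<in> \<E> \<Longrightarrow> q (ev (P h)) = h"
    using vc.linear_exists_left_inverse_on[OF ev_P E_subspace] by auto
  have qE: "q x \<circ> \<theta> \<in> \<E>" for x using q(1) assms by blast
  have lin: "clinear (\<lambda>x. q x \<circ> \<theta>)"
    by (rule clinearI) (simp_all add: fun_eq_iff clinear_add[OF q(2)] clinear_scale[OF q(2)] scaleC_fun_apply)
  have "clinear (\<lambda>x. ev (P (q x \<circ> \<theta>)))"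
    by (rule clinear_comp[OF ev_P lin])
  moreover have "ev (P (q (ev h) \<circ> \<theta>)) = ev (h \<circ> \<theta>)" if "h \<in> \<E>" for h
    using q(3)[OF that] P(3) that assms by simp
  ultimately show ?thesis using that by blast
qed

text \<open>Evaluating \<open>h\<close> on the identity P(z_1) Q(z_2) = eps(z) 1 yields a
  convolution identity for the pieces of \<open>h\<close>, which \<open>ev\<close> turns into a
  product identity. The second form, with reversed products, is the one satisfied by the inverse
  antipode.\<close>

lemma ev_convolution:
  assumes h: "h \<in> \<E>" and ab: "\<And>k. k < n \<Longrightarrow> a k \<in> \<E>" "\<And>k. k < n \<Longrightarrow> b k \<in> \<E>"
    and dec: "\<And>x y. h (x * y) = (\<Sum>k<n. a k x * b k y)"
    and lin: "clinear P" "clinear Q"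
    and E: "\<And>h. h \<in> \<E> \<Longrightarrow> h \<circ> P \<in> \<E>" "\<And>h. h \<in> \<E> \<Longrightarrow> h \<circ> Q \<in> \<E>"
  shows "(\<And>z. convolve cop (*) P Q z = cou z *\<^sub>C 1) \<Longrightarrow>
      (\<Sum>k<n. ev (a k \<circ> P) * ev (b k \<circ> Q)) = h 1 *\<^sub>C 1"
    and "(\<And>z. convolve cop (\<lambda>p q. q * p) Q P z = cou z *\<^sub>C 1) \<Longrightarrow>
      (\<Sum>k<n. ev (b k \<circ> Q) * ev (a k \<circ> P)) = h 1 *\<^sub>C 1"
proof -
  note M = cbilinear_mult
  have l: "clinear (a k \<circ> P)" "clinear (b k \<circ> Q)" if "k < n" for k
    using that ab E by (simp_all only: E_linear)
  have hlin: "clinear h" by (rule E_linear[OF h])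
  have fin: "ev (h 1 *\<^sub>C cou) = h 1 *\<^sub>C 1"
    by (simp only: gamma_scale[OF calc_subalgebra.unit] gamma_unit)
  show "(\<Sum>k<n. ev (a k \<circ> P) * ev (b k \<circ> Q)) = h 1 *\<^sub>C 1" if z: "\<And>z. convolve cop (*) P Q z = cou z *\<^sub>C 1"
  proof -
    have "(\<Sum>k<n. conv cop (a k \<circ> P) (b k \<circ> Q)) = h 1 *\<^sub>C cou"
    proof
      fix z
      have "tensor_lift (\<lambda>x y. \<Sum>k<n. (a k \<circ> P) x * (b k \<circ> Q) y) (cop z) =
          (\<Sum>k<n. conv cop (a k \<circ> P) (b k \<circ> Q) z)"
        unfolding conv_def by (rule tensor_lift_sum) (rule cbilinear_comp[OF M l]; simp)
      moreover have "tensor_lift (\<lambda>x y. \<Sum>k<n. (a k \<circ> P) x * (b k \<circ> Q) y) (cop z) =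
          tensor_lift (\<lambda>x y. h (P x * Q y)) (cop z)"
        by (simp add: dec)
      moreover have "\<dots> = h (convolve cop (*) P Q z)"
        unfolding convolve_def by (rule tensor_lift_comp[OF hlin cbilinear_comp[OF M lin], symmetric])
      ultimately show "(\<Sum>k<n. conv cop (a k \<circ> P) (b k \<circ> Q)) z = (h 1 *\<^sub>C cou) z"
        by (simp add: z clinear_scale[OF hlin] sum_fun_apply scaleC_fun_apply scaleC_complex_def)
    qed
    then have "ev (\<Sum>k<n. conv cop (a k \<circ> P) (b k \<circ> Q)) = h 1 *\<^sub>C 1" by (simp only: fin)
    moreover have "ev (\<Sum>k<n. conv cop (a k \<circ> P) (b k \<circ> Q)) = (\<Sum>k<n. ev (conv cop (a k \<circ> P) (b k \<circ> Q)))"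
      by (rule ev_sum) (use ab E in \<open>auto intro!: calc_subalgebra.mult simp del: o_apply\<close>)
    moreover have "\<dots> = (\<Sum>k<n. ev (a k \<circ> P) * ev (b k \<circ> Q))"
      by (rule sum.cong[OF refl]) (use ab E in \<open>simp only: gamma_conv lessThan_iff\<close>)
    ultimately show ?thesis by simp
  qed
  show "(\<Sum>k<n. ev (b k \<circ> Q) * ev (a k \<circ> P)) = h 1 *\<^sub>C 1" if z: "\<And>z. convolve cop (\<lambda>p q. q * p) Q P z = cou z *\<^sub>C 1"
  proof -
    have "(\<Sum>k<n. conv cop (b k \<circ> Q) (a k \<circ> P)) = h 1 *\<^sub>C cou"
    proof
      fix z
      have "tensor_lift (\<lambda>x y. \<Sum>k<n. (b k \<circ> Q) x * (a k \<circ> P) y) (cop z) =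
          (\<Sum>k<n. conv cop (b k \<circ> Q) (a k \<circ> P) z)"
        unfolding conv_def by (rule tensor_lift_sum) (rule cbilinear_comp[OF M l(2) l(1)]; simp)
      moreover have "tensor_lift (\<lambda>x y. \<Sum>k<n. (b k \<circ> Q) x * (a k \<circ> P) y) (cop z) =
          tensor_lift (\<lambda>x y. h (P y * Q x)) (cop z)"
        by (simp add: dec mult.commute)
      moreover have "\<dots> = h (convolve cop (\<lambda>p q. q * p) Q P z)"
        unfolding convolve_def
        by (rule tensor_lift_comp[OF hlin cbilinear_comp[OF cbilinear_swap[OF M] lin(2,1)], symmetric])
      ultimately show "(\<Sum>k<n. conv cop (b k \<circ> Q) (a k \<circ> P)) z = (h 1 *\<^sub>C cou) z"
        by (simp add: z clinear_scale[OF hlin] sum_fun_apply scaleC_fun_apply scaleC_complex_def)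
    qed
    then have "ev (\<Sum>k<n. conv cop (b k \<circ> Q) (a k \<circ> P)) = h 1 *\<^sub>C 1" by (simp only: fin)
    moreover have "ev (\<Sum>k<n. conv cop (b k \<circ> Q) (a k \<circ> P)) = (\<Sum>k<n. ev (conv cop (b k \<circ> Q) (a k \<circ> P)))"
      by (rule ev_sum) (use ab E in \<open>auto intro!: calc_subalgebra.mult simp del: o_apply\<close>)
    moreover have "\<dots> = (\<Sum>k<n. ev (b k \<circ> Q) * ev (a k \<circ> P))"
      by (rule sum.cong[OF refl]) (use ab E in \<open>simp only: gamma_conv lessThan_iff\<close>)
    ultimately show ?thesis by simp
  qed
qed

text \<open>Level 0 is the image of \<E>, where composition with \<open>\<theta>\<close> supplies an
  inverse; \<open>convolution_inverse_extends\<close> does the rest. The product \<open>m\<close> is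
  a parameter so that the multiplication with \<open>S\<close> and its graded opposite with
  \<open>inv S\<close> are both covered.\<close>

lemma convolution_inverse_exists:
  assumes CA: "convolution_algebra copC couC m 1"
    and E: "\<And>h. h \<in> \<E> \<Longrightarrow> h \<circ> \<theta> \<in> \<E>"
    and inv: "\<And>h n a b. h \<in> \<E> \<Longrightarrow> (\<And>k. k < n \<Longrightarrow> a k \<in> \<E>) \<Longrightarrow> (\<And>k. k < n \<Longrightarrow> b k \<in> \<E>) \<Longrightarrow>
      (\<And>x y. h (x * y) = (\<Sum>k<n::nat. a k x * b k y)) \<Longrightarrow>
      (\<Sum>k<n. m (ev (a k)) (ev (b k \<circ> \<theta>))) = h 1 *\<^sub>C 1 \<and> (\<Sum>k<n. m (ev (a k \<circ> \<theta>)) (ev (b k))) = h 1 *\<^sub>C 1"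
  obtains T where "clinear T" "\<And>x. convolve copC m T (\<lambda>x. x) x = couC x *\<^sub>C 1"
    "\<And>x. convolve copC m (\<lambda>x. x) T x = couC x *\<^sub>C 1"
proof -
  interpret CA: convolution_algebra copC couC m 1 by (rule CA)
  interpret FC: filtered_convolution copC couC m 1 F
    by unfold_locales (use F_mono F_exhaust F_copC in \<open>auto simp: TF_def\<close>)
  obtain g where g: "clinear g" "\<And>h. h \<in> \<E> \<Longrightarrow> g (ev h) = ev (h \<circ> \<theta>)"
    using ev_transport[OF E] by blast
  note m = CA.m_bilinear and id = clinear_ident(1)[where 'a = 'c]
  have "convolve copC m (\<lambda>x. x) g x = couC x *\<^sub>C 1 \<and> convolve copC m g (\<lambda>x. x) x = couC x *\<^sub>C 1"
    if x: "x \<in> F 0" for x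
  proof -
    obtain h where h: "h \<in> \<E>" "x = ev h" using F_zero_ev[OF x] by blast
    obtain n :: nat and a b where ab: "\<And>k. k < n \<Longrightarrow> a k \<in> \<E>" "\<And>k. k < n \<Longrightarrow> b k \<in> \<E>"
      "\<And>x y. h (x * y) = (\<Sum>k<n. a k x * b k y)" "copC (ev h) = (\<Sum>k<n. ev (a k) \<otimes> ev (b k))"
      by (rule ev_decomposition[OF h(1)]) (rule that)
    have "convolve copC m (\<lambda>x. x) g x = (\<Sum>k<n. m (ev (a k)) (g (ev (b k))))"
      unfolding convolve_def h(2) ab(4) by (rule tensor_lift_sum_pure[OF cbilinear_comp[OF m id g(1)]])
    also have "\<dots> = (\<Sum>k<n. m (ev (a k)) (ev (b k \<circ> \<theta>)))"
      by (rule sum.cong[OF refl]) (use ab(2) g(2) in \<open>simp only: lessThan_iff\<close>)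
    finally have 1: "convolve copC m (\<lambda>x. x) g x = (\<Sum>k<n. m (ev (a k)) (ev (b k \<circ> \<theta>)))" .
    have "convolve copC m g (\<lambda>x. x) x = (\<Sum>k<n. m (g (ev (a k))) (ev (b k)))"
      unfolding convolve_def h(2) ab(4) by (rule tensor_lift_sum_pure[OF cbilinear_comp[OF m g(1) id]])
    also have "\<dots> = (\<Sum>k<n. m (ev (a k \<circ> \<theta>)) (ev (b k)))"
      by (rule sum.cong[OF refl]) (use ab(1) g(2) in \<open>simp only: lessThan_iff\<close>)
    finally have 2: "convolve copC m g (\<lambda>x. x) x = (\<Sum>k<n. m (ev (a k \<circ> \<theta>)) (ev (b k)))" .
    have 3: "couC x = h 1" unfolding h(2) by (rule couC_ev[OF h(1)])
    show ?thesis
      unfolding 1 2 3 by (rule inv[OF h(1) ab(1-3)])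
  qed
  note zero = this
  obtain T where T: "clinear T" "convolve copC m T (\<lambda>x. x) = (\<lambda>x. couC x *\<^sub>C 1)"
    "convolve copC m (\<lambda>x. x) T = (\<lambda>x. couC x *\<^sub>C 1)"
    by (rule FC.convolution_inverse_extends[OF id g(1)]) (use zero in \<open>auto intro: that\<close>)
  show ?thesis
    by (rule that[OF T(1)]) (simp_all add: T(2,3))
qed

lemma antipode_exists: obtains T where "is_antipode copC couC T"
proof -
  have CA: "convolution_algebra copC couC ((*) :: 'c \<Rightarrow> 'c \<Rightarrow> 'c) 1"
    by unfold_locales (simp_all add: C.coalg cbilinear_mult mult.assoc)
  note id = clinear_ident(1)[where 'a = 'a]
  have idE: "h \<circ> (\<lambda>x. x) \<in> \<E>" if "h \<in> \<E>" for h using that by (simp add: comp_def)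
  obtain T where "clinear T" "\<And>x. convolve copC (*) T (\<lambda>x. x) x = couC x *\<^sub>C 1"
    "\<And>x. convolve copC (*) (\<lambda>x. x) T x = couC x *\<^sub>C 1"
  proof (rule convolution_inverse_exists[OF CA, where \<theta> = S])
    show "h \<circ> S \<in> \<E>" if "h \<in> \<E>" for h using that by (rule E_antipode)
  next
    fix h n and a b assume *: "h \<in> \<E>" "\<And>k. k < n \<Longrightarrow> a k \<in> \<E>" "\<And>k. k < n \<Longrightarrow> b k \<in> \<E>"
      "\<And>x y. h (x * y) = (\<Sum>k<n::nat. a k x * b k y)"
    show "(\<Sum>k<n. ev (a k) * ev (b k \<circ> S)) = h 1 *\<^sub>C 1 \<and> (\<Sum>k<n. ev (a k \<circ> S) * ev (b k)) = h 1 *\<^sub>C 1"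
      using ev_convolution(1)[OF * id S_linear idE E_antipode S_right]
        ev_convolution(1)[OF * S_linear id E_antipode idE S_left]
      by (simp add: comp_def)
  qed (rule that)
  then have "is_antipode copC couC T" by (simp add: is_antipode_def convolve_def)
  then show ?thesis by (rule that)
qed

text \<open>On even elements the graded opposite product is the plain opposite product, for which
  \<open>inv S\<close> satisfies the antipode identities.\<close>

lemma skew_antipode_exists:
  obtains T where "clinear T" "\<And>x. convolve copC C.gop T (\<lambda>x. x) x = couC x *\<^sub>C 1"
    "\<And>x. convolve copC C.gop (\<lambda>x. x) T x = couC x *\<^sub>C 1"
proof -
  have CA: "convolution_algebra copC couC C.gop 1"
    by unfold_locales (simp_all add: C.coalg C.gop_bilinear C.gop_assoc C.gop_one)
  note id = clinear_ident(1)[where 'a = 'a]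
  have idE: "h \<circ> (\<lambda>x. x) \<in> \<E>" if "h \<in> \<E>" for h using that by (simp add: comp_def)
  note iS = inv_S[OF bij_S]
  show ?thesis
  proof (rule convolution_inverse_exists[OF CA, where \<theta> = "inv S"])
    show "h \<circ> inv S \<in> \<E>" if "h \<in> \<E>" for h using that by (rule E_inv_S)
  next
    fix h n and a b assume *: "h \<in> \<E>" "\<And>k. k < n \<Longrightarrow> a k \<in> \<E>" "\<And>k. k < n \<Longrightarrow> b k \<in> \<E>"
      "\<And>x y. h (x * y) = (\<Sum>k<n::nat. a k x * b k y)"
    have g: "C.gop (ev g) (ev h) = ev h * ev g" if "g \<in> \<E>" for g h
      by (rule C.gop_even[OF ev_grade[OF that]])
    have "(\<Sum>k<n. C.gop (ev (a k)) (ev (b k \<circ> inv S))) = (\<Sum>k<n. ev (b k \<circ> inv S) * ev (a k \<circ> (\<lambda>x. x)))"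
      by (rule sum.cong[OF refl]) (use *(2) g in \<open>simp add: comp_def\<close>)
    moreover have "(\<Sum>k<n. C.gop (ev (a k \<circ> inv S)) (ev (b k))) = (\<Sum>k<n. ev (b k \<circ> (\<lambda>x. x)) * ev (a k \<circ> inv S))"
      by (rule sum.cong[OF refl]) (use *(2) g[OF E_inv_S] in \<open>simp add: comp_def\<close>)
    ultimately show "(\<Sum>k<n. C.gop (ev (a k)) (ev (b k \<circ> inv S))) = h 1 *\<^sub>C 1 \<and>
        (\<Sum>k<n. C.gop (ev (a k \<circ> inv S)) (ev (b k))) = h 1 *\<^sub>C 1"
      using ev_convolution(2)[OF * id iS(1) idE E_inv_S iS(7)]
        ev_convolution(2)[OF * iS(1) id E_inv_S idE iS(6)] by simp
  qed (rule that)
qed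

end

locale quantum_cartan_antipode =
  quantum_cartan_bialgebra cop cou S lm rm d lco rco N \<omega> f J X t \<gamma> copC couC +
  A: graded_antipode "cartan_grading cop cou N X f \<gamma>" copC couC SC
  for cop :: "'a::complex_algebra_1 \<Rightarrow> ('a, 'a) tensor" and cou S
    and lm :: "'a \<Rightarrow> 'g::complex_vector \<Rightarrow> 'g" and rm d lco rco N \<omega> f J X t
    and \<gamma> :: "('a \<Rightarrow> complex) cartan_gen \<Rightarrow> 'c::complex_algebra_1"
    and copC :: "'c \<Rightarrow> ('c, 'c) tensor" and couC :: "'c \<Rightarrow> complex" and SC :: "'c \<Rightarrow> 'c"
begin

abbreviation fS :: "nat \<Rightarrow> nat \<Rightarrow> 'c" where "fS i j \<equiv> ev (f i j \<circ> S)"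

lemma fS_grade: "i \<in> {1..N} \<Longrightarrow> j \<in> {1..N} \<Longrightarrow> fS i j \<in> G 0"
  by (rule ev_grade[OF fS_E])

lemma f_grade: "i \<in> {1..N} \<Longrightarrow> j \<in> {1..N} \<Longrightarrow> ev (f i j) \<in> G 0"
  by (rule ev_grade[OF calc_subalgebra.gen_f])

lemma ev_f_inverse:
  assumes k: "k \<in> {1..N}" and l: "l \<in> {1..N}"
  shows "(\<Sum>j=1..N. ev (f k j) * fS j l) = (if k = l then 1 else 0)"
    and "(\<Sum>j=1..N. fS k j * ev (f j l)) = (if k = l then 1 else 0)"
proof -
  note E = calc_subalgebra.gen_f fS_E
  have c: "ev (if k = l then cou else 0) = (if k = l then 1 else 0)" by (simp only: gamma_unit ev_zero split: if_splits) simp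
  have "(\<Sum>j=1..N. conv cop (f k j) (f j l \<circ> S)) = (if k = l then cou else 0)"
    by (rule ext) (simp add: sum_fun_apply f_S(2)[OF k l])
  then have "ev (\<Sum>j=1..N. conv cop (f k j) (f j l \<circ> S)) = (if k = l then 1 else 0)" by (simp only: c)
  moreover have "ev (\<Sum>j=1..N. conv cop (f k j) (f j l \<circ> S)) = (\<Sum>j=1..N. ev (conv cop (f k j) (f j l \<circ> S)))"
    by (rule ev_sum) (intro calc_subalgebra.mult E k l)
  moreover have "\<dots> = (\<Sum>j=1..N. ev (f k j) * fS j l)"
    by (rule sum.cong[OF refl]) (intro gamma_conv E k l)
  ultimately show "(\<Sum>j=1..N. ev (f k j) * fS j l) = (if k = l then 1 else 0)" by simp
  have "(\<Sum>j=1..N. conv cop (f k j \<circ> S) (f j l)) = (if k = l then cou else 0)"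
    by (rule ext) (simp add: sum_fun_apply f_S(1)[OF k l])
  then have "ev (\<Sum>j=1..N. conv cop (f k j \<circ> S) (f j l)) = (if k = l then 1 else 0)" by (simp only: c)
  moreover have "ev (\<Sum>j=1..N. conv cop (f k j \<circ> S) (f j l)) = (\<Sum>j=1..N. ev (conv cop (f k j \<circ> S) (f j l)))"
    by (rule ev_sum) (intro calc_subalgebra.mult E k l)
  moreover have "\<dots> = (\<Sum>j=1..N. fS k j * ev (f j l))"
    by (rule sum.cong[OF refl]) (intro gamma_conv E k l)
  ultimately show "(\<Sum>j=1..N. fS k j * ev (f j l)) = (if k = l then 1 else 0)" by simp
qed

text \<open>By \<open>ev_f_inverse\<close>, right multiplication by the matrix of the
  \<open>ev (f j i)\<close> is inverted by the matrix of the \<open>fS i k\<close>.\<close>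

lemma solve_f:
  assumes "\<And>i. i \<in> {1..N} \<Longrightarrow> (\<Sum>j=1..N. u j * ev (f j i)) = v i" and k: "k \<in> {1..N}"
  shows "u k = (\<Sum>i=1..N. v i * fS i k)"
proof -
  have "(\<Sum>i=1..N. v i * fS i k) = (\<Sum>i=1..N. \<Sum>j=1..N. u j * (ev (f j i) * fS i k))"
    by (rule sum.cong[OF refl]) (simp add: assms(1)[symmetric] sum_distrib_right mult.assoc)
  also have "\<dots> = (\<Sum>j=1..N. u j * (\<Sum>i=1..N. ev (f j i) * fS i k))"
    by (subst sum.swap) (simp add: sum_distrib_left)
  also have "\<dots> = (\<Sum>j=1..N. if j = k then u j else 0)"
    by (rule sum.cong[OF refl]) (simp add: ev_f_inverse(1)[OF _ k])
  also have "\<dots> = u k" using k by simp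
  finally show ?thesis ..
qed

subsection \<open>The antipode on products with a generator\<close>

text \<open>What a generator \<open>g\<close> has to satisfy so that the antihomomorphism properties
  pass from \<open>z\<close> to \<open>g * z\<close>.\<close>

definition reverses :: "bit \<Rightarrow> 'c \<Rightarrow> bool" where
  "reverses p g \<longleftrightarrow> g \<in> G p \<and> (\<forall>z. SC (g * z) = SC (C.twist p z) * SC g) \<and> copC (SC g) = A.flip_SC (copC g)"

text \<open>\<open>SC_shift\<close> for the coproduct of \<open>f i l\<close> says that the elements
  \<open>SC (ev (f i k) * z)\<close>, multiplied by the matrix of \<open>f\<close>, give a Kronecker
  symbol times \<open>SC z\<close>; \<open>solve_f\<close> inverts this. The value on the generator
  is the case z = 1.\<close>

lemma SC_f:
  assumes i: "i \<in> {1..N}" and j: "j \<in> {1..N}"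
  shows "SC (ev (f i j) * z) = SC z * fS i j" "SC (ev (f i j)) = fS i j"
proof -
  have 1: "SC (ev (f i j) * z) = SC z * fS i j" for z
  proof -
    have "(\<Sum>k=1..N. SC (ev (f i k) * z) * ev (f k l)) = (if i = l then SC z else 0)"
      if l: "l \<in> {1..N}" for l
      using A.SC_shift[OF copC_f[OF i l], where i = "\<lambda>_. 0" and y = z] i l
      by (simp add: f_grade C.twist_zero couC_f scaleC_one)
    then have "SC (ev (f i j) * z) = (\<Sum>l=1..N. (if i = l then SC z else 0) * fS l j)"
      by (rule solve_f[OF _ j])
    also have "\<dots> = SC z * fS i j"
      using i by (simp add: if_distrib[of "\<lambda>c. c * _"] cong: if_cong)
    finally show ?thesis .
  qed
  show "SC (ev (f i j) * z) = SC z * fS i j" by (rule 1)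
  show "SC (ev (f i j)) = fS i j" using 1[of 1] by (simp add: A.SC_one)
qed

text \<open>Even legs create no signs, so associativity of the ungraded tensor product becomes
  available for these elements.\<close>

lemma gmult_copC_ev: "h \<in> \<E> \<Longrightarrow> C.gmult (copC (ev h)) u = tensor_mult (*) (*) (copC (ev h)) u"
proof -
  assume h: "h \<in> \<E>"
  obtain n :: nat and a b where ab: "\<And>k. k < n \<Longrightarrow> a k \<in> \<E>" "\<And>k. k < n \<Longrightarrow> b k \<in> \<E>"
    "\<And>x y. h (x * y) = (\<Sum>k<n. a k x * b k y)" "copC (ev h) = (\<Sum>k<n. ev (a k) \<otimes> ev (b k))"
    by (rule ev_decomposition[OF h]) (rule that)
  note B = tensor_mult_bilinear[OF cbilinear_mult[where 'a = 'c] cbilinear_mult[where 'a = 'c]]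
  have "C.gmult (x \<otimes> ev k) u = tensor_mult (*) (*) (x \<otimes> ev k) u" if "k \<in> \<E>" for x k
    by (induction u rule: tensor_induct)
      (simp_all add: C.gmult_left[OF ev_grade[OF that]] C.twist_zero tensor_mult_alg_pure
        clinear_add[OF cbilinearD(1)[OF C.gmult_bilinear]] clinear_add[OF cbilinearD(1)[OF B]])
  then show ?thesis
    by (simp add: ab(2) ab(4) clinear_sum[OF cbilinearD(2)[OF C.gmult_bilinear]] clinear_sum[OF cbilinearD(2)[OF B]])
qed

text \<open>Both sides are inverse to the matrix of the coproducts of the \<open>f i j\<close>.\<close>

lemma copC_fS:
  assumes i: "i \<in> {1..N}" and j: "j \<in> {1..N}"
  shows "copC (fS i j) = (\<Sum>k=1..N. fS k j \<otimes> fS i k)"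
proof -
  let ?m = "tensor_mult (*) (*) :: ('c, 'c) tensor \<Rightarrow> _"
  note B = tensor_mult_bilinear[OF cbilinear_mult[where 'a = 'c] cbilinear_mult[where 'a = 'c]]
  note E = calc_subalgebra.gen_f fS_E
  define Y where "Y i j = (\<Sum>k=1..N. fS k j \<otimes> fS i k)" for i j
  have FY: "(\<Sum>l=1..N. ?m (copC (ev (f m l))) (Y l j)) = (if m = j then 1 \<otimes> 1 else 0)"
    if m: "m \<in> {1..N}" for m
  proof -
    have "(\<Sum>l=1..N. ?m (copC (ev (f m l))) (Y l j)) =
        (\<Sum>l=1..N. \<Sum>n=1..N. \<Sum>k=1..N. (ev (f m k) * fS n j) \<otimes> (ev (f k l) * fS l n))"
      using m
      by (simp add: copC_f Y_def clinear_sum[OF cbilinearD(1)[OF B]] clinear_sum[OF cbilinearD(2)[OF B]]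
          tensor_mult_alg_pure)
    also have "\<dots> = (\<Sum>n=1..N. \<Sum>l=1..N. \<Sum>k=1..N. (ev (f m k) * fS n j) \<otimes> (ev (f k l) * fS l n))"
      by (rule sum.swap)
    also have "\<dots> = (\<Sum>n=1..N. \<Sum>k=1..N. \<Sum>l=1..N. (ev (f m k) * fS n j) \<otimes> (ev (f k l) * fS l n))"
      by (rule sum.cong[OF refl], rule sum.swap)
    also have "\<dots> = (\<Sum>n=1..N. \<Sum>k=1..N. (ev (f m k) * fS n j) \<otimes> (if k = n then 1 else 0))"
      by (intro sum.cong refl) (simp add: tensor_sum_right[symmetric] ev_f_inverse(1))
    also have "\<dots> = (\<Sum>n=1..N. (ev (f m n) * fS n j) \<otimes> 1)"
      by (rule sum.cong[OF refl]) (simp add: if_distrib[of "\<lambda>c. _ \<otimes> c"] tensor_zero_right cong: if_cong)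
    also have "\<dots> = (if m = j then 1 \<otimes> 1 else 0)"
      by (simp add: tensor_sum_left[symmetric] ev_f_inverse(1)[OF m j] tensor_zero_left)
    finally show ?thesis .
  qed
  have ZF: "(\<Sum>m=1..N. ?m (copC (fS i m)) (copC (ev (f m l)))) = (if i = l then 1 \<otimes> 1 else 0)"
    if l: "l \<in> {1..N}" for l
  proof -
    have "(\<Sum>m=1..N. ?m (copC (fS i m)) (copC (ev (f m l)))) = (\<Sum>m=1..N. copC (fS i m * ev (f m l)))"
      by (rule sum.cong[OF refl]) (simp only: C.cop_mult gmult_copC_ev[OF fS_E[OF i]])
    also have "\<dots> = copC (\<Sum>m=1..N. fS i m * ev (f m l))" by (rule clinear_sum[OF C.cop_linear, symmetric])
    finally show ?thesis by (simp add: ev_f_inverse(2)[OF i l] C.cop_one clinear_0[OF C.cop_linear])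
  qed
  have "copC (fS i j) = (\<Sum>m=1..N. ?m (copC (fS i m)) (if m = j then 1 \<otimes> 1 else 0))"
    using j by (simp add: if_distrib[of "?m _"] tensor_mult_one clinear_0[OF cbilinearD(1)[OF B]] cong: if_cong)
  also have "\<dots> = (\<Sum>m=1..N. \<Sum>l=1..N. ?m (?m (copC (fS i m)) (copC (ev (f m l)))) (Y l j))"
    by (rule sum.cong[OF refl]) (simp add: FY[symmetric] clinear_sum[OF cbilinearD(1)[OF B]] tensor_mult_assoc)
  also have "\<dots> = (\<Sum>l=1..N. ?m (\<Sum>m=1..N. ?m (copC (fS i m)) (copC (ev (f m l)))) (Y l j))"
    by (subst sum.swap) (simp only: clinear_sum[OF cbilinearD(2)[OF B]])
  also have "\<dots> = (\<Sum>l=1..N. if i = l then Y l j else 0)"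
    by (rule sum.cong[OF refl]) (simp add: ZF tensor_mult_one clinear_0[OF cbilinearD(2)[OF B]])
  also have "\<dots> = Y i j" using i by simp
  finally show ?thesis by (simp add: Y_def)
qed

lemma reverses_f:
  assumes "i \<in> {1..N}" "j \<in> {1..N}"
  shows "reverses 0 (ev (f i j))"
  unfolding reverses_def
proof (intro conjI allI)
  have "A.flip_SC (copC (ev (f i j))) = (\<Sum>k=1..N. fS k j \<otimes> fS i k)"
    using assms by (simp add: copC_f clinear_sum[OF A.flip_SC_linear] A.flip_SC_even f_grade SC_f(2))
  then show "copC (SC (ev (f i j))) = A.flip_SC (copC (ev (f i j)))"
    using assms by (simp add: SC_f(2) copC_fS)
qed (use assms in \<open>simp_all add: f_grade SC_f C.twist_zero\<close>)

context
  fixes p and y :: "nat \<Rightarrow> 'c"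
  assumes y_grade: "\<And>i. i \<in> {1..N} \<Longrightarrow> y i \<in> G p"
    and copC_y: "\<And>i. i \<in> {1..N} \<Longrightarrow> copC (y i) = 1 \<otimes> y i + (\<Sum>j=1..N. y j \<otimes> ev (f j i))"
    and couC_y: "\<And>i. i \<in> {1..N} \<Longrightarrow> couC (y i) = 0"
begin

text \<open>The generators X_i and \<xi>_i have coproducts of the same shape and are treated
  together, with \<open>p\<close> their degree. The vanishing counit turns \<open>SC_shift\<close>
  into a system with matrix \<open>f\<close>, solved by \<open>solve_f\<close>.\<close>

lemma SC_y_mult:
  assumes k: "k \<in> {1..N}"
  shows "SC (y k * z) = - (\<Sum>i=1..N. SC (C.twist p z) * y i * fS i k)"
proof -
  have "(\<Sum>j=1..N. SC (y j * z) * ev (f j i)) = - (SC (C.twist p z) * y i)" if i: "i \<in> {1..N}" for i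
  proof -
    \<comment> \<open>Index 0 stands for the summand \<open>1 \<otimes> y i\<close>, whose second
      leg has degree \<open>p\<close>; the remaining second legs are even.\<close>
    let ?a = "\<lambda>k::nat. if k = 0 then 1 else y k"
    let ?b = "\<lambda>k::nat. if k = 0 then y i else ev (f k i)"
    let ?i = "\<lambda>k::nat. if k = 0 then p else 0"
    have z: "(0::nat) \<notin> {1..N}" by simp
    have "copC (y i) = (\<Sum>k\<in>insert 0 {1..N}. ?a k \<otimes> ?b k)"
      by (simp add: copC_y[OF i] sum.insert[OF _ z])
    moreover have "?b k \<in> G (?i k)" if "k \<in> insert 0 {1..N}" for k
      using that i by (auto simp: y_grade f_grade)
    ultimately have "(\<Sum>k\<in>insert 0 {1..N}. SC (?a k * C.twist (?i k) z) * ?b k) = couC (y i) *\<^sub>C SC z"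
      by (rule A.SC_shift)
    then have "SC (C.twist p z) * y i + (\<Sum>j=1..N. SC (y j * z) * ev (f j i)) = 0"
      by (simp add: sum.insert[OF _ z] couC_y[OF i] C.twist_zero)
    then show ?thesis by (simp add: eq_neg_iff_add_eq_0 add.commute)
  qed
  then show ?thesis
    using solve_f[OF _ k, of "\<lambda>j. SC (y j * z)" "\<lambda>i. - (SC (C.twist p z) * y i)"] by (simp add: sum_negf)
qed

lemma SC_y:
  assumes k: "k \<in> {1..N}"
  shows "SC (y k) = - (\<Sum>i=1..N. y i * fS i k)"
  using SC_y_mult[OF k, of 1] by (simp add: C.twist_one A.SC_one)

text \<open>For the coproduct, expand the explicit formula \<open>SC_y\<close>. The summands
  \<open>1 \<otimes> y j\<close> collect into \<open>SC (y m)\<close> in the second leg, and in the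
  others the product of \<open>ev (f k j)\<close> and \<open>fS j m\<close> cancels. The
  \<open>fS\<close> are even, so no sign appears even when \<open>y\<close> is odd.\<close>

lemma reverses_y:
  assumes i: "i \<in> {1..N}"
  shows "reverses p (y i)"
  unfolding reverses_def
proof (intro conjI allI)
  show "y i \<in> G p" by (rule y_grade[OF i])
  show "SC (y i * z) = SC (C.twist p z) * SC (y i)" for z
    by (simp add: SC_y_mult[OF i] SC_y[OF i] sum_distrib_left mult.assoc)
  note B = C.gmult_bilinear
  have "copC (y j * fS j i) = (\<Sum>m=1..N. fS m i \<otimes> (y j * fS j m)) +
      (\<Sum>k=1..N. \<Sum>m=1..N. (y k * fS m i) \<otimes> (ev (f k j) * fS j m))" if j: "j \<in> {1..N}" for j
  proof -
    have "copC (y j * fS j i) = (\<Sum>m=1..N. fS m i \<otimes> (y j * fS j m)) +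
      (\<Sum>m=1..N. \<Sum>k=1..N. (y k * fS m i) \<otimes> (ev (f k j) * fS j m))"
      using i j
      by (simp add: C.cop_mult copC_fS copC_y clinear_sum[OF cbilinearD(1)[OF B]] clinear_sum[OF cbilinearD(2)[OF B]]
          clinear_add[OF cbilinearD(2)[OF B]] C.gmult_right_even fS_grade sum.distrib)
    then show ?thesis by (subst sum.swap)
  qed
  then have "(\<Sum>j=1..N. copC (y j * fS j i)) = (\<Sum>j=1..N. \<Sum>m=1..N. fS m i \<otimes> (y j * fS j m)) +
      (\<Sum>j=1..N. \<Sum>k=1..N. \<Sum>m=1..N. (y k * fS m i) \<otimes> (ev (f k j) * fS j m))"
    by (simp add: sum.distrib)
  also have "(\<Sum>j=1..N. \<Sum>m=1..N. fS m i \<otimes> (y j * fS j m)) = (\<Sum>m=1..N. fS m i \<otimes> (\<Sum>j=1..N. y j * fS j m))"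
    by (subst sum.swap) (simp only: tensor_sum_right)
  also have "\<dots> = - (\<Sum>m=1..N. fS m i \<otimes> SC (y m))"
    by (simp add: SC_y tensor_neg_right sum_negf)
  also have "(\<Sum>j=1..N. \<Sum>k=1..N. \<Sum>m=1..N. (y k * fS m i) \<otimes> (ev (f k j) * fS j m)) =
      (\<Sum>k=1..N. \<Sum>m=1..N. \<Sum>j=1..N. (y k * fS m i) \<otimes> (ev (f k j) * fS j m))"
    by (subst sum.swap, rule sum.cong[OF refl], rule sum.swap)
  also have "\<dots> = (\<Sum>k=1..N. \<Sum>m=1..N. (y k * fS m i) \<otimes> (if k = m then 1 else 0))"
    by (intro sum.cong refl) (simp add: tensor_sum_right[symmetric] ev_f_inverse(1))
  also have "\<dots> = (\<Sum>k=1..N. (y k * fS k i) \<otimes> 1)"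
    by (rule sum.cong[OF refl]) (simp add: if_distrib[of "\<lambda>c. _ \<otimes> c"] tensor_zero_right cong: if_cong)
  also have "\<dots> = - (SC (y i) \<otimes> 1)"
    by (simp add: SC_y[OF i] tensor_neg_left tensor_sum_left)
  finally have "(\<Sum>j=1..N. copC (y j * fS j i)) = - (\<Sum>m=1..N. fS m i \<otimes> SC (y m)) + - (SC (y i) \<otimes> 1)" .
  then have "copC (SC (y i)) = SC (y i) \<otimes> 1 + (\<Sum>m=1..N. fS m i \<otimes> SC (y m))"
    by (simp add: SC_y[OF i] clinear_neg[OF C.cop_linear] clinear_sum[OF C.cop_linear])
  also have "\<dots> = A.flip_SC (copC (y i))"
    using i
    by (simp add: copC_y clinear_add[OF A.flip_SC_linear] clinear_sum[OF A.flip_SC_linear] A.flip_SC_even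
        f_grade C.grade_one A.SC_one SC_f(2))
  finally show "copC (SC (y i)) = A.flip_SC (copC (y i))" .
qed

end

lemmas X_grade = ev_grade[OF calc_subalgebra.gen_X]

lemma reverses_X: "i \<in> {1..N} \<Longrightarrow> reverses 0 (ev (X i))"
  by (rule reverses_y[where y = "\<lambda>i. ev (X i)"]) (assumption | rule X_grade copC_X couC_X)+

lemma reverses_xi: "i \<in> {1..N} \<Longrightarrow> reverses 1 (\<gamma> (Xi i))"
  by (rule reverses_y[where y = "\<lambda>i. \<gamma> (Xi i)"]) (assumption | rule xi_grade copC_xi couC_xi)+

lemma SC_X: "i \<in> {1..N} \<Longrightarrow> SC (ev (X i)) = - (\<Sum>j=1..N. ev (X j) * fS j i)"
  by (rule SC_y[where y = "\<lambda>i. ev (X i)"]) (assumption | rule X_grade copC_X couC_X)+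

lemma SC_xi: "i \<in> {1..N} \<Longrightarrow> SC (\<gamma> (Xi i)) = - (\<Sum>j=1..N. \<gamma> (Xi j) * fS j i)"
  by (rule SC_y[where y = "\<lambda>i. \<gamma> (Xi i)"]) (assumption | rule xi_grade copC_xi couC_xi)+

lemma SC_delta_mult: "SC (\<gamma> Delta * z) = - (SC (C.twist 1 z) * \<gamma> Delta)"
proof -
  let ?a = "\<lambda>k::nat. if k = 0 then 1 else \<gamma> Delta"
  let ?b = "\<lambda>k::nat. if k = 0 then \<gamma> Delta else 1"
  let ?i = "\<lambda>k::nat. if k = 0 then 1 else (0::bit)"
  have "copC (\<gamma> Delta) = (\<Sum>k\<in>{0, 1}. ?a k \<otimes> ?b k)" by (simp add: copC_delta)
  moreover have "?b k \<in> G (?i k)" if "k \<in> {0, 1}" for k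
    using that by (auto simp: delta_grade C.grade_one)
  ultimately have "(\<Sum>k\<in>{0, 1}. SC (?a k * C.twist (?i k) z) * ?b k) = couC (\<gamma> Delta) *\<^sub>C SC z"
    by (rule A.SC_shift)
  then show ?thesis by (simp add: couC_delta C.twist_zero eq_neg_iff_add_eq_0 add.commute)
qed

lemma SC_delta: "SC (\<gamma> Delta) = - \<gamma> Delta"
  using SC_delta_mult[of 1] by (simp add: C.twist_one A.SC_one)

lemma reverses_delta: "reverses 1 (\<gamma> Delta)"
  unfolding reverses_def
  by (simp add: delta_grade SC_delta_mult SC_delta copC_delta clinear_neg[OF C.cop_linear]
      clinear_add[OF A.flip_SC_linear] A.flip_SC_even C.grade_one A.SC_one tensor_neg_left tensor_neg_right
      add.commute)

subsection \<open>The antipode is an antihomomorphism\<close>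

text \<open>Induction on the left factor with \<open>y\<close> arbitrary: \<open>reverses\<close>
  splits off one generator and associativity of \<open>gop\<close> regroups the rest.\<close>

lemma SC_mult: "SC (x * y) = C.gop (SC x) (SC y)"
proof (induction x arbitrary: y rule: generator_induct)
  have gen: "SC (g * w) = C.gop (SC g) (SC w)" if "reverses p g" for p g w
    using that by (simp add: reverses_def C.gop_left[OF A.SC_grade, of g p] A.SC_twist)
  have "SC (g * x * y) = C.gop (SC (g * x)) (SC y)"
    if "reverses p g" "\<And>y. SC (x * y) = C.gop (SC x) (SC y)" for p g x y
    by (simp add: mult.assoc gen[OF that(1)] that(2) C.gop_assoc)
  note step = this
  {
    case one
    show ?case by (simp add: A.SC_one C.gop_one)
  next
    case (add x y)
    then show ?case
      by (simp add: distrib_right clinear_add[OF A.SC_linear] clinear_add[OF cbilinearD(2)[OF C.gop_bilinear]])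
  next
    case (scale c x)
    then show ?case
      by (simp add: scaleC_mult_left clinear_scale[OF A.SC_linear] clinear_scale[OF cbilinearD(2)[OF C.gop_bilinear]])
  next
    case (f i j x)
    then show ?case by (intro step[OF reverses_f])
  next
    case (X i x)
    then show ?case by (intro step[OF reverses_X])
  next
    case (xi i x)
    then show ?case by (intro step[OF reverses_xi])
  next
    case (delta x)
    then show ?case by (intro step[OF reverses_delta])
  }
qed

lemma SC_algebra_antihom: "graded_algebra_antihom G SC"
  unfolding graded_algebra_antihom_def
  using A.SC_linear A.SC_grade A.SC_one by (auto simp: SC_mult C.gop_homogeneous)

text \<open>Splitting off a generator \<open>g\<close> reverses the two factors and twists the other
  one by the degree of \<open>g\<close>; \<open>flip_SC_gmult\<close> produces exactly the same
  twist on the tensor square.\<close>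

lemma copC_SC: "copC (SC x) = A.flip_SC (copC x)"
proof (induction x rule: generator_induct)
  have step: "copC (SC (g * x)) = A.flip_SC (copC (g * x))"
    if g: "reverses p g" and x: "copC (SC x) = A.flip_SC (copC x)" for p g x
  proof -
    have "copC (SC (g * x)) = C.gmult (copC (C.twist p (SC x))) (A.flip_SC (copC g))"
      using g by (simp add: reverses_def C.cop_mult A.SC_twist)
    also have "copC (C.twist p (SC x)) = A.flip_SC (tensor_map (C.twist p) (C.twist p) (copC x))"
      by (simp add: C.cop_twist x A.twist_flip_SC)
    also have "C.gmult \<dots> (A.flip_SC (copC g)) = A.flip_SC (C.gmult (copC g) (copC x))"
      using g by (intro A.flip_SC_gmult[symmetric] SC_mult C.cop_grade) (simp add: reverses_def)
    finally show ?thesis by (simp add: C.cop_mult)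
  qed
  {
    case one
    show ?case by (simp add: A.SC_one C.cop_one A.flip_SC_even C.grade_one)
  next
    case (add x y)
    then show ?case
      by (simp add: clinear_add[OF A.SC_linear] clinear_add[OF C.cop_linear] clinear_add[OF A.flip_SC_linear])
  next
    case (scale c x)
    then show ?case
      by (simp add: clinear_scale[OF A.SC_linear] clinear_scale[OF C.cop_linear] clinear_scale[OF A.flip_SC_linear])
  next
    case (f i j x)
    then show ?case by (intro step[OF reverses_f])
  next
    case (X i x)
    then show ?case by (intro step[OF reverses_X])
  next
    case (xi i x)
    then show ?case by (intro step[OF reverses_xi])
  next
    case (delta x)
    then show ?case by (intro step[OF reverses_delta])
  }
qed

lemma SC_coalgebra_antihom: "graded_coalgebra_antihom G copC couC SC"
  unfolding graded_coalgebra_antihom_def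
  using A.SC_linear A.SC_grade copC_SC A.cou_SC by (auto simp: A.flip_SC_def)

text \<open>Both maps are homomorphisms into the graded opposite algebra. Agreement on
  \<open>f\<close>, \<open>X\<close>, \<xi> and \<delta> suffices because these generate everything,
  including the remaining elements of \<E>.\<close>

lemma SC_unique:
  assumes T: "graded_algebra_antihom G T"
    and "\<And>i j. i \<in> {1..N} \<Longrightarrow> j \<in> {1..N} \<Longrightarrow> T (ev (f i j)) = SC (ev (f i j))"
    and "\<And>i. i \<in> {1..N} \<Longrightarrow> T (ev (X i)) = SC (ev (X i))"
    and "\<And>i. i \<in> {1..N} \<Longrightarrow> T (\<gamma> (Xi i)) = SC (\<gamma> (Xi i))"
    and "T (\<gamma> Delta) = SC (\<gamma> Delta)"
  shows "T = SC"
proof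
  have lin: "clinear T" and one: "T 1 = 1" using T by (simp_all add: graded_algebra_antihom_def)
  note mult = C.antihom_gop[OF T]
  show "T x = SC x" for x
    by (induction x rule: generator_induct)
      (simp_all add: one A.SC_one clinear_add[OF lin] clinear_add[OF A.SC_linear] clinear_scale[OF lin]
        clinear_scale[OF A.SC_linear] mult SC_mult assms)
qed

subsection \<open>Bijectivity\<close>

text \<open>Let T be the skew antipode. Both \<open>SC \<circ> T\<close> and
  \<open>T \<circ> SC\<close> are right convolution inverses of \<open>SC\<close>: the first because
  \<open>SC\<close> turns the graded opposite product into the product, the second because
  \<open>SC\<close> reverses coproducts. The identity is a left inverse of \<open>SC\<close>, so
  both composites equal it.\<close>

lemma SC_bij: "bij SC"
proof -
  obtain T where T: "clinear T" "\<And>x. convolve copC C.gop T (\<lambda>x. x) x = couC x *\<^sub>C 1"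
    "\<And>x. convolve copC C.gop (\<lambda>x. x) T x = couC x *\<^sub>C 1"
    by (rule skew_antipode_exists) (rule that)
  note id = clinear_ident(1)[where 'a = 'c] and S = A.SC_linear
  have CA: "convolution_algebra copC couC C.gop 1"
    by unfold_locales (simp_all add: C.coalg C.gop_bilinear C.gop_assoc C.gop_one)
  have T_grade: "x \<in> G i \<Longrightarrow> T x \<in> G i" for x i
    by (rule C.convolution_inverse_even(2)[OF CA C.twist_gop T])
  have left: "convolve copC (*) (\<lambda>x. x) SC = (\<lambda>x. couC x *\<^sub>C 1)"
    by (rule ext) (rule A.SC_right)
  have ST: "SC (T x) = x" for x
  proof -
    have S_gop: "SC (C.gop a b) = SC a * SC b" for a b
    proof (induction a rule: C.homogeneous_induct)
      case (homogeneous i a)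
      then show ?case
      proof (induction b rule: C.homogeneous_induct)
        case (homogeneous j b)
        then show ?case
          using A.SC_grade[OF homogeneous(1)] A.SC_grade[OF homogeneous(2)]
          by (simp add: C.gop_homogeneous clinear_scale[OF S] SC_mult scaleC_scaleC
              C.koszul_commute[of j i] C.koszul_square scaleC_one)
      qed (simp add: clinear_add[OF cbilinearD(1)[OF C.gop_bilinear]] clinear_add[OF S] distrib_left)
    qed (simp add: clinear_add[OF cbilinearD(2)[OF C.gop_bilinear]] clinear_add[OF S] distrib_right)
    have "convolve copC (*) SC (\<lambda>x. SC (T x)) = (\<lambda>x. couC x *\<^sub>C 1)"
    proof
      fix x
      have "SC (convolve copC C.gop (\<lambda>x. x) T x) = convolve copC (\<lambda>a b. SC (C.gop a b)) (\<lambda>x. x) T x"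
        by (rule convolve_comp[OF S C.gop_bilinear id T(1)])
      also have "\<dots> = convolve copC (*) SC (\<lambda>x. SC (T x)) x"
        by (rule convolve_cong) (rule S_gop)
      finally show "convolve copC (*) SC (\<lambda>x. SC (T x)) x = couC x *\<^sub>C 1"
        by (simp add: T(3) clinear_scale[OF S] A.SC_one)
    qed
    from A.CA.star_inverse_unique[OF id S clinear_comp[OF S T(1)] left this]
    show ?thesis by metis
  qed
  have TS: "T (SC x) = x" for x
  proof -
    have B: "cbilinear (\<lambda>a b. C.gop (T a) b)" by (rule cbilinear_comp[OF C.gop_bilinear T(1) id])
    have B': "cbilinear (\<lambda>a b. SC a * T (SC b))"
      by (rule cbilinear_comp[OF cbilinear_mult S clinear_comp[OF T(1) S]])
    have flip: "tensor_lift (\<lambda>a b. C.gop (T a) b) (A.flip_SC s) = tensor_lift (\<lambda>a b. SC a * T (SC b)) s" for s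
    proof (induction s rule: C.homogeneous_tensor_induct)
      case (pure a b i j)
      then show ?case
        using A.SC_grade[OF pure(1)] T_grade[OF A.SC_grade[OF pure(2)]]
        by (simp add: A.flip_SC_pure clinear_scale[OF tensor_lift_linear[OF B]] tensor_lift_pure[OF B]
            tensor_lift_pure[OF B'] C.gop_homogeneous scaleC_scaleC C.koszul_commute[of j i] C.koszul_square scaleC_one)
    qed (simp add: clinear_add[OF tensor_lift_linear[OF B]] clinear_add[OF tensor_lift_linear[OF B']]
        clinear_add[OF A.flip_SC_linear])
    have "convolve copC (*) SC (\<lambda>x. T (SC x)) = (\<lambda>x. couC x *\<^sub>C 1)"
    proof
      fix x
      have "convolve copC (*) SC (\<lambda>x. T (SC x)) x = convolve copC C.gop T (\<lambda>x. x) (SC x)"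
        by (simp add: convolve_def copC_SC flip)
      then show "convolve copC (*) SC (\<lambda>x. T (SC x)) x = couC x *\<^sub>C 1"
        by (simp add: T(2) A.cou_SC)
    qed
    from A.CA.star_inverse_unique[OF id S clinear_comp[OF T(1) S] left this]
    show ?thesis by metis
  qed
  show ?thesis by (rule o_bij[of T SC]) (simp_all add: fun_eq_iff ST TS)
qed

end

theorem proposition2p4:
  fixes cop :: "'a::complex_algebra_1 \<Rightarrow> ('a, 'a) tensor"
    and cou :: "'a \<Rightarrow> complex"
    and S :: "'a \<Rightarrow> 'a"
    and lm :: "'a \<Rightarrow> 'g::complex_vector \<Rightarrow> 'g"
    and rm :: "'g \<Rightarrow> 'a \<Rightarrow> 'g"
    and d :: "'a \<Rightarrow> 'g"
    and lco :: "'g \<Rightarrow> ('a, 'g) tensor"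
    and rco :: "'g \<Rightarrow> ('g, 'a) tensor"
    and N :: nat
    and \<omega> :: "nat \<Rightarrow> 'g"
    and f :: "nat \<Rightarrow> nat \<Rightarrow> 'a \<Rightarrow> complex"
    and J :: "nat \<Rightarrow> nat \<Rightarrow> 'a"
    and X :: "nat \<Rightarrow> 'a \<Rightarrow> complex"
    and t :: "nat \<Rightarrow> nat \<Rightarrow> nat \<Rightarrow> nat \<Rightarrow> complex"
    and \<gamma> :: "('a \<Rightarrow> complex) cartan_gen \<Rightarrow> 'c::complex_algebra_1"
    and copC :: "'c \<Rightarrow> ('c, 'c) tensor"
    and couC :: "'c \<Rightarrow> complex"
  defines "G \<equiv> cartan_grading cop cou N X f \<gamma>"
  assumes hopf: "hopf_algebra cop cou S" "bij S"
    and calculus: "bicovariant_fodc cop cou lm rm d lco rco"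
    and inv_basis: "basis_of N \<omega> (left_invariants lco)"
    and f_dual: "\<And>i j. i \<in> {1..N} \<Longrightarrow> j \<in> {1..N} \<Longrightarrow> f i j \<in> hopf_dual"
    and f_comm: "\<And>i x. i \<in> {1..N} \<Longrightarrow>
      rm (\<omega> i) x = (\<Sum>j=1..N. lm (dual_act cop (f i j) x) (\<omega> j))"
    and J_coaction: "\<And>i. i \<in> {1..N} \<Longrightarrow> rco (\<omega> i) = (\<Sum>j=1..N. \<omega> j \<otimes> J j i)"
    and tangent_basis: "basis_of N X (tangent_space cop cou S lm d)"
    and dual_basis: "\<And>i j. i \<in> {1..N} \<Longrightarrow> j \<in> {1..N} \<Longrightarrow>
      tangent_pairing cou lm d (X i) (\<omega> j) = (if i = j then 1 else 0)"
    and t_diag: "\<And>i j. i \<in> {1..N} \<Longrightarrow> j \<in> {1..N} \<Longrightarrow> t i j i j = 0"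
    and t_span: "transposed_braid_kernel N X (braid f J) =
      cvs.span {(X i \<otimes> X j) + (\<Sum>k=1..N. \<Sum>l=1..N. t i j k l *\<^sub>C (X k \<otimes> X l))
        | i j. i \<in> {1..N} \<and> j \<in> {1..N}}"
    and S_compatible: "\<And>i j. i \<in> {1..N} \<Longrightarrow> j \<in> {1..N} \<Longrightarrow>
      dual_antipode S (f i j) \<in> calc_subalgebra cop cou N X f"
    and cartan: "quantum_cartan_algebra cop cou N X f J t \<gamma>"
    and bialgebra: "graded_bialgebra G copC couC"
    and copC_X: "\<And>i. i \<in> {1..N} \<Longrightarrow> copC (\<gamma> (Even (X i))) =
      1 \<otimes> \<gamma> (Even (X i)) + (\<Sum>j=1..N. \<gamma> (Even (X j)) \<otimes> \<gamma> (Even (f j i)))"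
    and copC_f: "\<And>i j. i \<in> {1..N} \<Longrightarrow> j \<in> {1..N} \<Longrightarrow> copC (\<gamma> (Even (f i j))) =
      (\<Sum>k=1..N. \<gamma> (Even (f i k)) \<otimes> \<gamma> (Even (f k j)))"
    and copC_xi: "\<And>i. i \<in> {1..N} \<Longrightarrow> copC (\<gamma> (Xi i)) =
      1 \<otimes> \<gamma> (Xi i) + (\<Sum>j=1..N. \<gamma> (Xi j) \<otimes> \<gamma> (Even (f j i)))"
    and copC_delta: "copC (\<gamma> Delta) = 1 \<otimes> \<gamma> Delta + \<gamma> Delta \<otimes> 1"
    and couC_X: "\<And>i. i \<in> {1..N} \<Longrightarrow> couC (\<gamma> (Even (X i))) = 0"
    and couC_f: "\<And>i j. i \<in> {1..N} \<Longrightarrow> j \<in> {1..N} \<Longrightarrow>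
      couC (\<gamma> (Even (f i j))) = (if i = j then 1 else 0)"
    and couC_xi: "\<And>i. i \<in> {1..N} \<Longrightarrow> couC (\<gamma> (Xi i)) = 0"
    and couC_delta: "couC (\<gamma> Delta) = 0"
  shows "\<exists>S\<^sub>\<Gamma> :: 'c \<Rightarrow> 'c.
    (\<forall>T.
       graded_algebra_antihom G T \<and>
       (\<forall>i\<in>{1..N}. \<forall>j\<in>{1..N}.
          T (\<gamma> (Even (f i j))) = \<gamma> (Even (dual_antipode S (f i j)))) \<and>
       (\<forall>i\<in>{1..N}.
          T (\<gamma> (Even (X i))) =
            - (\<Sum>j=1..N. \<gamma> (Even (X j)) * \<gamma> (Even (dual_antipode S (f j i))))) \<and>
       (\<forall>i\<in>{1..N}.
          T (\<gamma> (Xi i)) =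
            - (\<Sum>j=1..N. \<gamma> (Xi j) * \<gamma> (Even (dual_antipode S (f j i))))) \<and>
       T (\<gamma> Delta) = - \<gamma> Delta
       \<longleftrightarrow> T = S\<^sub>\<Gamma>) \<and>
    graded_coalgebra_antihom G copC couC S\<^sub>\<Gamma> \<and>
    graded_hopf_algebra G copC couC S\<^sub>\<Gamma> \<and>
    bij S\<^sub>\<Gamma>"
proof -
  have f_linear: "clinear (f i j)" if "i \<in> {1..N}" "j \<in> {1..N}" for i j
    using f_dual[OF that] by (simp add: hopf_dual_def)
  interpret Q: quantum_cartan_bialgebra cop cou S lm rm d lco rco N \<omega> f J X t \<gamma> copC couC
    by (intro quantum_cartan_bialgebra.intro quantum_cartan_bialgebra_axioms.intro
        quantum_cartan.intro quantum_cartan_axioms.intro compatible_fodc.intro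
        compatible_fodc_axioms.intro fodc_structure.intro fodc_structure_axioms.intro
        hopf_structure.intro graded_bialg.intro)
      (assumption | rule hopf calculus inv_basis f_linear f_comm J_coaction tangent_basis dual_basis
        S_compatible cartan bialgebra[unfolded G_def] copC_X copC_f copC_xi copC_delta
        couC_X couC_f couC_xi couC_delta)+
  \<comment> \<open>Only some antipode is obtained here; its values on the generators and its
    antihomomorphism properties are consequences drawn from the locale below.\<close>
  obtain SC where SC: "is_antipode copC couC SC" by (rule Q.antipode_exists)
  interpret A: quantum_cartan_antipode cop cou S lm rm d lco rco N \<omega> f J X t \<gamma> copC couC SC
    by (intro quantum_cartan_antipode.intro graded_antipode.intro graded_antipode_axioms.intro
        Q.quantum_cartan_bialgebra_axioms Q.C.graded_bialg_axioms SC)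
  have SC_gens: "SC (\<gamma> (Even (f i j))) = \<gamma> (Even (dual_antipode S (f i j)))"
    "SC (\<gamma> (Even (X i))) = - (\<Sum>j=1..N. \<gamma> (Even (X j)) * \<gamma> (Even (dual_antipode S (f j i))))"
    "SC (\<gamma> (Xi i)) = - (\<Sum>j=1..N. \<gamma> (Xi j) * \<gamma> (Even (dual_antipode S (f j i))))"
    if "i \<in> {1..N}" "j \<in> {1..N}" for i j
    unfolding dual_antipode_def using that by (simp_all only: A.SC_f(2) A.SC_X A.SC_xi)
  show ?thesis
    unfolding G_def
  proof (intro exI[of _ SC] conjI allI iffI)
    fix T
    assume T: "graded_algebra_antihom (cartan_grading cop cou N X f \<gamma>) T \<and>
       (\<forall>i\<in>{1..N}. \<forall>j\<in>{1..N}.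
          T (\<gamma> (Even (f i j))) = \<gamma> (Even (dual_antipode S (f i j)))) \<and>
       (\<forall>i\<in>{1..N}.
          T (\<gamma> (Even (X i))) =
            - (\<Sum>j=1..N. \<gamma> (Even (X j)) * \<gamma> (Even (dual_antipode S (f j i))))) \<and>
       (\<forall>i\<in>{1..N}.
          T (\<gamma> (Xi i)) =
            - (\<Sum>j=1..N. \<gamma> (Xi j) * \<gamma> (Even (dual_antipode S (f j i))))) \<and>
       T (\<gamma> Delta) = - \<gamma> Delta"
    show "T = SC"
      by (rule A.SC_unique) (use T SC_gens A.SC_delta in auto)
  next
    fix T assume "T = SC"
    then show "graded_algebra_antihom (cartan_grading cop cou N X f \<gamma>) T"
      "\<forall>i\<in>{1..N}. \<forall>j\<in>{1..N}. T (\<gamma> (Even (f i j))) = \<gamma> (Even (dual_antipode S (f i j)))"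
      "\<forall>i\<in>{1..N}. T (\<gamma> (Even (X i))) =
        - (\<Sum>j=1..N. \<gamma> (Even (X j)) * \<gamma> (Even (dual_antipode S (f j i))))"
      "\<forall>i\<in>{1..N}. T (\<gamma> (Xi i)) =
        - (\<Sum>j=1..N. \<gamma> (Xi j) * \<gamma> (Even (dual_antipode S (f j i))))"
      "T (\<gamma> Delta) = - \<gamma> Delta"
      using A.SC_algebra_antihom SC_gens A.SC_delta by simp_all
  next
    show "graded_coalgebra_antihom (cartan_grading cop cou N X f \<gamma>) copC couC SC"
      by (rule A.SC_coalgebra_antihom)
    show "graded_hopf_algebra (cartan_grading cop cou N X f \<gamma>) copC couC SC"
      using bialgebra A.A.SC_grade SC by (auto simp: graded_hopf_algebra_def G_def)
    show "bij SC" by (rule A.SC_bij)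
  qed
qed

end
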